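(* Let $\mathcal{X}$ be a finite set with $|\mathcal{X}|\ge2$ and let $(\mathcal{X},\mathcal{E})$ be a strongly connected directed graph with $\mathcal{E}$ symmetric. The manifold $\mathcal{W}_{\mathsf{rev}}(\mathcal{X},\mathcal{E})$ of irreducible and reversible Markov kernels over $(\mathcal{X},\mathcal{E})$ is a doubly autoparallel submanifold of $\mathcal{W}(\mathcal{X},\mathcal{E})$ (i.e. autoparallel with respect to both the e-connection $\nabla^{(e)}$ and the m-connection $\nabla^{(m)}$), with dimension $$\dim\mathcal{W}_{\mathsf{rev}}(\mathcal{X},\mathcal{E})=\frac{|\mathcal{E}|+|T_0(\mathcal{E})|}{2}-1,\qquad T_0(\mathcal{E})=\{(x,x')\in\mathcal{E}:x=x'\}.$$
   Context: $\mathcal{E}\subset\mathcal{X}^2$ symmetric means $(x,x')\in\mathcal{E}\iff(x',x)\in\mathcal{E}$. $\mathcal{W}(\mathcal{X},\mathcal{E})$: row-stochastic matrices $P$ on $\mathcal{X}$ with $P(x,x')>0$ exactly for $(x,x')\in\mathcal{E}$, a smooth manifold of dimension $|\mathcal{E}|-|\mathcal{X}|$. Each such $P$ has a unique stationary distribution $\pi>0$ and edge measure $Q(x,x')=\pi(x)P(x,x')$. $\mathcal{W}_{\mathsf{rev}}(\mathcal{X},\mathcal{E})$: those $P\in\mathcal{W}(\mathcal{X},\mathcal{E})$ with $\pi(x)P(x,x')=\pi(x')P(x',x)$ for all $x,x'$. In a chart $\theta\mapsto P_\theta$ of $\mathcal{W}(\mathcal{X},\mathcal{E})$, with edge measures $Q_\theta$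 and $\partial_i=\partial/\partial\theta^i$, the Fisher metric is $\mathfrak{g}_{ij}(\theta)=\sum_{(x,x')\in\mathcal{E}}Q_\theta(x,x')\,\partial_i\log P_\theta(x,x')\,\partial_j\log P_\theta(x,x')$, and the e-connection $\nabla^{(e)}$ and m-connection $\nabla^{(m)}$ are the torsion-free affine connections on $\mathcal{W}(\mathcal{X},\mathcal{E})$ given by the Christoffel symbols $\Gamma_{ij,k}=\mathfrak{g}(\nabla_{\partial_i}\partial_j,\partial_k)$, $$\Gamma^{(e)}_{ij,k}(\theta)=\sum_{(x,x')\in\mathcal{E}}\partial_i\partial_j\log P_\theta(x,x')\,\partial_kQ_\theta(x,x'),\qquad \Gamma^{(m)}_{ij,k}(\theta)=\sum_{(x,x')\in\mathcal{E}}\partial_i\partial_jQ_\theta(x,x')\,\partial_k\log P_\theta(x,x').$$ A submanifold $\mathcal{V}$ of $\mathcal{W}(\mathcal{X},\mathcal{E})$ is autoparallel with respect to a connection $\nabla$ if $\nabla_XY$ is tangent to $\mathcal{V}$ for all vector fields $X,Y$ tangent to $\mathcal{V}$ (i.e. $\nabla_XY\in\Gamma(T\mathcal{V})$ for all $X,Y\in\Gamma(T\mathcal{V})$). *)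

theory Defs
  imports "HOL-Analysis.Analysis"
begin

section \<open>Smooth maps and submanifolds of Euclidean space\<close>

text \<open>\<open>C\<^sup>k\<close> maps on an open set \<open>S\<close>.\<close>

primrec Ck_on :: "nat \<Rightarrow> 'a set \<Rightarrow> ('a::real_normed_vector \<Rightarrow> 'b::real_normed_vector) \<Rightarrow> bool" where
  "Ck_on 0 S f \<longleftrightarrow> continuous_on S f"
| "Ck_on (Suc k) S f \<longleftrightarrow>
     (\<forall>p\<in>S. f differentiable (at p)) \<and> (\<forall>v. Ck_on k S (\<lambda>p. frechet_derivative f (at p) v))"

text \<open>On an arbitrary subset \<open>S\<close> of a Euclidean space, smooth means: locally the restriction of a
  \<open>C\<^sup>\<infinity>\<close> map on an open set of the ambient space. Values of \<open>f\<close> off \<open>S\<close> are irrelevant.\<close>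

definition smooth_on :: "'a set \<Rightarrow> ('a::real_normed_vector \<Rightarrow> 'b::real_normed_vector) \<Rightarrow> bool" where
  "smooth_on S f \<longleftrightarrow>
     (\<forall>p\<in>S. \<exists>N g. open N \<and> p \<in> N \<and> (\<forall>k. Ck_on k N g) \<and> (\<forall>q\<in>N \<inter> S. f q = g q))"

text \<open>Charts are given as parametrisations \<open>\<theta> \<mapsto> \<psi> \<theta>\<close>. The coordinate space \<open>\<real>\<^sup>m\<close> is realised as
  \<open>span I\<close> for a set \<open>I\<close> of \<open>m\<close> standard basis vectors of the ambient space (so that \<open>m\<close> may depend
  on a term, and \<open>m = 0\<close> is allowed). The coordinates of \<open>\<theta>\<close> are \<open>\<theta> \<bullet> i\<close> for \<open>i \<in> I\<close>. The smooth
  structure is the one induced from the ambient space.\<close>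

definition chart :: "'a set \<Rightarrow> 'a set \<Rightarrow> ('a \<Rightarrow> 'a) \<Rightarrow> 'a::euclidean_space set \<Rightarrow> bool" where
  "chart I U \<psi> M \<longleftrightarrow>
     I \<subseteq> Basis \<and> openin (top_of_set (span I)) U \<and>
     \<psi> ` U \<subseteq> M \<and> openin (top_of_set M) (\<psi> ` U) \<and> inj_on \<psi> U \<and>
     smooth_on U \<psi> \<and> smooth_on (\<psi> ` U) (inv_into U \<psi>)"

definition smooth_manifold :: "nat \<Rightarrow> 'a::euclidean_space set \<Rightarrow> bool" where
  "smooth_manifold m M \<longleftrightarrow> (\<forall>p\<in>M. \<exists>I U \<psi>. chart I U \<psi> M \<and> card I = m \<and> p \<in> \<psi> ` U)"

text \<open>Both \<open>V\<close> and \<open>W\<close> carry the structure induced from the ambient space, so the inclusion is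
  automatically a smooth embedding.\<close>

definition smooth_submanifold :: "'a::euclidean_space set \<Rightarrow> 'a set \<Rightarrow> bool" where
  "smooth_submanifold V W \<longleftrightarrow>
     V \<subseteq> W \<and> (\<exists>n. smooth_manifold n W) \<and> (\<exists>m. smooth_manifold m V)"

definition tangent_space :: "'a::euclidean_space set \<Rightarrow> 'a \<Rightarrow> 'a set" where
  "tangent_space M p =
     {v. \<exists>\<gamma> e. 0 < e \<and> smooth_on {-e<..<e::real} \<gamma> \<and> \<gamma> ` {-e<..<e} \<subseteq> M \<and> \<gamma> 0 = p \<and>
               (\<gamma> has_vector_derivative v) (at 0)}"

definition vector_fields :: "'a::euclidean_space set \<Rightarrow> ('a \<Rightarrow> 'a) set" where
  "vector_fields M = {X. smooth_on M X \<and> (\<forall>p\<in>M. X p \<in> tangent_space M p)}"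

text \<open>For \<open>v = i \<in> I\<close> this is the partial derivative \<open>\<partial>\<^sub>i\<close> of a function of the coordinates.\<close>

definition dir_deriv ::
  "'a::real_normed_vector \<Rightarrow> ('a \<Rightarrow> 'b::real_normed_vector) \<Rightarrow> 'a \<Rightarrow> 'b" where
  "dir_deriv v f \<theta> = vector_derivative (\<lambda>t::real. f (\<theta> + t *\<^sub>R v)) (at 0)"

definition coords :: "'a set \<Rightarrow> ('a \<Rightarrow> 'a) \<Rightarrow> 'a \<Rightarrow> 'a::euclidean_space \<Rightarrow> 'a" where
  "coords I \<psi> \<theta> v = (THE \<xi>. \<xi> \<in> span I \<and> dir_deriv \<xi> \<psi> \<theta> = v)"


section \<open>Markov kernels\<close>

type_synonym 'x kernel = "real ^ 'x ^ 'x"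

definition markov_kernels :: "('x::finite \<times> 'x) set \<Rightarrow> 'x kernel set" where
  "markov_kernels E =
     {P. (\<forall>x. (\<Sum>y\<in>UNIV. P $ x $ y) = 1) \<and> (\<forall>x y. 0 \<le> P $ x $ y) \<and>
         (\<forall>x y. 0 < P $ x $ y \<longleftrightarrow> (x, y) \<in> E)}"

definition stationary :: "'x::finite kernel \<Rightarrow> real ^ 'x" where
  "stationary P = (THE \<pi>. (\<forall>x. 0 \<le> \<pi> $ x) \<and> (\<Sum>x\<in>UNIV. \<pi> $ x) = 1 \<and> \<pi> v* P = \<pi>)"

definition edge_measure :: "'x::finite kernel \<Rightarrow> 'x kernel" where
  "edge_measure P = (\<chi> x y. stationary P $ x * P $ x $ y)"

definition reversible_kernels :: "('x::finite \<times> 'x) set \<Rightarrow> 'x kernel set" where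
  "reversible_kernels E =
     {P \<in> markov_kernels E. \<forall>x y. stationary P $ x * P $ x $ y = stationary P $ y * P $ y $ x}"


section \<open>Fisher metric, e-connection and m-connection\<close>

definition fisher_metric ::
  "('x::finite \<times> 'x) set \<Rightarrow> ('x kernel \<Rightarrow> 'x kernel) \<Rightarrow> 'x kernel \<Rightarrow> 'x kernel \<Rightarrow> 'x kernel \<Rightarrow> real"
where
  "fisher_metric E \<psi> i j \<theta> =
     (\<Sum>(x, y)\<in>E. edge_measure (\<psi> \<theta>) $ x $ y *
        dir_deriv i (\<lambda>\<theta>. ln (\<psi> \<theta> $ x $ y)) \<theta> * dir_deriv j (\<lambda>\<theta>. ln (\<psi> \<theta> $ x $ y)) \<theta>)"

text \<open>A connection is given by its Christoffel symbols of the first kind: \<open>G \<psi> i j k \<theta>\<close> is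
  \<open>\<Gamma>\<^bsub>ij,k\<^esub>(\<theta>)\<close> in the chart \<open>\<psi>\<close>.\<close>

type_synonym 'x christoffel =
  "('x kernel \<Rightarrow> 'x kernel) \<Rightarrow> 'x kernel \<Rightarrow> 'x kernel \<Rightarrow> 'x kernel \<Rightarrow> 'x kernel \<Rightarrow> real"

definition christoffel_e :: "('x::finite \<times> 'x) set \<Rightarrow> 'x christoffel" where
  "christoffel_e E \<psi> i j k \<theta> =
     (\<Sum>(x, y)\<in>E. dir_deriv i (dir_deriv j (\<lambda>\<theta>. ln (\<psi> \<theta> $ x $ y))) \<theta> *
        dir_deriv k (\<lambda>\<theta>. edge_measure (\<psi> \<theta>) $ x $ y) \<theta>)"

definition christoffel_m :: "('x::finite \<times> 'x) set \<Rightarrow> 'x christoffel" where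
  "christoffel_m E \<psi> i j k \<theta> =
     (\<Sum>(x, y)\<in>E. dir_deriv i (dir_deriv j (\<lambda>\<theta>. edge_measure (\<psi> \<theta>) $ x $ y)) \<theta> *
        dir_deriv k (\<lambda>\<theta>. ln (\<psi> \<theta> $ x $ y)) \<theta>)"

text \<open>The coordinate vector \<open>c\<close> of \<open>\<nabla>\<^bsub>\<partial>i\<^esub>\<partial>\<^sub>j\<close>, determined by \<open>g(\<nabla>\<^bsub>\<partial>i\<^esub>\<partial>\<^sub>j, \<partial>\<^sub>k) = \<Gamma>\<^bsub>ij,k\<^esub>\<close> for all \<open>k\<close>.\<close>

definition nabla_basis ::
  "('x::finite \<times> 'x) set \<Rightarrow> 'x christoffel \<Rightarrow> 'x kernel set \<Rightarrow> ('x kernel \<Rightarrow> 'x kernel) \<Rightarrow>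
   'x kernel \<Rightarrow> 'x kernel \<Rightarrow> 'x kernel \<Rightarrow> 'x kernel"
where
  "nabla_basis E G I \<psi> i j \<theta> =
     (THE c. c \<in> span I \<and> (\<forall>k\<in>I. (\<Sum>l\<in>I. (c \<bullet> l) * fisher_metric E \<psi> l k \<theta>) = G \<psi> i j k \<theta>))"

text \<open>\<open>\<nabla>\<^bsub>X\<^esub>Y\<close> at \<open>\<psi> \<theta> \<in> V\<close>, in the coordinates of the chart \<open>\<psi>\<close> of the kernel manifold, for vector
  fields \<open>X\<close>, \<open>Y\<close> on a submanifold \<open>V\<close>: with \<open>\<xi>\<close>, \<open>\<eta>\<close> the coordinate expressions of \<open>X\<close>, \<open>Y\<close>, it is
  \<open>\<xi>\<^sup>i \<partial>\<^sub>i\<eta> + \<xi>\<^sup>i \<eta>\<^sup>j \<nabla>\<^bsub>\<partial>i\<^esub>\<partial>\<^sub>j\<close>. As \<open>\<eta>\<close> is only given on \<open>\<psi>\<^sup>-\<^sup>1(V)\<close>, the first term is a derivative within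
  that set; a derivative \<open>D\<close> within a submanifold is not unique, but its value on the tangent
  vector \<open>\<xi>\<close> is, and it equals the value obtained from any local extension of \<open>Y\<close>. For \<open>V\<close> the whole
  manifold this is the usual coordinate formula.\<close>

definition nabla_coords ::
  "('x::finite \<times> 'x) set \<Rightarrow> 'x christoffel \<Rightarrow> 'x kernel set \<Rightarrow> 'x kernel set \<Rightarrow>
   ('x kernel \<Rightarrow> 'x kernel) \<Rightarrow> 'x kernel set \<Rightarrow> ('x kernel \<Rightarrow> 'x kernel) \<Rightarrow>
   ('x kernel \<Rightarrow> 'x kernel) \<Rightarrow> 'x kernel \<Rightarrow> 'x kernel"
where
  "nabla_coords E G I U \<psi> V X Y \<theta> =
     (let \<xi> = coords I \<psi> \<theta> (X (\<psi> \<theta>));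
          \<eta> = (\<lambda>\<theta>. coords I \<psi> \<theta> (Y (\<psi> \<theta>)))
      in (THE w. \<exists>D. (\<eta> has_derivative D) (at \<theta> within {\<theta> \<in> U. \<psi> \<theta> \<in> V}) \<and> w = D \<xi>) +
         (\<Sum>i\<in>I. \<Sum>j\<in>I. ((\<xi> \<bullet> i) * (\<eta> \<theta> \<bullet> j)) *\<^sub>R nabla_basis E G I \<psi> i j \<theta>))"

text \<open>The tangent vector \<open>(\<nabla>\<^bsub>X\<^esub>Y)(p)\<close> is the one having the above coordinates in every chart
  around \<open>p\<close>.\<close>

definition nabla ::
  "('x::finite \<times> 'x) set \<Rightarrow> 'x christoffel \<Rightarrow> 'x kernel set \<Rightarrow> ('x kernel \<Rightarrow> 'x kernel) \<Rightarrow>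
   ('x kernel \<Rightarrow> 'x kernel) \<Rightarrow> 'x kernel \<Rightarrow> 'x kernel"
where
  "nabla E G V X Y p =
     (THE z. \<forall>I U \<psi> \<theta>. chart I U \<psi> (markov_kernels E) \<and> \<theta> \<in> U \<and> \<psi> \<theta> = p \<longrightarrow>
        dir_deriv (nabla_coords E G I U \<psi> V X Y \<theta>) \<psi> \<theta> = z)"

definition autoparallel :: "('x::finite \<times> 'x) set \<Rightarrow> 'x christoffel \<Rightarrow> 'x kernel set \<Rightarrow> bool" where
  "autoparallel E G V \<longleftrightarrow>
     (\<forall>X\<in>vector_fields V. \<forall>Y\<in>vector_fields V. nabla E G V X Y \<in> vector_fields V)"

definition doubly_autoparallel_submanifold ::
  "('x::finite \<times> 'x) set \<Rightarrow> 'x kernel set \<Rightarrow> bool" where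
  "doubly_autoparallel_submanifold E V \<longleftrightarrow>
     smooth_submanifold V (markov_kernels E) \<and>
     autoparallel E (christoffel_e E) V \<and> autoparallel E (christoffel_m E) V"

end

theory Submission
  imports Defs
begin

text \<open>In the coordinates \<open>Q\<close> (edge measures), the kernels form an open piece of an affine space in
  which the reversible ones are cut out by the linear equations \<open>Q(x, y) = Q(y, x)\<close>; this gives the
  manifold structure, the dimension and the m-autoparallelity. For the e-connection,
  \<open>\<nabla>\<^sub>XY\<close> is the tangent vector \<open>z\<close> for which \<open>z / P - X (Y log P)\<close> annihilates all tangent
  vectors in \<open>Q\<close>-coordinates, that is, \<open>z(x, y) / P(x, y) = X (Y log P(x, y)) + f(y) - f(x) + c\<close>
  with \<open>f\<close> and \<open>c\<close> determined by a Poisson equation for \<open>P\<close>. On reversible kernels the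
  antisymmetric part of \<open>X (Y log P)\<close> is a coboundary, hence so is that of \<open>z / P\<close>, which is tangency
  to the reversible kernels. Both the stationary distribution and \<open>f\<close> are smooth by Cramer's
  rule.\<close>

section \<open>Calculus of smooth maps\<close>

text \<open>The obstacle is that \<open>nabla\<close> is a description over all charts, built from
  further descriptions (coordinates, a derivative within a preimage, solutions of linear systems),
  for fields that have meaning on the submanifold only. The way out is a chart-free test. For (a, b)
  either ordering of log P and Q, the covariant derivative is the only tangent vector z with \<Sum>
  da(z) db(k) = \<Sum> X(Y a) db(k) for all tangent k; it is unique since the Fisher metric is
  definite. So it is enough to exhibit z, and an explicit formula also yields the smoothness that
  \<open>vector_fields\<close> demands. For the e-connection the freedom f(y) - f(x) + c arises
  because the derivative of an edge measure has equal row and column sums and total mass 0; the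
  Poisson equation then says that the rows of z sum to 0. Reversibility of z uses one more freedom:
  adding to a direction of edge measures Q(x, y) times a function of x does not change the resulting
  direction of kernels, and a suitable function makes the former symmetric.\<close>

abbreviation Dd :: "('a::real_normed_vector \<Rightarrow> 'b::real_normed_vector) \<Rightarrow> 'a \<Rightarrow> 'a \<Rightarrow> 'b" where
  "Dd f p \<equiv> frechet_derivative f (at p)"

lemma Dd_eqI: "(f has_derivative F) (at p) \<Longrightarrow> Dd f p = F"
  by (metis frechet_derivative_at)

lemma Dd_works: "f differentiable (at p) \<Longrightarrow> (f has_derivative Dd f p) (at p)"
  by (simp add: frechet_derivative_works)

lemma Dd_cong:
  assumes "open S" "p \<in> S" "\<And>q. q \<in> S \<Longrightarrow> f q = g q"
  shows "f differentiable (at p) \<longleftrightarrow> g differentiable (at p)" and "Dd f p = Dd g p"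
proof -
  have *: "(f has_derivative F) (at p) \<longleftrightarrow> (g has_derivative F) (at p)" for F
    using assms by (metis has_derivative_transform_within_open)
  show "f differentiable (at p) \<longleftrightarrow> g differentiable (at p)"
    unfolding differentiable_def using * by blast
  show "Dd f p = Dd g p"
    unfolding frechet_derivative_def using * by simp
qed

lemma Ck_on_cong:
  assumes "open S" "\<And>q. q \<in> S \<Longrightarrow> f q = g q"
  shows "Ck_on k S f \<longleftrightarrow> Ck_on k S g"
  using assms(2)
proof (induction k arbitrary: f g)
  case 0
  then show ?case by (simp cong: continuous_on_cong)
next
  case (Suc k)
  have "Ck_on k S (\<lambda>p. Dd f p v) \<longleftrightarrow> Ck_on k S (\<lambda>p. Dd g p v)" for v
    by (rule Suc.IH) (use Dd_cong(2)[OF assms(1) _ Suc.prems] in auto)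
  moreover have "f differentiable (at p) \<longleftrightarrow> g differentiable (at p)" if "p \<in> S" for p
    using Dd_cong(1)[OF assms(1) that Suc.prems] .
  ultimately show ?case by simp
qed

lemma Ck_on_subset: "Ck_on k S f \<Longrightarrow> T \<subseteq> S \<Longrightarrow> Ck_on k T f"
proof (induction k arbitrary: f)
  case 0
  then show ?case by (auto intro: continuous_on_subset)
next
  case (Suc k)
  then show ?case by (auto simp: subset_iff)
qed

lemma Ck_on_local:
  assumes "\<And>p. p \<in> S \<Longrightarrow> \<exists>N. open N \<and> p \<in> N \<and> Ck_on k N f"
  shows "Ck_on k S f"
  using assms
proof (induction k arbitrary: f)
  case 0
  then show ?case
    by (auto intro!: continuous_at_imp_continuous_on simp: continuous_on_eq_continuous_at)
      (metis continuous_on_eq_continuous_at)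
next
  case (Suc k)
  have "f differentiable (at p)" if "p \<in> S" for p
    using Suc.prems[OF that] by auto
  moreover have "Ck_on k S (\<lambda>p. Dd f p v)" for v
  proof (rule Suc.IH)
    fix p assume "p \<in> S"
    then show "\<exists>N. open N \<and> p \<in> N \<and> Ck_on k N (\<lambda>p. Dd f p v)"
      using Suc.prems by fastforce
  qed
  ultimately show ?case by simp
qed

lemma Ck_on_Suc_D: "Ck_on (Suc k) S f \<Longrightarrow> Ck_on k S f"
proof (induction k arbitrary: f)
  case 0
  then show ?case
    by (auto intro!: continuous_at_imp_continuous_on differentiable_imp_continuous_within)
next
  case (Suc k)
  then show ?case by (metis Ck_on.simps(2))
qed

lemma Ck_on_const: "Ck_on k S (\<lambda>p. c)"
  by (induction k arbitrary: c) (auto simp: frechet_derivative_const)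

lemma Ck_on_bounded_linear: "bounded_linear f \<Longrightarrow> Ck_on k S f"
proof (induction k)
  case 0
  then show ?case by (simp add: linear_continuous_on)
next
  case (Suc k)
  have "(f has_derivative f) (at p)" for p
    using Suc.prems by (rule bounded_linear_imp_has_derivative)
  then have "Dd f p = f" "f differentiable (at p)" for p
    by (auto simp: Dd_eqI differentiable_def)
  then show ?case by (simp add: Ck_on_const)
qed

lemma Ck_on_add:
  assumes "open S" "Ck_on k S f" "Ck_on k S g"
  shows "Ck_on k S (\<lambda>p. f p + g p)"
  using assms(2,3)
proof (induction k arbitrary: f g)
  case 0
  then show ?case by (simp add: continuous_on_add)
next
  case (Suc k)
  have hd: "((\<lambda>p. f p + g p) has_derivative (\<lambda>v. Dd f p v + Dd g p v)) (at p)" if "p \<in> S" for p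
    using Suc.prems that by (intro has_derivative_add Dd_works) auto
  have "Ck_on k S (\<lambda>p. Dd (\<lambda>p. f p + g p) p v)" for v
  proof -
    have "Ck_on k S (\<lambda>p. Dd f p v + Dd g p v)"
      using Suc by simp
    then show ?thesis
      by (rule Ck_on_cong[OF assms(1), THEN iffD1, rotated]) (simp add: Dd_eqI[OF hd])
  qed
  then show ?case using hd by (auto simp: differentiable_def)
qed

text \<open>One induction serves scalar multiples, real products and inner products. The Leibniz
  rule also involves the undifferentiated factors, whence \<open>Ck_on_Suc_D\<close>.\<close>

lemma (in bounded_bilinear) Ck_on_prod:
  assumes "open S" "Ck_on k S f" "Ck_on k S g"
  shows "Ck_on k S (\<lambda>p. prod (f p) (g p))"
  using assms(2,3)
proof (induction k arbitrary: f g)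
  case 0
  then show ?case by (simp add: continuous_on)
next
  case (Suc k)
  have hd: "((\<lambda>p. prod (f p) (g p)) has_derivative (\<lambda>v. prod (f p) (Dd g p v) + prod (Dd f p v) (g p))) (at p)"
    if "p \<in> S" for p
    using Suc.prems that by (intro FDERIV Dd_works) auto
  have "Ck_on k S (\<lambda>p. Dd (\<lambda>p. prod (f p) (g p)) p v)" for v
  proof -
    have "Ck_on k S f" "Ck_on k S g"
      using Suc.prems Ck_on_Suc_D by blast+
    then have "Ck_on k S (\<lambda>p. prod (f p) (Dd g p v) + prod (Dd f p v) (g p))"
      using Suc by (intro Ck_on_add[OF assms(1)] Suc.IH) simp_all
    then show ?thesis
      by (rule Ck_on_cong[OF assms(1), THEN iffD1, rotated]) (simp add: Dd_eqI[OF hd])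
  qed
  then show ?case using hd by (auto simp: differentiable_def)
qed

lemma Ck_on_sum:
  assumes "open S" "\<And>i. i \<in> I \<Longrightarrow> Ck_on k S (f i)"
  shows "Ck_on k S (\<lambda>p. \<Sum>i\<in>I. f i p)"
  using assms(2)
  by (induction I rule: infinite_finite_induct) (auto simp: Ck_on_const intro!: Ck_on_add[OF assms(1)])

lemma Dd_basis_expansion:
  fixes f :: "'a::euclidean_space \<Rightarrow> 'b::real_normed_vector"
  assumes "f differentiable (at p)"
  shows "Dd f p v = (\<Sum>b\<in>Basis. (v \<bullet> b) *\<^sub>R Dd f p b)"
proof -
  have l: "linear (Dd f p)"
    using assms by (rule linear_frechet_derivative)
  have "Dd f p v = Dd f p (\<Sum>b\<in>Basis. (v \<bullet> b) *\<^sub>R b)"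
    by (simp add: euclidean_representation)
  also have "\<dots> = (\<Sum>b\<in>Basis. (v \<bullet> b) *\<^sub>R Dd f p b)"
    by (simp add: linear_sum[OF l] linear_cmul[OF l])
  finally show ?thesis .
qed

text \<open>In the chain rule the direction \<open>Dd f p v\<close> moves with the point, while the
  induction hypothesis for derivatives of \<open>g\<close> needs a fixed direction. Expansion along
  the basis of the intermediate space isolates fixed directions \<open>b\<close>; the coefficients
  are left to the product rule.\<close>

lemma Ck_on_compose:
  fixes f :: "'a::real_normed_vector \<Rightarrow> 'b::euclidean_space"
  assumes "open S" "open T" "f ` S \<subseteq> T" "Ck_on k S f" "Ck_on k T g"
  shows "Ck_on k S (\<lambda>p. g (f p))"
  using assms(4,5)
proof (induction k arbitrary: g)
  case 0
  then show ?case using assms(3) by (auto intro: continuous_on_compose2)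
next
  case (Suc k)
  have hd: "((\<lambda>p. g (f p)) has_derivative (\<lambda>v. Dd g (f p) (Dd f p v))) (at p)"
    if "p \<in> S" for p
    using Suc.prems that assms(3) by (intro has_derivative_compose[OF Dd_works Dd_works]) auto
  have "Ck_on k S (\<lambda>p. Dd (\<lambda>p. g (f p)) p v)" for v
  proof -
    have fk: "Ck_on k S f" using Suc.prems Ck_on_Suc_D by blast
    have "Ck_on k S (\<lambda>p. \<Sum>b\<in>Basis. (Dd f p v \<bullet> b) *\<^sub>R Dd g (f p) b)"
    proof (intro Ck_on_sum[OF assms(1)] bounded_bilinear.Ck_on_prod[OF bounded_bilinear_scaleR] assms(1))
      fix b :: 'b assume "b \<in> Basis"
      show "Ck_on k S (\<lambda>p. Dd f p v \<bullet> b)"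
        using Suc.prems by (intro bounded_bilinear.Ck_on_prod[OF bounded_bilinear_inner] assms(1) Ck_on_const) auto
      show "Ck_on k S (\<lambda>p. Dd g (f p) b)"
        using Suc.prems fk by (intro Suc.IH) auto
    qed
    then show ?thesis
    proof (rule Ck_on_cong[OF assms(1), THEN iffD1, rotated])
      fix q assume q: "q \<in> S"
      then have "g differentiable (at (f q))" using Suc.prems assms(3) by auto
      then show "(\<Sum>b\<in>Basis. (Dd f q v \<bullet> b) *\<^sub>R Dd g (f q) b) = Dd (\<lambda>p. g (f p)) q v"
        by (simp add: Dd_eqI[OF hd[OF q]] flip: Dd_basis_expansion)
    qed
  qed
  then show ?case using hd by (auto simp: differentiable_def)
qed

text \<open>The derivative is a polynomial in \<open>inverse\<close> itself, so the product rule
  lifts order \<open>k\<close> to order \<open>Suc k\<close>.\<close>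

lemma Ck_on_inverse: "Ck_on k (- {0::real}) inverse"
proof (induction k)
  case 0
  then show ?case by (auto intro!: continuous_intros)
next
  case (Suc k)
  have hd: "(inverse has_derivative (\<lambda>v. - (inverse p * v * inverse p))) (at p)" if "p \<in> - {0}" for p :: real
    using that by (intro has_derivative_inverse') auto
  have "Ck_on k (- {0}) (\<lambda>p::real. Dd inverse p v)" for v
  proof -
    have "Ck_on k (- {0}) (\<lambda>p. (- v * inverse p) * inverse p)"
      by (intro bounded_bilinear.Ck_on_prod[OF bounded_bilinear_mult] Ck_on_const Suc) auto
    then show ?thesis
      by (rule Ck_on_cong[THEN iffD1, rotated 2]) (auto simp: Dd_eqI[OF hd])
  qed
  then show ?case using hd by (auto simp: differentiable_def)
qed

lemma Ck_on_ln: "Ck_on k {0::real<..} ln"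
proof (cases k)
  case 0
  then show ?thesis by (auto intro!: continuous_intros)
next
  case (Suc j)
  have hd: "(ln has_derivative (\<lambda>v. v * inverse p)) (at p)" if "p \<in> {0<..}" for p :: real
    using that by (auto intro!: derivative_eq_intros)
  have "Ck_on j {0<..} (\<lambda>p::real. Dd ln p v)" for v
  proof -
    have "Ck_on j {0<..} (\<lambda>p. v * inverse p)"
      by (intro bounded_bilinear.Ck_on_prod[OF bounded_bilinear_mult] Ck_on_const
            Ck_on_subset[OF Ck_on_inverse]) auto
    then show ?thesis
      by (rule Ck_on_cong[THEN iffD1, rotated 2]) (auto simp: Dd_eqI[OF hd])
  qed
  then show ?thesis using hd Suc by (auto simp: differentiable_def)
qed

text \<open>Openness is part of the notion because \<open>Dd\<close> is taken at interior points; it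
  spares most closure rules a side condition.\<close>

definition Cinf :: "'a::real_normed_vector set \<Rightarrow> ('a \<Rightarrow> 'b::real_normed_vector) \<Rightarrow> bool" where
  "Cinf S f \<longleftrightarrow> open S \<and> (\<forall>k. Ck_on k S f)"

lemma Cinf_open: "Cinf S f \<Longrightarrow> open S"
  by (simp add: Cinf_def)

lemma Cinf_differentiable: "Cinf S f \<Longrightarrow> p \<in> S \<Longrightarrow> f differentiable (at p)"
  by (metis Cinf_def Ck_on.simps(2))

lemma Cinf_has_derivative: "Cinf S f \<Longrightarrow> p \<in> S \<Longrightarrow> (f has_derivative Dd f p) (at p)"
  by (intro Dd_works Cinf_differentiable)

lemma Cinf_linear_Dd: "Cinf S f \<Longrightarrow> p \<in> S \<Longrightarrow> linear (Dd f p)"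
  by (intro linear_frechet_derivative Cinf_differentiable)

lemma Cinf_continuous_on: "Cinf S f \<Longrightarrow> continuous_on S f"
  by (metis Cinf_def Ck_on.simps(1))

lemma Cinf_subset: "Cinf S f \<Longrightarrow> open T \<Longrightarrow> T \<subseteq> S \<Longrightarrow> Cinf T f"
  by (auto simp: Cinf_def intro: Ck_on_subset)

lemma Cinf_cong:
  assumes "Cinf S f" "\<And>q. q \<in> S \<Longrightarrow> g q = f q" shows "Cinf S g"
  using assms Ck_on_cong[of S f g] by (auto simp: Cinf_def)

lemma Cinf_const: "open S \<Longrightarrow> Cinf S (\<lambda>p. c)"
  by (simp add: Cinf_def Ck_on_const)

lemma Cinf_bounded_linear: "bounded_linear f \<Longrightarrow> open S \<Longrightarrow> Cinf S f"
  by (simp add: Cinf_def Ck_on_bounded_linear)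

lemma Cinf_linear:
  fixes f :: "'a::euclidean_space \<Rightarrow> 'b::real_normed_vector"
  shows "linear f \<Longrightarrow> open S \<Longrightarrow> Cinf S f"
  by (simp add: Cinf_bounded_linear linear_conv_bounded_linear)

lemma Cinf_ident: "open S \<Longrightarrow> Cinf S (\<lambda>p. p)"
  by (rule Cinf_bounded_linear) (rule bounded_linear_ident)

lemma Cinf_add: "Cinf S f \<Longrightarrow> Cinf S g \<Longrightarrow> Cinf S (\<lambda>p. f p + g p)"
  by (simp add: Cinf_def Ck_on_add)

lemma Cinf_sum: "open S \<Longrightarrow> (\<And>i. i \<in> I \<Longrightarrow> Cinf S (f i)) \<Longrightarrow> Cinf S (\<lambda>p. \<Sum>i\<in>I. f i p)"
  by (simp add: Cinf_def Ck_on_sum)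

lemma Cinf_scaleR: "Cinf S f \<Longrightarrow> Cinf S g \<Longrightarrow> Cinf S (\<lambda>p. f p *\<^sub>R g p)"
  by (simp add: Cinf_def bounded_bilinear.Ck_on_prod[OF bounded_bilinear_scaleR])

lemma Cinf_mult:
  fixes f :: "_ \<Rightarrow> real"
  shows "Cinf S f \<Longrightarrow> Cinf S g \<Longrightarrow> Cinf S (\<lambda>p. f p * g p)"
  by (simp add: Cinf_def bounded_bilinear.Ck_on_prod[OF bounded_bilinear_mult])

lemma Cinf_inner: "Cinf S f \<Longrightarrow> Cinf S g \<Longrightarrow> Cinf S (\<lambda>p. f p \<bullet> g p)"
  by (simp add: Cinf_def bounded_bilinear.Ck_on_prod[OF bounded_bilinear_inner])

lemma Cinf_compose:
  fixes f :: "'a::real_normed_vector \<Rightarrow> 'b::euclidean_space"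
  assumes "Cinf S f" "Cinf T g" "f ` S \<subseteq> T"
  shows "Cinf S (\<lambda>p. g (f p))"
  using assms by (auto simp: Cinf_def intro: Ck_on_compose)

lemma Cinf_minus: "Cinf S f \<Longrightarrow> Cinf S (\<lambda>p. - f p)"
  using Cinf_scaleR[OF Cinf_const[of S "-1::real"], of f] by (simp add: Cinf_open)

lemma Cinf_diff: "Cinf S f \<Longrightarrow> Cinf S g \<Longrightarrow> Cinf S (\<lambda>p. f p - g p)"
  using Cinf_add[OF _ Cinf_minus, of S f g] by simp

lemma Cinf_prod:
  fixes f :: "_ \<Rightarrow> _ \<Rightarrow> real"
  shows "open S \<Longrightarrow> (\<And>i. i \<in> I \<Longrightarrow> Cinf S (f i)) \<Longrightarrow> Cinf S (\<lambda>p. \<Prod>i\<in>I. f i p)"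
  by (induction I rule: infinite_finite_induct) (auto intro: Cinf_const Cinf_mult)

lemma Cinf_inverse:
  fixes f :: "_ \<Rightarrow> real"
  assumes "Cinf S f" "\<And>p. p \<in> S \<Longrightarrow> f p \<noteq> 0"
  shows "Cinf S (\<lambda>p. inverse (f p))"
  by (rule Cinf_compose[OF assms(1), where T="- {0}"]) (use assms(2) in \<open>auto simp: Cinf_def Ck_on_inverse\<close>)

lemma Cinf_divide:
  fixes f :: "_ \<Rightarrow> real"
  assumes "Cinf S f" "Cinf S g" "\<And>p. p \<in> S \<Longrightarrow> g p \<noteq> 0"
  shows "Cinf S (\<lambda>p. f p / g p)"
  unfolding divide_inverse by (intro Cinf_mult Cinf_inverse assms)

lemma Cinf_ln:
  fixes f :: "_ \<Rightarrow> real"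
  assumes "Cinf S f" "\<And>p. p \<in> S \<Longrightarrow> 0 < f p"
  shows "Cinf S (\<lambda>p. ln (f p))"
  by (rule Cinf_compose[OF assms(1), where T="{0<..}"]) (use assms(2) in \<open>auto simp: Cinf_def Ck_on_ln\<close>)

lemma Cinf_det:
  fixes M :: "_ \<Rightarrow> real^'n^'n"
  assumes "open S" "\<And>i j. Cinf S (\<lambda>p. M p $ i $ j)"
  shows "Cinf S (\<lambda>p. det (M p))"
  unfolding det_def by (intro Cinf_sum Cinf_mult Cinf_const Cinf_prod assms)

text \<open>\<open>Ck_on\<close> speaks of fixed directions; the basis expansion extends it to a
  direction varying with the point. With vector fields as directions, iterated derivatives X(Y f)
  stay smooth.\<close>

lemma Cinf_Dd:
  fixes f :: "'a::euclidean_space \<Rightarrow> 'b::real_normed_vector"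
  assumes "Cinf S f" "Cinf S X"
  shows "Cinf S (\<lambda>p. Dd f p (X p))"
proof (rule Cinf_cong)
  have "Cinf S (\<lambda>p. Dd f p b)" for b
    using assms(1) by (metis Cinf_def Ck_on.simps(2))
  then show "Cinf S (\<lambda>p. \<Sum>b\<in>Basis. (X p \<bullet> b) *\<^sub>R Dd f p b)"
    using assms by (intro Cinf_sum Cinf_scaleR Cinf_inner Cinf_const) (auto simp: Cinf_open)
qed (simp add: Dd_basis_expansion[OF Cinf_differentiable[OF assms(1)]])

lemma Cinf_nth: "Cinf S (f :: _ \<Rightarrow> ('b::euclidean_space)^'n) \<Longrightarrow> Cinf S (\<lambda>p. f p $ i)"
  by (rule Cinf_compose[where T=UNIV])
    (auto intro: Cinf_bounded_linear bounded_linear_vec_nth)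

lemma matrix_eq_sum_axis:
  fixes M :: "real^'n^'m"
  shows "M = (\<Sum>x\<in>UNIV. \<Sum>y\<in>UNIV. (M $ x $ y) *\<^sub>R axis x (axis y 1))" (is "M = ?R")
proof -
  have "((M $ x $ y) *\<^sub>R axis x (axis y 1) :: real^'n^'m) $ i $ j
      = (if j = y then if i = x then M $ x $ y else 0 else 0)" for i j x y
    by (simp add: axis_def)
  then have "?R $ i $ j = (\<Sum>x\<in>UNIV. \<Sum>y\<in>UNIV. if j = y then if i = x then M $ x $ y else 0 else 0)" for i j
    by simp
  then show ?thesis by (simp add: vec_eq_iff)
qed

lemma Cinf_matrix:
  fixes M :: "_ \<Rightarrow> real^'n^'m"
  assumes "open S" "\<And>x y. Cinf S (\<lambda>p. M p $ x $ y)"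
  shows "Cinf S M"
proof (rule Cinf_cong)
  show "Cinf S (\<lambda>p. \<Sum>x\<in>UNIV. \<Sum>y\<in>UNIV. (M p $ x $ y) *\<^sub>R axis x (axis y (1::real)) :: real^'n^'m)"
    by (intro Cinf_sum Cinf_scaleR Cinf_const assms)
qed (rule matrix_eq_sum_axis)

lemma smooth_on_Cinf:
  "smooth_on S f \<longleftrightarrow> (\<forall>p\<in>S. \<exists>N g. Cinf N g \<and> p \<in> N \<and> (\<forall>q\<in>N \<inter> S. f q = g q))"
  unfolding smooth_on_def Cinf_def by (intro ball_cong refl ex_cong) metis

lemma smooth_onI: "Cinf N g \<Longrightarrow> S \<subseteq> N \<Longrightarrow> (\<And>q. q \<in> S \<Longrightarrow> f q = g q) \<Longrightarrow> smooth_on S f"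
  unfolding smooth_on_Cinf by (metis IntD2 subsetD)

lemma has_vector_derivative_Dd_curve:
  assumes "(\<gamma> has_vector_derivative v) (at 0)" "f differentiable (at (\<gamma> 0))"
  shows "((\<lambda>t. f (\<gamma> t)) has_vector_derivative Dd f (\<gamma> 0) v) (at 0)"
proof -
  have "((\<lambda>t. f (\<gamma> t)) has_derivative (\<lambda>t. Dd f (\<gamma> 0) (t *\<^sub>R v))) (at 0)"
    using has_derivative_compose[OF assms(1)[unfolded has_vector_derivative_def] Dd_works[OF assms(2)]] .
  then show ?thesis
    by (simp add: has_vector_derivative_def linear_cmul[OF linear_frechet_derivative[OF assms(2)]])
qed

section \<open>Charts and tangent spaces\<close>

lemma tangent_space_curve:
  assumes "v \<in> tangent_space M p" "open N" "p \<in> N"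
  obtains \<gamma> and S :: "real set" where "\<gamma> 0 = p" "(\<gamma> has_vector_derivative v) (at 0)"
    "open S" "0 \<in> S" "\<gamma> ` S \<subseteq> M \<inter> N"
proof -
  obtain \<gamma> e where \<gamma>: "0 < e" "\<gamma> ` {-e<..<e::real} \<subseteq> M" "\<gamma> 0 = p" "(\<gamma> has_vector_derivative v) (at 0)"
    using assms by (auto simp: tangent_space_def)
  have "isCont \<gamma> 0" using \<gamma>(4) by (rule has_vector_derivative_continuous)
  then have "\<exists>A. open A \<and> 0 \<in> A \<and> (\<forall>t\<in>A. \<gamma> t \<in> N)"
    using assms(2,3) \<gamma>(3) unfolding continuous_at_open by blast
  then obtain A where A: "open A" "0 \<in> A" "\<forall>t\<in>A. \<gamma> t \<in> N" by blast
  show ?thesis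
    by (rule that[OF \<gamma>(3,4), of "A \<inter> {-e<..<e}"]) (use A \<gamma>(1,2) in \<open>auto simp: open_Int\<close>)
qed

lemma tangent_spaceI:
  assumes "Cinf S \<gamma>" "0 \<in> S" "\<gamma> ` S \<subseteq> M" "\<gamma> 0 = p" "(\<gamma> has_vector_derivative v) (at (0::real))"
  shows "v \<in> tangent_space M p"
proof -
  obtain e where "0 < e" "cball 0 e \<subseteq> S"
    using Cinf_open[OF assms(1)] assms(2) open_contains_cball by metis
  then have "0 < e" "{-e<..<e} \<subseteq> S" by (auto simp: subset_iff dist_real_def)
  then show ?thesis
    using assms(3-5) smooth_onI[OF assms(1), of "{-e<..<e}" \<gamma>]
    unfolding tangent_space_def by (intro CollectI exI[of _ \<gamma>] exI[of _ e]) auto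
qed

lemma tangent_space_mono: "V \<subseteq> W \<Longrightarrow> tangent_space V p \<subseteq> tangent_space W p"
  by (fastforce simp: tangent_space_def)

text \<open>A tangent vector is the velocity of a curve inside \<open>M\<close>, along which
  \<open>f\<close> and \<open>g\<close> coincide. Thus identities known only on a submanifold can be
  differentiated although \<open>Dd\<close> is an ambient derivative.\<close>

lemma Dd_tangent_eq:
  assumes "v \<in> tangent_space M p" "open N" "p \<in> N" "\<And>q. q \<in> N \<inter> M \<Longrightarrow> f q = g q"
    and "f differentiable (at p)" "g differentiable (at p)"
  shows "Dd f p v = Dd g p v"
proof -
  obtain \<gamma> and S :: "real set" where \<gamma>: "\<gamma> 0 = p" "(\<gamma> has_vector_derivative v) (at 0)"
    and S: "open S" "0 \<in> S" "\<gamma> ` S \<subseteq> M \<inter> N"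
    by (rule tangent_space_curve[OF assms(1-3)])
  have f: "((\<lambda>t. f (\<gamma> t)) has_vector_derivative Dd f p v) (at 0)"
    using has_vector_derivative_Dd_curve[OF \<gamma>(2)] \<gamma>(1) assms(5) by auto
  have "((\<lambda>t. g (\<gamma> t)) has_vector_derivative Dd g p v) (at 0)"
    using has_vector_derivative_Dd_curve[OF \<gamma>(2)] \<gamma>(1) assms(6) by auto
  then have "((\<lambda>t. f (\<gamma> t)) has_vector_derivative Dd g p v) (at 0)"
    by (rule has_vector_derivative_transform_within_open) (use S assms(4) in \<open>auto simp: image_subset_iff\<close>)
  with f show ?thesis by (rule vector_derivative_unique_at)
qed

lemma Dd_tangent_const:
  assumes "v \<in> tangent_space M p" "open N" "p \<in> N" "\<And>q. q \<in> N \<inter> M \<Longrightarrow> f q = c"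
    and "f differentiable (at p)"
  shows "Dd f p v = 0"
  using Dd_tangent_eq[OF assms(1-3), of f "\<lambda>q. c"] assms(4,5) by (simp add: frechet_derivative_const)

lemma bounded_linear_coord_proj: "bounded_linear (\<lambda>\<theta>::'a::euclidean_space. \<Sum>i\<in>I. (\<theta> \<bullet> i) *\<^sub>R i)"
  by (intro bounded_linear_sum bounded_linear_scaleR_const bounded_linear_inner_left)

lemma span_Basis_proj:
  assumes "I \<subseteq> (Basis :: 'a::euclidean_space set)" "\<theta> \<in> span I"
  shows "(\<Sum>i\<in>I. (\<theta> \<bullet> i) *\<^sub>R i) = \<theta>"
proof -
  have "linear (\<lambda>\<theta>::'a. \<Sum>i\<in>I. (\<theta> \<bullet> i) *\<^sub>R i)"
    using bounded_linear_coord_proj bounded_linear.linear by blast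
  moreover have "(\<Sum>i\<in>I. (b \<bullet> i) *\<^sub>R i) = id b" if "b \<in> I" for b
  proof -
    have "(\<Sum>i\<in>I. (b \<bullet> i) *\<^sub>R i) = (\<Sum>i\<in>I. if b = i then i else 0)"
      by (rule sum.cong) (use that assms(1) in \<open>auto simp: inner_Basis subset_iff\<close>)
    then show ?thesis
      using that finite_subset[OF assms(1) finite_Basis] by simp
  qed
  ultimately have "(\<Sum>i\<in>I. (\<theta> \<bullet> i) *\<^sub>R i) = id \<theta>"
    using linear_eq_on[OF _ linear_id assms(2)] by blast
  then show ?thesis by simp
qed

text \<open>\<open>\<psi>\<close> is controlled only on a relatively open part of a coordinate
  subspace, where \<open>Dd\<close> has no meaning. Composing with the projection onto
  \<open>span I\<close> gives a smooth map on an open set that still takes its values in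
  \<open>M\<close>.\<close>

lemma chart_extension:
  assumes "chart I U \<psi> M"
  obtains \<Omega> \<Psi> where "Cinf \<Omega> \<Psi>" "U = \<Omega> \<inter> span I" "\<Psi> ` \<Omega> \<subseteq> M" "\<And>\<theta>. \<theta> \<in> span I \<Longrightarrow> \<Psi> \<theta> = \<psi> \<theta>"
proof -
  define pr where "pr = (\<lambda>\<theta>::'a. \<Sum>i\<in>I. (\<theta> \<bullet> i) *\<^sub>R i)"
  have I: "I \<subseteq> Basis" and U: "openin (top_of_set (span I)) U" and im: "\<psi> ` U \<subseteq> M"
    and sm: "smooth_on U \<psi>"
    using assms by (auto simp: chart_def)
  have prC: "Cinf UNIV pr"
    unfolding pr_def using bounded_linear_coord_proj by (rule Cinf_bounded_linear) simp
  then have prc: "continuous_on UNIV pr" by (rule Cinf_continuous_on)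
  have prs: "pr \<theta> \<in> span I" for \<theta>
    unfolding pr_def by (intro span_sum span_scale span_base)
  have pri: "pr \<theta> = \<theta>" if "\<theta> \<in> span I" for \<theta>
    unfolding pr_def using span_Basis_proj[OF I that] .
  obtain T where T: "open T" "U = span I \<inter> T" using U by (auto simp: openin_open)
  define \<Omega> where "\<Omega> = pr -` T"
  have o: "open \<Omega>" unfolding \<Omega>_def using prc T(1) by (simp add: open_vimage)
  have prU: "pr \<theta> \<in> U" if "\<theta> \<in> \<Omega>" for \<theta> using that prs by (auto simp: \<Omega>_def T)
  \<comment> \<open>The local extensions \<open>g\<close> depend on the point, but near each point
    \<open>\<psi>\<close> after \<open>pr\<close> equals some \<open>g\<close> after
    \<open>pr\<close>, and regularity is local.\<close>
  have "Ck_on k \<Omega> (\<lambda>\<theta>. \<psi> (pr \<theta>))" for k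
  proof (rule Ck_on_local)
    fix \<theta> assume "\<theta> \<in> \<Omega>"
    with sm prU obtain N g where N: "Cinf N g" "pr \<theta> \<in> N" "\<forall>q\<in>N \<inter> U. \<psi> q = g q"
      unfolding smooth_on_Cinf by meson
    define S where "S = \<Omega> \<inter> pr -` N"
    have oS: "open S" unfolding S_def using o prc Cinf_open[OF N(1)] by (simp add: open_vimage open_Int)
    have "Cinf S (\<lambda>\<theta>. g (pr \<theta>))"
      by (rule Cinf_compose[OF Cinf_subset[OF prC oS] N(1)]) (auto simp: S_def)
    then have "Cinf S (\<lambda>\<theta>. \<psi> (pr \<theta>))"
      by (rule Cinf_cong) (use N(3) prU in \<open>auto simp: S_def\<close>)
    then show "\<exists>N. open N \<and> \<theta> \<in> N \<and> Ck_on k N (\<lambda>\<theta>. \<psi> (pr \<theta>))"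
      using \<open>\<theta> \<in> \<Omega>\<close> N(2) by (auto simp: Cinf_def S_def)
  qed
  then have "Cinf \<Omega> (\<lambda>\<theta>. \<psi> (pr \<theta>))" using o by (simp add: Cinf_def)
  moreover have "U = \<Omega> \<inter> span I" using T pri by (auto simp: \<Omega>_def)
  moreover have "(\<lambda>\<theta>. \<psi> (pr \<theta>)) ` \<Omega> \<subseteq> M" using prU im by auto
  ultimately show ?thesis using that[of \<Omega> "\<lambda>\<theta>. \<psi> (pr \<theta>)"] pri by simp
qed

text \<open>The image of a chart is open in \<open>M\<close>; shrinking the neighbourhood by the
  open set \<open>T\<close> places all nearby points of \<open>M\<close> in that image.\<close>

lemma chart_inverse_extension:
  assumes "chart I U \<psi> M" "\<theta> \<in> U"
  obtains N h where "Cinf N h" "\<psi> \<theta> \<in> N" "\<And>q. q \<in> N \<inter> M \<Longrightarrow> h q \<in> U" "\<And>q. q \<in> N \<inter> M \<Longrightarrow> \<psi> (h q) = q"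
    "\<And>\<theta>. \<theta> \<in> U \<Longrightarrow> \<psi> \<theta> \<in> N \<Longrightarrow> h (\<psi> \<theta>) = \<theta>"
proof -
  have im: "\<psi> ` U \<subseteq> M" "openin (top_of_set M) (\<psi> ` U)" and inj: "inj_on \<psi> U"
    and sm: "smooth_on (\<psi> ` U) (inv_into U \<psi>)"
    using assms by (auto simp: chart_def)
  obtain T where T: "open T" "\<psi> ` U = M \<inter> T" using im by (auto simp: openin_open)
  obtain N h where N: "Cinf N h" "\<psi> \<theta> \<in> N" "\<forall>q\<in>N \<inter> \<psi> ` U. inv_into U \<psi> q = h q"
    using sm assms(2) unfolding smooth_on_Cinf by (metis imageI)
  have 1: "Cinf (N \<inter> T) h"
    by (rule Cinf_subset[OF N(1)]) (use Cinf_open[OF N(1)] T in auto)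
  have 2: "h q = inv_into U \<psi> q" "q \<in> \<psi> ` U" if "q \<in> (N \<inter> T) \<inter> M" for q
    using that N(3) T by auto
  show ?thesis
  proof (rule that[of "N \<inter> T" h])
    show "\<psi> \<theta> \<in> N \<inter> T" using N(2) T assms(2) by auto
    fix \<theta>' assume "\<theta>' \<in> U" "\<psi> \<theta>' \<in> N \<inter> T"
    then show "h (\<psi> \<theta>') = \<theta>'" using 2(1)[of "\<psi> \<theta>'"] im inj by (auto simp: inv_into_f_f)
  qed (use 1 2 in \<open>auto simp: inv_into_into f_inv_into_f\<close>)
qed

lemma dir_deriv_cong:
  assumes "open \<Omega>" "subspace L" "\<theta> \<in> \<Omega> \<inter> L" "v \<in> L" "\<And>\<theta>. \<theta> \<in> \<Omega> \<inter> L \<Longrightarrow> f \<theta> = g \<theta>"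
  shows "dir_deriv v f \<theta> = dir_deriv v g \<theta>"
  unfolding dir_deriv_def
proof (rule vector_derivative_cong_eq)
  have "((\<lambda>t. \<theta> + t *\<^sub>R v) \<longlongrightarrow> \<theta> + 0 *\<^sub>R v) (nhds (0::real))"
    by (intro tendsto_intros filterlim_ident)
  then have "\<forall>\<^sub>F t in nhds (0::real). \<theta> + t *\<^sub>R v \<in> \<Omega>"
    using assms(1,3) by (auto dest: topological_tendstoD)
  then show "\<forall>\<^sub>F t in nhds (0::real). t \<in> UNIV \<longrightarrow> f (\<theta> + t *\<^sub>R v) = g (\<theta> + t *\<^sub>R v)"
    by eventually_elim (use assms in \<open>auto simp: subspace_add subspace_scale\<close>)
qed auto

lemma line_has_vector_derivative: "((\<lambda>t. \<theta> + t *\<^sub>R v) has_vector_derivative v) (at 0)"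
  by (auto intro!: derivative_eq_intros)

lemma dir_deriv_eq_Dd:
  assumes "f differentiable (at \<theta>)"
  shows "dir_deriv v f \<theta> = Dd f \<theta> v"
  unfolding dir_deriv_def
  by (rule vector_derivative_at) (use has_vector_derivative_Dd_curve[OF line_has_vector_derivative, of f \<theta> v] assms in simp)

text \<open>A chart with ambient extensions of itself and of its inverse, so that calculus in the
  chart becomes calculus on open sets. \<open>\<Psi>\<close> covers the whole chart, whereas
  \<open>h\<close> is available on \<open>N\<close> only.\<close>

locale local_chart =
  fixes I U :: "'a::euclidean_space set" and \<psi> :: "'a \<Rightarrow> 'a" and M \<Omega> \<Psi> N h
  assumes I: "I \<subseteq> Basis"
    and \<Psi>: "Cinf \<Omega> \<Psi>" "\<Psi> ` \<Omega> \<subseteq> M" "\<And>\<theta>. \<theta> \<in> span I \<Longrightarrow> \<Psi> \<theta> = \<psi> \<theta>"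
    and U: "U = \<Omega> \<inter> span I"
    and h: "Cinf N h" "\<And>q. q \<in> N \<inter> M \<Longrightarrow> h q \<in> U" "\<And>q. q \<in> N \<inter> M \<Longrightarrow> \<psi> (h q) = q"
      "\<And>\<theta>. \<theta> \<in> U \<Longrightarrow> \<psi> \<theta> \<in> N \<Longrightarrow> h (\<psi> \<theta>) = \<theta>"
begin

lemma dir_deriv_chart:
  assumes "\<theta> \<in> U" "v \<in> span I" "\<And>\<theta>. \<theta> \<in> U \<Longrightarrow> f \<theta> = F \<theta>" "F differentiable (at \<theta>)"
  shows "dir_deriv v f \<theta> = Dd F \<theta> v"
  using dir_deriv_cong[of \<Omega> "span I" \<theta> v f F] assms Cinf_open[OF \<Psi>(1)]
  by (simp add: U dir_deriv_eq_Dd)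

lemma dir_deriv_\<psi>: "\<theta> \<in> U \<Longrightarrow> v \<in> span I \<Longrightarrow> dir_deriv v \<psi> \<theta> = Dd \<Psi> \<theta> v"
  by (rule dir_deriv_chart) (use \<Psi> in \<open>auto simp: U intro: Cinf_differentiable\<close>)

text \<open>Derivative at t = 0 of the identity \<open>h\<close> after \<open>\<Psi>\<close> = id
  along a line in \<open>span I\<close>.\<close>

lemma Dd_h_Dd_\<Psi>:
  assumes "\<theta> \<in> U" "\<psi> \<theta> \<in> N" "v \<in> span I"
  shows "Dd h (\<psi> \<theta>) (Dd \<Psi> \<theta> v) = v"
proof -
  have d\<Psi>: "\<Psi> differentiable (at \<theta>)" using assms \<Psi>(1) by (auto simp: U intro: Cinf_differentiable)
  have dh: "h differentiable (at (\<psi> \<theta>))" using assms h(1) by (auto intro: Cinf_differentiable)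
  have \<theta>: "\<Psi> \<theta> = \<psi> \<theta>" using assms \<Psi> by (auto simp: U)
  have "((\<lambda>t. \<Psi> (\<theta> + t *\<^sub>R v)) has_vector_derivative Dd \<Psi> \<theta> v) (at 0)"
    using has_vector_derivative_Dd_curve[OF line_has_vector_derivative, of \<Psi> \<theta> v] d\<Psi> by simp
  from has_vector_derivative_Dd_curve[OF this, of h]
  have 1: "((\<lambda>t. h (\<Psi> (\<theta> + t *\<^sub>R v))) has_vector_derivative Dd h (\<psi> \<theta>) (Dd \<Psi> \<theta> v)) (at 0)"
    using dh \<theta> by simp
  define S where "S = \<Omega> \<inter> \<Psi> -` N"
  have "open S" unfolding S_def using \<Psi>(1) h(1) by (auto intro: continuous_open_preimage Cinf_continuous_on Cinf_open)
  then have oA: "open ((\<lambda>t::real. \<theta> + t *\<^sub>R v) -` S)"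
    by (intro open_vimage continuous_intros)
  have "((\<lambda>t. \<theta> + t *\<^sub>R v) has_vector_derivative Dd h (\<psi> \<theta>) (Dd \<Psi> \<theta> v)) (at 0)"
  proof (rule has_vector_derivative_transform_within_open[OF 1 oA])
    fix t assume t: "t \<in> (\<lambda>t. \<theta> + t *\<^sub>R v) -` S"
    have "\<theta> + t *\<^sub>R v \<in> span I" using assms by (auto simp: U span_add span_scale)
    with t show "h (\<Psi> (\<theta> + t *\<^sub>R v)) = \<theta> + t *\<^sub>R v"
      using \<Psi>(3)[of "\<theta> + t *\<^sub>R v"] h(4)[of "\<theta> + t *\<^sub>R v"] by (auto simp: S_def U)
  qed (use assms \<theta> in \<open>auto simp: S_def U\<close>)
  then show ?thesis using line_has_vector_derivative vector_derivative_unique_at by blast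
qed

lemma Dd_\<Psi>_tangent:
  assumes "\<theta> \<in> U" "v \<in> span I"
  shows "Dd \<Psi> \<theta> v \<in> tangent_space M (\<psi> \<theta>)"
proof -
  have d\<Psi>: "\<Psi> differentiable (at \<theta>)" using assms \<Psi>(1) by (auto simp: U intro: Cinf_differentiable)
  have oA: "open ((\<lambda>t::real. \<theta> + t *\<^sub>R v) -` \<Omega>)" (is "open ?A")
    using Cinf_open[OF \<Psi>(1)] by (intro open_vimage continuous_intros)
  have "Cinf ?A (\<lambda>t. \<Psi> (\<theta> + t *\<^sub>R v))"
    by (rule Cinf_compose[OF _ \<Psi>(1)]) (use oA in \<open>auto intro!: Cinf_add Cinf_const Cinf_scaleR Cinf_ident\<close>)
  then show ?thesis
    by (rule tangent_spaceI)
     (use has_vector_derivative_Dd_curve[OF line_has_vector_derivative, of \<Psi> \<theta> v] assms \<Psi> d\<Psi> in \<open>auto simp: U\<close>)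
qed

lemma tangent_Dd_h:
  assumes "p \<in> N \<inter> M" "v \<in> tangent_space M p"
  shows "Dd h p v \<in> span I" "Dd \<Psi> (h p) (Dd h p v) = v"
proof -
  have "open N" "p \<in> N" using h(1) assms(1) by (auto intro: Cinf_open)
  then obtain \<gamma> and S :: "real set" where \<gamma>: "\<gamma> 0 = p" "(\<gamma> has_vector_derivative v) (at 0)"
    and S: "open S" "0 \<in> S" "\<gamma> ` S \<subseteq> M \<inter> N"
    by (rule tangent_space_curve[OF assms(2)])
  have dh: "h differentiable (at p)" using assms h(1) by (auto intro: Cinf_differentiable)
  have d\<Psi>: "\<Psi> differentiable (at (h p))" using assms h(2) \<Psi>(1) by (auto simp: U intro: Cinf_differentiable)
  have 1: "((\<lambda>t. h (\<gamma> t)) has_vector_derivative Dd h p v) (at 0)"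
    using has_vector_derivative_Dd_curve[OF \<gamma>(2)] dh \<gamma>(1) by simp
  have 2: "((\<lambda>t. \<Psi> (h (\<gamma> t))) has_vector_derivative Dd \<Psi> (h p) (Dd h p v)) (at 0)"
    using has_vector_derivative_Dd_curve[OF 1] d\<Psi> \<gamma>(1) by simp
  have "((\<lambda>t. \<Psi> (h (\<gamma> t))) has_vector_derivative v) (at 0)"
  proof (rule has_vector_derivative_transform_within_open[OF \<gamma>(2) S(1,2)])
    fix t assume "t \<in> S"
    then have "\<gamma> t \<in> N \<inter> M" using S by blast
    with h(2,3) \<Psi>(3) show "\<gamma> t = \<Psi> (h (\<gamma> t))" by (simp add: U)
  qed
  with 2 show "Dd \<Psi> (h p) (Dd h p v) = v" by (rule vector_derivative_unique_at)
  \<comment> \<open>The curve \<open>h (\<gamma> t)\<close> stays in the coordinate subspace and is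
    fixed by the projection; hence so is its velocity.\<close>
  let ?pr = "\<lambda>\<theta>::'a. \<Sum>i\<in>I. (\<theta> \<bullet> i) *\<^sub>R i"
  have "((\<lambda>t. ?pr (h (\<gamma> t))) has_vector_derivative ?pr (Dd h p v)) (at 0)"
    using bounded_linear.has_vector_derivative[OF bounded_linear_coord_proj 1] .
  moreover have "((\<lambda>t. ?pr (h (\<gamma> t))) has_vector_derivative Dd h p v) (at 0)"
  proof (rule has_vector_derivative_transform_within_open[OF 1 S(1,2)])
    fix t assume "t \<in> S"
    then have "\<gamma> t \<in> N \<inter> M" using S by blast
    then have "h (\<gamma> t) \<in> span I" using h(2) by (auto simp: U)
    then show "h (\<gamma> t) = ?pr (h (\<gamma> t))" using span_Basis_proj[OF I] by simp
  qed
  ultimately have "Dd h p v = ?pr (Dd h p v)" using vector_derivative_unique_at by blast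
  also have "\<dots> \<in> span I" by (intro span_sum span_scale span_base)
  finally show "Dd h p v \<in> span I" .
qed

text \<open>\<open>tangent_Dd_h\<close> gives existence and \<open>Dd_h_Dd_\<Psi>\<close> uniqueness
  for the description in \<open>coords\<close>, which thereby becomes an expression that can be
  differentiated in the base point.\<close>

lemma coords_eq:
  assumes "\<theta> \<in> U" "\<psi> \<theta> \<in> N" "v \<in> tangent_space M (\<psi> \<theta>)"
  shows "coords I \<psi> \<theta> v = Dd h (\<psi> \<theta>) v"
  unfolding coords_def
proof (rule the_equality)
  have "\<psi> \<theta> \<in> N \<inter> M" using assms \<Psi> by (force simp: U)
  from tangent_Dd_h[OF this assms(3)]
  show "Dd h (\<psi> \<theta>) v \<in> span I \<and> dir_deriv (Dd h (\<psi> \<theta>) v) \<psi> \<theta> = v"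
    using assms by (simp add: dir_deriv_\<psi> h(4))
  fix \<xi> assume "\<xi> \<in> span I \<and> dir_deriv \<xi> \<psi> \<theta> = v"
  then show "\<xi> = Dd h (\<psi> \<theta>) v"
    using assms Dd_h_Dd_\<Psi>[of \<theta> \<xi>] by (auto simp: dir_deriv_\<psi>)
qed

end

lemma chart_local_chart:
  assumes "chart I U \<psi> M" "\<theta> \<in> U"
  obtains \<Omega> \<Psi> N h where "local_chart I U \<psi> M \<Omega> \<Psi> N h" "\<psi> \<theta> \<in> N"
proof -
  have "I \<subseteq> Basis" using assms by (simp add: chart_def)
  moreover obtain \<Omega> \<Psi> where "Cinf \<Omega> \<Psi>" "U = \<Omega> \<inter> span I" "\<Psi> ` \<Omega> \<subseteq> M"
    "\<And>\<theta>. \<theta> \<in> span I \<Longrightarrow> \<Psi> \<theta> = \<psi> \<theta>"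
    using chart_extension[OF assms(1)] by metis
  moreover obtain N h where "Cinf N h" "\<psi> \<theta> \<in> N" "\<And>q. q \<in> N \<inter> M \<Longrightarrow> h q \<in> U"
    "\<And>q. q \<in> N \<inter> M \<Longrightarrow> \<psi> (h q) = q" "\<And>\<theta>. \<theta> \<in> U \<Longrightarrow> \<psi> \<theta> \<in> N \<Longrightarrow> h (\<psi> \<theta>) = \<theta>"
    using chart_inverse_extension[OF assms] by metis
  ultimately have "local_chart I U \<psi> M \<Omega> \<Psi> N h" "\<psi> \<theta> \<in> N"
    unfolding local_chart_def by blast+
  then show ?thesis by (rule that)
qed

text \<open>One global parametrisation by a relatively open part of \<open>L\<close> suffices. Since
  a chart needs a coordinate subspace, a linear isomorphism from the span of \<open>dim L\<close>
  standard basis vectors is put in front.\<close>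

lemma smooth_manifold_affine:
  fixes L :: "'a::euclidean_space set" and \<phi> \<kappa> :: "'a \<Rightarrow> 'a"
  assumes L: "subspace L" and G: "open G"
    and im: "\<And>\<theta>. \<theta> \<in> L \<inter> G \<Longrightarrow> \<phi> \<theta> \<in> M" "\<And>q. q \<in> M \<Longrightarrow> \<kappa> q \<in> L \<inter> G"
    and inv: "\<And>\<theta>. \<theta> \<in> L \<inter> G \<Longrightarrow> \<kappa> (\<phi> \<theta>) = \<theta>" "\<And>q. q \<in> M \<Longrightarrow> \<phi> (\<kappa> q) = q"
    and sm: "Cinf G \<phi>" "Cinf H \<kappa>" "M \<subseteq> H"
  shows "smooth_manifold (dim L) M"
proof -
  obtain I :: "'a set" where I: "I \<subseteq> Basis" "card I = dim L"
    using obtain_subset_with_card_n[OF dim_subset_UNIV[of L]] by metis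
  have "independent I" using I(1) independent_Basis independent_mono by blast
  then have dI: "dim (span I) = dim L" using I(2) by (simp add: dim_eq_card_independent)
  obtain f g where fg: "linear f" "linear g" "f ` span I = L" "g ` L = span I"
    "\<And>x. x \<in> span I \<Longrightarrow> g (f x) = x" "\<And>x. x \<in> L \<Longrightarrow> f (g x) = x"
    using isometries_subspaces[OF subspace_span L dI] by metis
  define U where "U = span I \<inter> f -` G"
  define \<psi> where "\<psi> = (\<lambda>\<theta>. \<phi> (f \<theta>))"
  have oG: "open (f -` G)"
    using fg(1) G linear_continuous_on[of f UNIV] by (simp add: open_vimage linear_conv_bounded_linear)
  have fU: "f \<theta> \<in> L \<inter> G" if "\<theta> \<in> U" for \<theta> using that fg by (auto simp: U_def)
  have gU: "g (\<kappa> q) \<in> U" "\<psi> (g (\<kappa> q)) = q" if "q \<in> M" for q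
    using im(2)[OF that] inv(2)[OF that] fg by (auto simp: U_def \<psi>_def)
  have imU: "\<psi> ` U = M" using fU im(1) gU by (force simp: \<psi>_def image_iff)
  have left: "g (\<kappa> (\<psi> \<theta>)) = \<theta>" if "\<theta> \<in> U" for \<theta>
    using inv(1)[OF fU[OF that]] that fg by (simp add: \<psi>_def U_def)
  have inj: "inj_on \<psi> U" using left by (metis inj_onI)
  have "chart I U \<psi> M"
    unfolding chart_def
  proof (intro conjI)
    show "openin (top_of_set (span I)) U" using oG by (auto simp: U_def openin_open)
    show "smooth_on U \<psi>"
    proof (rule smooth_onI)
      show "Cinf (f -` G) (\<lambda>\<theta>. \<phi> (f \<theta>))"
        by (rule Cinf_compose[OF Cinf_linear[OF fg(1) oG] sm(1)]) auto
    qed (auto simp: U_def \<psi>_def)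
    show "smooth_on (\<psi> ` U) (inv_into U \<psi>)"
    proof (rule smooth_onI)
      show "Cinf H (\<lambda>q. g (\<kappa> q))"
        by (rule Cinf_compose[OF sm(2) Cinf_linear[OF fg(2) open_UNIV]]) auto
      show "\<psi> ` U \<subseteq> H" using imU sm(3) by simp
      fix q assume "q \<in> \<psi> ` U"
      then have "q \<in> M" using imU by simp
      then show "inv_into U \<psi> q = g (\<kappa> q)"
        using gU inj by (metis inv_into_f_f)
    qed
  qed (use I imU inj in auto)
  then show ?thesis unfolding smooth_manifold_def using I(2) imU by blast
qed

section \<open>Covariant derivatives in charts\<close>

lemma open_Cinf_preimage: "Cinf S f \<Longrightarrow> open T \<Longrightarrow> open (S \<inter> f -` T)"
  by (intro continuous_open_preimage Cinf_continuous_on) (auto intro: Cinf_open)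

lemma inner_sum_Basis_subset:
  assumes "I \<subseteq> Basis" "j \<in> I"
  shows "(\<Sum>k\<in>I. f k *\<^sub>R k) \<bullet> j = f j"
proof -
  have "(\<Sum>k\<in>I. f k *\<^sub>R k) \<bullet> j = (\<Sum>k\<in>I. if k = j then f j else 0)"
    unfolding inner_sum_left by (rule sum.cong) (use assms in \<open>auto simp: inner_Basis subset_iff\<close>)
  then show ?thesis using assms(2) finite_subset[OF assms(1) finite_Basis] by simp
qed

text \<open>Definiteness makes the Gram matrix, seen as the endomorphism \<open>T\<close> of
  \<open>span I\<close>, injective, hence onto by dimension.\<close>

lemma pos_def_system_unique_solution:
  fixes G :: "'a::euclidean_space \<Rightarrow> 'a \<Rightarrow> real"
  assumes I: "I \<subseteq> Basis"
    and pd: "\<And>c. c \<in> span I \<Longrightarrow> (\<Sum>k\<in>I. (c \<bullet> k) * (\<Sum>l\<in>I. (c \<bullet> l) * G l k)) = 0 \<Longrightarrow> c = 0"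
  shows "\<exists>!c. c \<in> span I \<and> (\<forall>k\<in>I. (\<Sum>l\<in>I. (c \<bullet> l) * G l k) = r k)"
proof -
  define T where "T = (\<lambda>c. \<Sum>k\<in>I. (\<Sum>l\<in>I. (c \<bullet> l) * G l k) *\<^sub>R k)"
  have "bounded_linear T" unfolding T_def
    by (intro bounded_linear_sum bounded_linear_scaleR_const bounded_linear_mult_const bounded_linear_inner_left)
  then have lT: "linear T" by (rule bounded_linear.linear)
  have Tk: "T c \<bullet> k = (\<Sum>l\<in>I. (c \<bullet> l) * G l k)" if "k \<in> I" for c k
    unfolding T_def using inner_sum_Basis_subset[OF I that] .
  have Ts: "T c \<in> span I" for c
    unfolding T_def by (intro span_sum span_scale span_base)
  have T0: "c = 0" if "c \<in> span I" "T c = 0" for c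
  proof (rule pd[OF that(1)], rule sum.neutral, rule ballI)
    fix k assume "k \<in> I"
    then show "(c \<bullet> k) * (\<Sum>l\<in>I. (c \<bullet> l) * G l k) = 0"
      using Tk[of k c] that(2) by simp
  qed
  have inj: "inj_on T (span I)"
  proof (rule inj_onI)
    fix c d assume "c \<in> span I" "d \<in> span I" "T c = T d"
    then have "c - d \<in> span I" "T (c - d) = 0" by (auto simp: span_diff linear_diff[OF lT])
    then have "c - d = 0" by (rule T0)
    then show "c = d" by simp
  qed
  have "dim (T ` span I) = dim (span I)"
    by (rule dim_image_eq[OF lT]) (simp add: inj span_span)
  then have onto: "T ` span I = span I"
    by (intro subspace_dim_equal linear_subspace_image[OF lT] subspace_span) (use Ts in auto)
  define R where "R = (\<Sum>k\<in>I. r k *\<^sub>R k)"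
  have "R \<in> span I" unfolding R_def by (intro span_sum span_scale span_base)
  then obtain c where c: "c \<in> span I" "T c = R" using onto by (metis imageE)
  have R: "R \<bullet> k = r k" if "k \<in> I" for k
    unfolding R_def using inner_sum_Basis_subset[OF I that] .
  show ?thesis
  proof (rule ex1I[of _ c])
    show "c \<in> span I \<and> (\<forall>k\<in>I. (\<Sum>l\<in>I. (c \<bullet> l) * G l k) = r k)"
      using c R Tk[of _ c] by auto
    fix d assume d: "d \<in> span I \<and> (\<forall>k\<in>I. (\<Sum>l\<in>I. (d \<bullet> l) * G l k) = r k)"
    then have "T d = R" unfolding T_def R_def by simp
    then show "d = c" using c d inj by (auto dest: inj_onD)
  qed
qed

lemma linear_span_expansion:
  fixes f :: "'a::euclidean_space \<Rightarrow> 'b::real_vector"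
  assumes "linear f" "I \<subseteq> Basis" "c \<in> span I"
  shows "f c = (\<Sum>i\<in>I. (c \<bullet> i) *\<^sub>R f i)"
proof -
  have "f c = f (\<Sum>i\<in>I. (c \<bullet> i) *\<^sub>R i)"
    using span_Basis_proj[OF assms(2,3)] by simp
  then show ?thesis by (simp add: linear_sum[OF assms(1)] linear_cmul[OF assms(1)])
qed

lemma Dd_compose:
  assumes "f differentiable (at p)" "g differentiable (at (f p))"
  shows "Dd (\<lambda>q. g (f q)) p v = Dd g (f p) (Dd f p v)"
  using Dd_eqI[OF has_derivative_compose[OF Dd_works[OF assms(1)] Dd_works[OF assms(2)]]] by simp

context local_chart
begin

text \<open>A derivative within the preimage of \<open>V\<close> exists because of the ambient
  extension \<open>\<eta>t\<close>. Several may exist, but a curve in \<open>V\<close> with velocity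
  \<open>v\<close> pulls back to a curve in the preimage with velocity
  \<open>Dd h (\<psi> \<theta>) v\<close>, and the chain rule along it forces the value on that
  vector.\<close>

lemma nabla_coords_first_term:
  assumes V: "V \<subseteq> M" "\<theta> \<in> U" "\<psi> \<theta> \<in> N" "\<psi> \<theta> \<in> V"
    and X: "v \<in> tangent_space V (\<psi> \<theta>)"
    and Y: "Cinf N' Yt" "\<psi> \<theta> \<in> N'" "\<And>q. q \<in> N' \<inter> V \<Longrightarrow> Yt q \<in> tangent_space M q"
      "\<And>q. q \<in> N' \<inter> V \<Longrightarrow> Y q = Yt q"
  shows "(THE w. \<exists>D. ((\<lambda>\<theta>. coords I \<psi> \<theta> (Y (\<psi> \<theta>))) has_derivative D) (at \<theta> within {\<theta> \<in> U. \<psi> \<theta> \<in> V})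
      \<and> w = D (Dd h (\<psi> \<theta>) v)) = Dd (\<lambda>q. Dd h q (Yt q)) (\<psi> \<theta>) v" (is "The ?P = ?w")
    and "Dd (\<lambda>q. Dd h q (Yt q)) (\<psi> \<theta>) v \<in> span I"
proof -
  let ?S = "{\<theta> \<in> U. \<psi> \<theta> \<in> V}" and ?\<eta> = "\<lambda>\<theta>. coords I \<psi> \<theta> (Y (\<psi> \<theta>))"
  define \<eta>t where "\<eta>t = (\<lambda>q. Dd h q (Yt q))"
  have oN: "open (N \<inter> N')" using h(1) Y(1) by (auto intro: Cinf_open)
  have \<eta>tC: "Cinf (N \<inter> N') \<eta>t" unfolding \<eta>t_def
    by (intro Cinf_Dd Cinf_subset[OF h(1)] Cinf_subset[OF Y(1)] oN) auto
  have d\<eta>: "\<eta>t differentiable (at (\<psi> \<theta>))"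
    using Cinf_differentiable[OF \<eta>tC] V Y(2) by blast
  have \<eta>eq: "?\<eta> \<theta>' = \<eta>t (\<psi> \<theta>')" if "\<theta>' \<in> ?S" "\<psi> \<theta>' \<in> N \<inter> N'" for \<theta>'
    using coords_eq[of \<theta>' "Yt (\<psi> \<theta>')"] that Y(3,4)[of "\<psi> \<theta>'"] by (simp add: \<eta>t_def)
  have \<theta>: "\<theta> \<in> \<Omega>" "\<Psi> \<theta> = \<psi> \<theta>" using V \<Psi> by (auto simp: U)
  have d\<Psi>: "\<Psi> differentiable (at \<theta>)" using \<theta> \<Psi>(1) by (auto intro: Cinf_differentiable)
  have ex: "\<exists>D. (?\<eta> has_derivative D) (at \<theta> within ?S)"
  proof -
    define A where "A = \<Omega> \<inter> \<Psi> -` (N \<inter> N')"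
    have "open A" unfolding A_def
      using \<Psi>(1) oN by (rule open_Cinf_preimage)
    moreover have "\<theta> \<in> A" using \<theta> V Y(2) by (auto simp: A_def)
    ultimately obtain d where d: "0 < d" "ball \<theta> d \<subseteq> A" using open_contains_ball by metis
    have "((\<lambda>\<theta>. \<eta>t (\<Psi> \<theta>)) has_derivative (\<lambda>v. Dd \<eta>t (\<Psi> \<theta>) (Dd \<Psi> \<theta> v))) (at \<theta>)"
      using has_derivative_compose[OF Dd_works[OF d\<Psi>] Dd_works] d\<eta> \<theta> by simp
    then have "((\<lambda>\<theta>. \<eta>t (\<Psi> \<theta>)) has_derivative (\<lambda>v. Dd \<eta>t (\<Psi> \<theta>) (Dd \<Psi> \<theta> v))) (at \<theta> within ?S)"
      by (rule has_derivative_at_withinI)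
    then have "(?\<eta> has_derivative (\<lambda>v. Dd \<eta>t (\<Psi> \<theta>) (Dd \<Psi> \<theta> v))) (at \<theta> within ?S)"
    proof (rule has_derivative_transform_within[OF _ d(1)])
      fix \<theta>' assume a: "\<theta>' \<in> ?S" "dist \<theta>' \<theta> < d"
      then have "\<theta>' \<in> A" using d(2) by (auto simp: dist_commute subset_iff)
      moreover have "\<Psi> \<theta>' = \<psi> \<theta>'" using a \<Psi>(3) by (auto simp: U)
      ultimately show "\<eta>t (\<Psi> \<theta>') = ?\<eta> \<theta>'"
        using \<eta>eq[OF a(1)] by (simp add: A_def)
    qed (use V in auto)
    then show ?thesis by blast
  qed
  have uniq: "D (Dd h (\<psi> \<theta>) v) = ?w" if D: "(?\<eta> has_derivative D) (at \<theta> within ?S)" for D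
  proof -
    have pN: "\<psi> \<theta> \<in> N \<inter> N'" using V Y(2) by simp
    obtain \<gamma> and T :: "real set" where \<gamma>: "\<gamma> 0 = \<psi> \<theta>" "(\<gamma> has_vector_derivative v) (at 0)"
      and TS: "open T" "0 \<in> T" "\<gamma> ` T \<subseteq> V \<inter> (N \<inter> N')"
      by (rule tangent_space_curve[OF X oN pN])
    then have T: "open T" "0 \<in> T" "\<And>t. t \<in> T \<Longrightarrow> \<gamma> t \<in> V \<inter> (N \<inter> N')" by auto
    have dh: "h differentiable (at (\<psi> \<theta>))" using V h(1) by (auto intro: Cinf_differentiable)
    have c: "((\<lambda>t. h (\<gamma> t)) has_vector_derivative Dd h (\<psi> \<theta>) v) (at 0)"
      using has_vector_derivative_Dd_curve[OF \<gamma>(2)] dh \<gamma>(1) by simp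
    have hS: "h (\<gamma> t) \<in> ?S" "\<psi> (h (\<gamma> t)) = \<gamma> t" if "t \<in> T" for t
      using T(3)[OF that] V(1) h(2,3)[of "\<gamma> t"] by auto
    have h0: "h (\<gamma> 0) = \<theta>" using h(4) V \<gamma>(1) by simp
    have c': "((\<lambda>t. h (\<gamma> t)) has_derivative (\<lambda>t. t *\<^sub>R Dd h (\<psi> \<theta>) v)) (at 0 within T)"
      using c unfolding has_vector_derivative_def by (rule has_derivative_at_withinI)
    have D': "(?\<eta> has_derivative D) (at (h (\<gamma> 0)) within (\<lambda>t. h (\<gamma> t)) ` T)"
      unfolding h0 by (rule has_derivative_subset[OF D]) (use hS in auto)
    have "((\<lambda>t. ?\<eta> (h (\<gamma> t))) has_derivative (\<lambda>t. D (t *\<^sub>R Dd h (\<psi> \<theta>) v))) (at 0 within T)"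
      using c' D' by (rule has_derivative_in_compose[of "\<lambda>t. h (\<gamma> t)" _ _ _ ?\<eta>])
    moreover have "at 0 within T = at 0" using at_within_open[OF T(2,1)] .
    moreover have "D (t *\<^sub>R Dd h (\<psi> \<theta>) v) = t *\<^sub>R D (Dd h (\<psi> \<theta>) v)" for t
      by (rule linear_cmul[OF has_derivative_linear[OF D]])
    ultimately have 1: "((\<lambda>t. ?\<eta> (h (\<gamma> t))) has_vector_derivative D (Dd h (\<psi> \<theta>) v)) (at 0)"
      unfolding has_vector_derivative_def by (simp only:)
    have 2: "((\<lambda>t. \<eta>t (\<gamma> t)) has_vector_derivative Dd \<eta>t (\<psi> \<theta>) v) (at 0)"
      using has_vector_derivative_Dd_curve[OF \<gamma>(2)] d\<eta> \<gamma>(1) by simp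
    have "((\<lambda>t. ?\<eta> (h (\<gamma> t))) has_vector_derivative Dd \<eta>t (\<psi> \<theta>) v) (at 0)"
    proof (rule has_vector_derivative_transform_within_open[OF 2 T(1,2)])
      fix t assume t: "t \<in> T"
      then show "\<eta>t (\<gamma> t) = ?\<eta> (h (\<gamma> t))"
        using \<eta>eq[OF hS(1)[OF t]] hS(2)[OF t] T(3)[OF t] by simp
    qed
    with 1 show ?thesis unfolding \<eta>t_def by (rule vector_derivative_unique_at)
  qed
  show "The ?P = ?w"
    by (rule the_equality) (use ex uniq in auto)
  \<comment> \<open>\<open>\<eta>t\<close> is known to lie in \<open>span I\<close> on
    \<open>V\<close> only, so the projection argument is run along the tangent vector
    \<open>v\<close>.\<close>
  let ?pr = "\<lambda>\<theta>::'a. \<Sum>i\<in>I. (\<theta> \<bullet> i) *\<^sub>R i"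
  have pr: "((\<lambda>q. ?pr (\<eta>t q)) has_derivative (\<lambda>u. ?pr (Dd \<eta>t (\<psi> \<theta>) u))) (at (\<psi> \<theta>))"
    using bounded_linear.has_derivative[OF bounded_linear_coord_proj Dd_works[OF d\<eta>]] .
  have "Dd \<eta>t (\<psi> \<theta>) v = Dd (\<lambda>q. ?pr (\<eta>t q)) (\<psi> \<theta>) v"
  proof (rule Dd_tangent_eq[OF X oN])
    fix q assume "q \<in> N \<inter> N' \<inter> V"
    then have "\<eta>t q \<in> span I" using tangent_Dd_h(1)[of q "Yt q"] Y(3)[of q] V(1) by (auto simp: \<eta>t_def)
    then show "\<eta>t q = ?pr (\<eta>t q)" using span_Basis_proj[OF I] by simp
  qed (use V Y(2) d\<eta> pr in \<open>auto simp: differentiable_def\<close>)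
  also have "\<dots> = ?pr (Dd \<eta>t (\<psi> \<theta>) v)" by (simp add: Dd_eqI[OF pr])
  also have "\<dots> \<in> span I" by (intro span_sum span_scale span_base)
  finally show "?w \<in> span I" by (simp add: \<eta>t_def)
qed

text \<open>With F = f after \<open>\<Psi>\<close>, the function Y f equals \<Sum> \<eta>^j
  \<partial>_j F on \<open>V\<close>. The product rule along \<open>v\<close> leaves df of the flat
  derivative of \<eta>, and second partial derivatives of F; for f = a the latter are what the
  Christoffel symbols record.\<close>

lemma Dd_Dd_along_field:
  assumes V: "V \<subseteq> M" "\<theta> \<in> U" "\<psi> \<theta> \<in> N" "\<psi> \<theta> \<in> V"
    and X: "v \<in> tangent_space V (\<psi> \<theta>)"
    and Y: "Cinf N' Yt" "\<psi> \<theta> \<in> N'" "\<And>q. q \<in> N' \<inter> V \<Longrightarrow> Yt q \<in> tangent_space M q"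
    and f: "Cinf H f" "M \<subseteq> H"
  shows "Dd (\<lambda>q. Dd f q (Yt q)) (\<psi> \<theta>) v =
    Dd f (\<psi> \<theta>) (Dd \<Psi> \<theta> (Dd (\<lambda>q. Dd h q (Yt q)) (\<psi> \<theta>) v)) +
    (\<Sum>i\<in>I. \<Sum>j\<in>I. ((Dd h (\<psi> \<theta>) v \<bullet> i) * (Dd h (\<psi> \<theta>) (Yt (\<psi> \<theta>)) \<bullet> j)) *\<^sub>R
       Dd (\<lambda>\<theta>. Dd (\<lambda>\<theta>. f (\<Psi> \<theta>)) \<theta> j) \<theta> i)"
proof -
  define \<eta>t where "\<eta>t = (\<lambda>q. Dd h q (Yt q))"
  define F where "F = (\<lambda>\<theta>. f (\<Psi> \<theta>))"
  let ?p = "\<psi> \<theta>" and ?w = "Dd \<eta>t (\<psi> \<theta>) v" and ?\<xi> = "Dd h (\<psi> \<theta>) v"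
  have FC: "Cinf \<Omega> F" unfolding F_def
    by (rule Cinf_compose[OF \<Psi>(1) f(1)]) (use \<Psi>(2) f(2) in auto)
  have FjC: "Cinf \<Omega> (\<lambda>\<theta>. Dd F \<theta> j)" for j
    by (intro Cinf_Dd FC Cinf_const Cinf_open[OF FC])
  define B where "B = N \<inter> N' \<inter> H \<inter> (N \<inter> h -` \<Omega>)"
  have oB: "open B" unfolding B_def
    using Cinf_open[OF h(1)] Cinf_open[OF Y(1)] Cinf_open[OF f(1)]
      open_Cinf_preimage[OF h(1) Cinf_open[OF FC]] by auto
  have hC: "Cinf B h" by (rule Cinf_subset[OF h(1) oB]) (auto simp: B_def)
  have YC: "Cinf B Yt" by (rule Cinf_subset[OF Y(1) oB]) (auto simp: B_def)
  have fC: "Cinf B f" by (rule Cinf_subset[OF f(1) oB]) (auto simp: B_def)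
  have \<eta>tC: "Cinf B \<eta>t" unfolding \<eta>t_def by (intro Cinf_Dd hC YC)
  have hp: "h ?p = \<theta>" using h(4) V by simp
  have pB: "?p \<in> B" using V Y(2) f(2) hp by (auto simp: B_def U)
  have FhC: "Cinf B (\<lambda>q. Dd F (h q) j)" for j
    by (rule Cinf_compose[OF hC FjC]) (auto simp: B_def)
  have ws: "?w \<in> span I"
    unfolding \<eta>t_def by (rule nabla_coords_first_term(2)[OF V X Y refl])
  have eq: "Dd f q (Yt q) = (\<Sum>j\<in>I. (\<eta>t q \<bullet> j) *\<^sub>R Dd F (h q) j)" if q: "q \<in> B \<inter> V" for q
  proof -
    have qN: "q \<in> N \<inter> M" "Yt q \<in> tangent_space M q" using q V Y(3)[of q] by (auto simp: B_def)
    have hq: "h q \<in> U" "\<Psi> (h q) = q" using h(2,3)[OF qN(1)] \<Psi>(3) by (auto simp: U)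
    have "Dd f q (Yt q) = Dd f q (Dd \<Psi> (h q) (\<eta>t q))"
      using tangent_Dd_h(2)[OF qN] by (simp add: \<eta>t_def)
    also have "\<dots> = Dd F (h q) (\<eta>t q)" unfolding F_def
      using hq qN f \<Psi>(1) by (subst Dd_compose) (auto simp: U intro: Cinf_differentiable)
    also have "\<dots> = (\<Sum>j\<in>I. (\<eta>t q \<bullet> j) *\<^sub>R Dd F (h q) j)"
      using linear_span_expansion[OF Cinf_linear_Dd[OF FC] I] hq tangent_Dd_h(1)[OF qN]
      by (auto simp: \<eta>t_def U)
    finally show ?thesis .
  qed
  have d1: "(\<eta>t has_derivative Dd \<eta>t ?p) (at ?p)" using Cinf_has_derivative[OF \<eta>tC pB] .
  have d2: "((\<lambda>q. Dd F (h q) j) has_derivative Dd (\<lambda>q. Dd F (h q) j) ?p) (at ?p)" for j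
    using Cinf_has_derivative[OF FhC pB] .
  have hd: "((\<lambda>q. \<Sum>j\<in>I. (\<eta>t q \<bullet> j) *\<^sub>R Dd F (h q) j) has_derivative
     (\<lambda>u. \<Sum>j\<in>I. (\<eta>t ?p \<bullet> j) *\<^sub>R Dd (\<lambda>q. Dd F (h q) j) ?p u + (Dd \<eta>t ?p u \<bullet> j) *\<^sub>R Dd F (h ?p) j)) (at ?p)"
    by (intro has_derivative_sum has_derivative_scaleR has_derivative_inner_left d1 d2)
  have \<theta>: "\<theta> \<in> \<Omega>" "\<Psi> \<theta> = ?p" using V \<Psi>(3) by (auto simp: U)
  have \<xi>s: "?\<xi> \<in> span I"
    using tangent_Dd_h(1)[of ?p v] X tangent_space_mono[OF V(1), of ?p] V by auto
  have F2: "Dd (\<lambda>q. Dd F (h q) j) ?p v = (\<Sum>i\<in>I. (?\<xi> \<bullet> i) *\<^sub>R Dd (\<lambda>\<theta>. Dd F \<theta> j) \<theta> i)" for j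
  proof -
    have "Dd (\<lambda>q. Dd F (h q) j) ?p v = Dd (\<lambda>\<theta>. Dd F \<theta> j) \<theta> ?\<xi>"
      using Dd_compose[of h ?p "\<lambda>\<theta>. Dd F \<theta> j" v] hp Cinf_differentiable[OF hC pB]
        Cinf_differentiable[OF FjC[of j] \<theta>(1)] by simp
    also have "\<dots> = (\<Sum>i\<in>I. (?\<xi> \<bullet> i) *\<^sub>R Dd (\<lambda>\<theta>. Dd F \<theta> j) \<theta> i)"
      using linear_span_expansion[OF Cinf_linear_Dd[OF FjC[of j] \<theta>(1)] I \<xi>s] by simp
    finally show ?thesis .
  qed
  have "Dd (\<lambda>q. Dd f q (Yt q)) ?p v = Dd (\<lambda>q. \<Sum>j\<in>I. (\<eta>t q \<bullet> j) *\<^sub>R Dd F (h q) j) ?p v"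
    by (rule Dd_tangent_eq[OF X oB pB eq])
      (use hd Cinf_differentiable[OF Cinf_Dd[OF fC YC] pB] in \<open>auto simp: differentiable_def\<close>)
  also have "\<dots> = (\<Sum>j\<in>I. (\<eta>t ?p \<bullet> j) *\<^sub>R Dd (\<lambda>q. Dd F (h q) j) ?p v) + (\<Sum>j\<in>I. (?w \<bullet> j) *\<^sub>R Dd F \<theta> j)"
    by (simp add: Dd_eqI[OF hd] sum.distrib hp)
  also have "(\<Sum>j\<in>I. (?w \<bullet> j) *\<^sub>R Dd F \<theta> j) = Dd F \<theta> ?w"
    using linear_span_expansion[OF Cinf_linear_Dd[OF FC \<theta>(1)] I ws] by simp
  also have "\<dots> = Dd f ?p (Dd \<Psi> \<theta> ?w)"
    unfolding F_def using \<theta> V f \<Psi>(1) by (subst Dd_compose) (auto intro: Cinf_differentiable)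
  also have "(\<Sum>j\<in>I. (\<eta>t ?p \<bullet> j) *\<^sub>R Dd (\<lambda>q. Dd F (h q) j) ?p v) =
    (\<Sum>i\<in>I. \<Sum>j\<in>I. ((?\<xi> \<bullet> i) * (\<eta>t ?p \<bullet> j)) *\<^sub>R Dd (\<lambda>\<theta>. Dd F \<theta> j) \<theta> i)"
    unfolding F2 scaleR_sum_right by (subst sum.swap) (simp add: mult.commute)
  finally show ?thesis by (simp add: \<eta>t_def F_def add.commute)
qed

end

context local_chart
begin

text \<open>\<open>tangent_space\<close> is a set of velocities, so linearity is not built in; it is
  read off in coordinates.\<close>

lemma tangent_space_diff:
  assumes "p \<in> N \<inter> M" "u \<in> tangent_space M p" "v \<in> tangent_space M p"
  shows "u - v \<in> tangent_space M p"
proof -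
  have p: "h p \<in> U" "\<psi> (h p) = p" using h assms(1) by auto
  then have l: "linear (Dd \<Psi> (h p))" using Cinf_linear_Dd[OF \<Psi>(1)] by (simp add: U)
  have "u - v = Dd \<Psi> (h p) (Dd h p u - Dd h p v)"
    using tangent_Dd_h(2)[OF assms(1)] assms(2,3) by (simp add: linear_diff[OF l])
  also have "\<dots> \<in> tangent_space M p"
    using Dd_\<Psi>_tangent[OF p(1), of "Dd h p u - Dd h p v"] tangent_Dd_h(1)[OF assms(1)] assms(2,3) p(2)
    by (simp add: span_diff)
  finally show ?thesis .
qed

end

text \<open>Both connections have Christoffel symbols of the form
  \<open>\<Sum> \<partial>\<^sub>i\<partial>\<^sub>ja \<partial>\<^sub>kb\<close>, where \<open>(a, b)\<close> is \<open>(log P, Q)\<close> or \<open>(Q, log P)\<close>, and the Fisher metric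
  is \<open>\<Sum> \<partial>\<^sub>ia \<partial>\<^sub>jb\<close> for either pair. Here \<open>a\<close> and \<open>b\<close> are smooth extensions of \<open>A\<close> and \<open>B\<close> to an
  open set.\<close>

locale dual_connection =
  fixes E :: "('x::finite \<times> 'x) set" and W H :: "'x kernel set"
    and a b A B :: "'x \<times> 'x \<Rightarrow> 'x kernel \<Rightarrow> real" and G :: "'x christoffel"
  assumes W: "W = markov_kernels E" "\<exists>n. smooth_manifold n W"
    and a: "\<And>e. e \<in> E \<Longrightarrow> Cinf H (a e)" "\<And>e P. e \<in> E \<Longrightarrow> P \<in> W \<Longrightarrow> A e P = a e P"
    and b: "\<And>e. e \<in> E \<Longrightarrow> Cinf H (b e)" "\<And>e P. e \<in> E \<Longrightarrow> P \<in> W \<Longrightarrow> B e P = b e P"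
    and H: "W \<subseteq> H" "\<And>e P. e \<in> E \<Longrightarrow> P \<in> H \<Longrightarrow> 0 < P $ fst e $ snd e"
    and G: "G = (\<lambda>\<psi> i j k \<theta>. \<Sum>e\<in>E. dir_deriv i (dir_deriv j (\<lambda>\<theta>. A e (\<psi> \<theta>))) \<theta> * dir_deriv k (\<lambda>\<theta>. B e (\<psi> \<theta>)) \<theta>)"
    and metric: "\<And>p u v. p \<in> W \<Longrightarrow> u \<in> tangent_space W p \<Longrightarrow> v \<in> tangent_space W p \<Longrightarrow>
      (\<Sum>e\<in>E. edge_measure p $ fst e $ snd e * (Dd (\<lambda>P. ln (P $ fst e $ snd e)) p u * Dd (\<lambda>P. ln (P $ fst e $ snd e)) p v)) =
      (\<Sum>e\<in>E. Dd (a e) p u * Dd (b e) p v)"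
    and pd: "\<And>p v. p \<in> W \<Longrightarrow> v \<in> tangent_space W p \<Longrightarrow> (\<Sum>e\<in>E. Dd (a e) p v * Dd (b e) p v) = 0 \<Longrightarrow> v = 0"
begin

text \<open>Pairing with db turns \<open>nb i j\<close> into \<partial>_i \<partial>_j a, by its
  defining equation. These are the second-order terms of X(Y a) in \<open>Dd_Dd_along_field\<close>;
  the first-order term \<open>la e w\<close> is common to both sides, so the chart disappears from
  the result.\<close>

lemma nabla_chart_value:
  assumes lc: "local_chart I U \<psi> W \<Omega> \<Psi> N h"
    and V: "V \<subseteq> W" "\<theta> \<in> U" "\<psi> \<theta> = p" "p \<in> N" "p \<in> V"
    and X: "X p \<in> tangent_space V p"
    and Y: "Cinf N' Yt" "p \<in> N'" "\<And>q. q \<in> N' \<inter> V \<Longrightarrow> Yt q \<in> tangent_space W q"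
      "\<And>q. q \<in> N' \<inter> V \<Longrightarrow> Y q = Yt q"
  defines "Z \<equiv> dir_deriv (nabla_coords E G I U \<psi> V X Y \<theta>) \<psi> \<theta>"
  shows "Z \<in> tangent_space W p"
    and "k \<in> tangent_space W p \<Longrightarrow>
      (\<Sum>e\<in>E. Dd (a e) p Z * Dd (b e) p k) = (\<Sum>e\<in>E. Dd (\<lambda>q. Dd (a e) q (Yt q)) p (X p) * Dd (b e) p k)"
proof -
  interpret local_chart I U \<psi> W \<Omega> \<Psi> N h by (fact lc)
  have \<theta>: "\<theta> \<in> \<Omega>" "\<Psi> \<theta> = p" "p \<in> N \<inter> W" "h p = \<theta>" using V \<Psi>(3) h(4) by (auto simp: U)
  have d\<Psi>: "\<Psi> differentiable (at \<theta>)" using \<Psi>(1) \<theta>(1) by (rule Cinf_differentiable)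
  have XW: "X p \<in> tangent_space W p" using X tangent_space_mono[OF V(1), of p] by auto
  have YW: "Y p \<in> tangent_space W p" "Y p = Yt p" using Y(3)[of p] Y(4)[of p] Y(2) V by auto
  define \<xi> where "\<xi> = Dd h p (X p)"
  define \<eta> where "\<eta> = Dd h p (Yt p)"
  define w where "w = Dd (\<lambda>q. Dd h q (Yt q)) p (X p)"
  define nb where "nb = (\<lambda>i j. nabla_basis E G I \<psi> i j \<theta>)"
  define tot where "tot = w + (\<Sum>i\<in>I. \<Sum>j\<in>I. ((\<xi> \<bullet> i) * (\<eta> \<bullet> j)) *\<^sub>R nb i j)"
  define la where "la = (\<lambda>e v. Dd (a e) p (Dd \<Psi> \<theta> v))"
  define lb where "lb = (\<lambda>e v. Dd (b e) p (Dd \<Psi> \<theta> v))"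
  define dd where "dd = (\<lambda>e i j. Dd (\<lambda>\<theta>. Dd (\<lambda>\<theta>. a e (\<Psi> \<theta>)) \<theta> j) \<theta> i)"
  have l\<Psi>: "linear (Dd \<Psi> \<theta>)" by (rule Cinf_linear_Dd[OF \<Psi>(1) \<theta>(1)])
  have pW: "p \<in> W" using V by auto
  have pH: "p \<in> H" using H(1) V by auto
  have lla: "linear (la e)" if "e \<in> E" for e
    unfolding la_def using linear_compose[OF l\<Psi> Cinf_linear_Dd[OF a(1)[OF that] pH]] by (simp add: o_def)
  have llb: "linear (lb e)" if "e \<in> E" for e
    unfolding lb_def using linear_compose[OF l\<Psi> Cinf_linear_Dd[OF b(1)[OF that] pH]] by (simp add: o_def)
  have coords: "coords I \<psi> \<theta> (X p) = \<xi>" "coords I \<psi> \<theta> (Y p) = \<eta>"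
    using coords_eq[of \<theta> "X p"] coords_eq[of \<theta> "Y p"] V XW YW by (auto simp: \<xi>_def \<eta>_def)
  have first: "(THE w. \<exists>D. ((\<lambda>\<theta>. coords I \<psi> \<theta> (Y (\<psi> \<theta>))) has_derivative D) (at \<theta> within {\<theta> \<in> U. \<psi> \<theta> \<in> V})
      \<and> w = D \<xi>) = w" and ws: "w \<in> span I"
    using nabla_coords_first_term[of V \<theta> "X p" N' Yt Y] V X Y by (simp_all add: \<xi>_def w_def)
  have ndef: "nabla_coords E G I U \<psi> V X Y \<theta> = tot"
    unfolding nabla_coords_def Let_def using V(3) coords first by (simp add: tot_def nb_def)
  have dir1: "dir_deriv v (\<lambda>\<theta>. F (\<psi> \<theta>)) \<theta>' = Dd (\<lambda>\<theta>. f (\<Psi> \<theta>)) \<theta>' v"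
    if "Cinf H f" "\<And>P. P \<in> W \<Longrightarrow> F P = f P" "v \<in> span I" "\<theta>' \<in> U" for f F v \<theta>'
  proof (rule dir_deriv_chart[OF that(4,3)])
    fix \<theta>'' assume "\<theta>'' \<in> U"
    then show "F (\<psi> \<theta>'') = f (\<Psi> \<theta>'')" using that(2)[of "\<Psi> \<theta>''"] \<Psi>(2,3) by (auto simp: U)
  next
    have "Cinf \<Omega> (\<lambda>\<theta>. f (\<Psi> \<theta>))"
      by (rule Cinf_compose[OF \<Psi>(1) that(1)]) (use \<Psi>(2) H(1) in auto)
    then show "(\<lambda>\<theta>. f (\<Psi> \<theta>)) differentiable at \<theta>'"
      using that(4) by (auto simp: U intro: Cinf_differentiable)
  qed
  have dir1': "dir_deriv v (\<lambda>\<theta>. F (\<psi> \<theta>)) \<theta> = Dd f p (Dd \<Psi> \<theta> v)"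
    if "Cinf H f" "\<And>P. P \<in> W \<Longrightarrow> F P = f P" "v \<in> span I" for f F v
    using dir1[OF that V(2)] Dd_compose[OF d\<Psi>, of f v] Cinf_differentiable[OF that(1) pH] \<theta>(2) by simp
  have dir2: "dir_deriv i (dir_deriv j (\<lambda>\<theta>. A e (\<psi> \<theta>))) \<theta> = dd e i j"
    if "e \<in> E" "i \<in> I" "j \<in> I" for e i j
    unfolding dd_def
  proof (rule dir_deriv_chart[OF V(2) span_base[OF that(2)]])
    fix \<theta>' assume "\<theta>' \<in> U"
    then show "dir_deriv j (\<lambda>\<theta>. A e (\<psi> \<theta>)) \<theta>' = Dd (\<lambda>\<theta>. a e (\<Psi> \<theta>)) \<theta>' j"
      using dir1[OF a(1) a(2)] that by (simp add: span_base)
  next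
    have "Cinf \<Omega> (\<lambda>\<theta>. a e (\<Psi> \<theta>))"
      by (rule Cinf_compose[OF \<Psi>(1) a(1)[OF that(1)]]) (use \<Psi>(2) H(1) in auto)
    from Cinf_Dd[OF this Cinf_const[OF Cinf_open[OF this], of j]]
    show "(\<lambda>\<theta>. Dd (\<lambda>\<theta>. a e (\<Psi> \<theta>)) \<theta> j) differentiable at \<theta>"
      using \<theta>(1) by (rule Cinf_differentiable)
  qed
  have oH: "open H" if "e \<in> E" for e using Cinf_open[OF a(1)[OF that]] .
  have Gij: "G \<psi> i j k \<theta> = (\<Sum>e\<in>E. dd e i j * lb e k)" if "i \<in> I" "j \<in> I" "k \<in> I" for i j k
    unfolding G lb_def
  proof (rule sum.cong[OF refl])
    fix e assume e: "e \<in> E"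
    have "dir_deriv k (\<lambda>\<theta>. B e (\<psi> \<theta>)) \<theta> = Dd (b e) p (Dd \<Psi> \<theta> k)"
      by (rule dir1'[of "b e" "B e"]) (use b e that in \<open>auto simp: span_base\<close>)
    then show "dir_deriv i (dir_deriv j (\<lambda>\<theta>. A e (\<psi> \<theta>))) \<theta> * dir_deriv k (\<lambda>\<theta>. B e (\<psi> \<theta>)) \<theta> =
      dd e i j * Dd (b e) p (Dd \<Psi> \<theta> k)"
      using dir2[OF e that(1,2)] by simp
  qed
  have T: "Dd \<Psi> \<theta> v \<in> tangent_space W p" if "v \<in> span I" for v
    using Dd_\<Psi>_tangent[OF V(2) that] V(3) by simp
  have lnC: "Cinf H (\<lambda>P. ln (P $ fst e $ snd e))" if "e \<in> E" for e
    by (intro Cinf_ln Cinf_nth Cinf_ident oH[OF that] H(2)[OF that])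
  have fisher: "fisher_metric E \<psi> l k \<theta> = (\<Sum>e\<in>E. la e l * lb e k)" if "l \<in> I" "k \<in> I" for l k
  proof -
    have "fisher_metric E \<psi> l k \<theta> = (\<Sum>e\<in>E. edge_measure p $ fst e $ snd e *
      (Dd (\<lambda>P. ln (P $ fst e $ snd e)) p (Dd \<Psi> \<theta> l) * Dd (\<lambda>P. ln (P $ fst e $ snd e)) p (Dd \<Psi> \<theta> k)))"
      unfolding fisher_metric_def split_beta
    proof (rule sum.cong[OF refl])
      fix e assume "e \<in> E"
      then show "edge_measure (\<psi> \<theta>) $ fst e $ snd e * dir_deriv l (\<lambda>\<theta>. ln (\<psi> \<theta> $ fst e $ snd e)) \<theta> *
         dir_deriv k (\<lambda>\<theta>. ln (\<psi> \<theta> $ fst e $ snd e)) \<theta> =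
         edge_measure p $ fst e $ snd e * (Dd (\<lambda>P. ln (P $ fst e $ snd e)) p (Dd \<Psi> \<theta> l) *
         Dd (\<lambda>P. ln (P $ fst e $ snd e)) p (Dd \<Psi> \<theta> k))"
        using dir1'[OF lnC refl span_base[OF that(1)]] dir1'[OF lnC refl span_base[OF that(2)]] V(3) by simp
    qed
    also have "\<dots> = (\<Sum>e\<in>E. la e l * lb e k)"
      unfolding la_def lb_def by (rule metric[OF pW]) (use that T span_base in auto)
    finally show ?thesis .
  qed
  have sum_l: "(\<Sum>l\<in>I. (c \<bullet> l) * fisher_metric E \<psi> l k \<theta>) = (\<Sum>e\<in>E. la e c * lb e k)"
    if "c \<in> span I" "k \<in> I" for c k
  proof -
    have "(\<Sum>l\<in>I. (c \<bullet> l) * fisher_metric E \<psi> l k \<theta>) = (\<Sum>l\<in>I. \<Sum>e\<in>E. ((c \<bullet> l) * la e l) * lb e k)"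
      by (rule sum.cong) (use fisher that in \<open>auto simp: sum_distrib_left mult.assoc\<close>)
    also have "\<dots> = (\<Sum>e\<in>E. (\<Sum>l\<in>I. (c \<bullet> l) * la e l) * lb e k)"
      by (subst sum.swap) (simp add: sum_distrib_right)
    also have "\<dots> = (\<Sum>e\<in>E. la e c * lb e k)"
      by (rule sum.cong) (use linear_span_expansion[OF lla I that(1)] in auto)
    finally show ?thesis .
  qed
  have nb: "nb i j \<in> span I" "\<And>k. k \<in> I \<Longrightarrow> (\<Sum>e\<in>E. la e (nb i j) * lb e k) = (\<Sum>e\<in>E. dd e i j * lb e k)"
    if "i \<in> I" "j \<in> I" for i j
  proof -
    \<comment> \<open>The description in \<open>nabla_basis\<close> is proper: this rests on
      \<open>pd\<close> and on injectivity of \<open>Dd \<Psi> \<theta>\<close>.\<close>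
    have "\<exists>!c. c \<in> span I \<and> (\<forall>k\<in>I. (\<Sum>l\<in>I. (c \<bullet> l) * fisher_metric E \<psi> l k \<theta>) = G \<psi> i j k \<theta>)"
    proof (rule pos_def_system_unique_solution[OF I])
      fix c assume c: "c \<in> span I" "(\<Sum>k\<in>I. (c \<bullet> k) * (\<Sum>l\<in>I. (c \<bullet> l) * fisher_metric E \<psi> l k \<theta>)) = 0"
      have "(\<Sum>k\<in>I. (c \<bullet> k) * (\<Sum>l\<in>I. (c \<bullet> l) * fisher_metric E \<psi> l k \<theta>)) = (\<Sum>k\<in>I. \<Sum>e\<in>E. la e c * ((c \<bullet> k) * lb e k))"
        by (rule sum.cong) (use sum_l c(1) in \<open>auto simp: sum_distrib_left mult_ac\<close>)
      also have "\<dots> = (\<Sum>e\<in>E. la e c * (\<Sum>k\<in>I. (c \<bullet> k) * lb e k))"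
        by (subst sum.swap) (simp add: sum_distrib_left)
      also have "\<dots> = (\<Sum>e\<in>E. la e c * lb e c)"
        by (rule sum.cong) (use linear_span_expansion[OF llb I c(1)] in auto)
      finally have "Dd \<Psi> \<theta> c = 0"
        using pd[OF pW T[OF c(1)]] c(2) by (simp add: la_def lb_def)
      then show "c = 0"
        using Dd_h_Dd_\<Psi>[OF V(2) _ c(1)] V linear_0[OF Cinf_linear_Dd[OF h(1) V(4)]] by simp
    qed
    from theI'[OF this] have *: "nb i j \<in> span I" "\<And>k. k \<in> I \<Longrightarrow> (\<Sum>l\<in>I. (nb i j \<bullet> l) * fisher_metric E \<psi> l k \<theta>) = G \<psi> i j k \<theta>"
      unfolding nb_def nabla_basis_def by auto
    show "nb i j \<in> span I" by fact
    fix k assume "k \<in> I"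
    then show "(\<Sum>e\<in>E. la e (nb i j) * lb e k) = (\<Sum>e\<in>E. dd e i j * lb e k)"
      using *(2)[of k] sum_l[OF *(1), of k] Gij[OF that] by simp
  qed
  have tots: "tot \<in> span I"
    unfolding tot_def by (intro span_add ws span_sum span_scale nb)
  have Z: "Z = Dd \<Psi> \<theta> tot"
    unfolding Z_def ndef using dir_deriv_\<psi>[OF V(2) tots] .
  show "Z \<in> tangent_space W p" unfolding Z by (rule T[OF tots])
  define d where "d = (\<lambda>e. Dd (\<lambda>q. Dd (a e) q (Yt q)) p (X p))"
  have d: "d e = la e w + (\<Sum>i\<in>I. \<Sum>j\<in>I. ((\<xi> \<bullet> i) * (\<eta> \<bullet> j)) * dd e i j)" if "e \<in> E" for e
    using Dd_Dd_along_field[of V \<theta> "X p" N' Yt H "a e"] V X Y(1-3) a(1)[OF that] H(1)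
    by (simp add: d_def la_def w_def \<xi>_def \<eta>_def dd_def)
  have la_tot: "la e tot = la e w + (\<Sum>i\<in>I. \<Sum>j\<in>I. ((\<xi> \<bullet> i) * (\<eta> \<bullet> j)) * la e (nb i j))" if "e \<in> E" for e
    unfolding tot_def
    by (simp add: linear_add[OF lla[OF that]] linear_sum[OF lla[OF that]] linear_cmul[OF lla[OF that]])
  have key: "(\<Sum>e\<in>E. la e tot * lb e k) = (\<Sum>e\<in>E. d e * lb e k)" if k: "k \<in> I" for k
  proof -
    have swap: "(\<Sum>e\<in>E. (\<Sum>i\<in>I. \<Sum>j\<in>I. ((\<xi> \<bullet> i) * (\<eta> \<bullet> j)) * f e i j) * lb e k) =
      (\<Sum>i\<in>I. \<Sum>j\<in>I. ((\<xi> \<bullet> i) * (\<eta> \<bullet> j)) * (\<Sum>e\<in>E. f e i j * lb e k))" for f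
    proof -
      have "(\<Sum>e\<in>E. (\<Sum>i\<in>I. \<Sum>j\<in>I. ((\<xi> \<bullet> i) * (\<eta> \<bullet> j)) * f e i j) * lb e k) =
        (\<Sum>e\<in>E. \<Sum>i\<in>I. \<Sum>j\<in>I. ((\<xi> \<bullet> i) * (\<eta> \<bullet> j)) * (f e i j * lb e k))"
        by (simp add: sum_distrib_right mult.assoc)
      also have "\<dots> = (\<Sum>i\<in>I. \<Sum>e\<in>E. \<Sum>j\<in>I. ((\<xi> \<bullet> i) * (\<eta> \<bullet> j)) * (f e i j * lb e k))"
        by (rule sum.swap)
      also have "\<dots> = (\<Sum>i\<in>I. \<Sum>j\<in>I. \<Sum>e\<in>E. ((\<xi> \<bullet> i) * (\<eta> \<bullet> j)) * (f e i j * lb e k))"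
        by (intro sum.cong refl sum.swap)
      finally show ?thesis by (simp add: sum_distrib_left)
    qed
    have "(\<Sum>e\<in>E. la e tot * lb e k) = (\<Sum>e\<in>E. la e w * lb e k) +
       (\<Sum>e\<in>E. (\<Sum>i\<in>I. \<Sum>j\<in>I. ((\<xi> \<bullet> i) * (\<eta> \<bullet> j)) * la e (nb i j)) * lb e k)"
      unfolding sum.distrib[symmetric] by (rule sum.cong) (auto simp: la_tot algebra_simps)
    also have "(\<Sum>e\<in>E. (\<Sum>i\<in>I. \<Sum>j\<in>I. ((\<xi> \<bullet> i) * (\<eta> \<bullet> j)) * la e (nb i j)) * lb e k) =
      (\<Sum>e\<in>E. (\<Sum>i\<in>I. \<Sum>j\<in>I. ((\<xi> \<bullet> i) * (\<eta> \<bullet> j)) * dd e i j) * lb e k)"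
      unfolding swap by (intro sum.cong refl) (use nb(2) k in auto)
    also have "(\<Sum>e\<in>E. la e w * lb e k) + \<dots> = (\<Sum>e\<in>E. d e * lb e k)"
      unfolding sum.distrib[symmetric] by (rule sum.cong) (auto simp: d algebra_simps)
    finally show ?thesis .
  qed
  assume k: "k \<in> tangent_space W p"
  define \<kappa> where "\<kappa> = Dd h p k"
  have \<kappa>: "\<kappa> \<in> span I" "Dd \<Psi> \<theta> \<kappa> = k"
    using tangent_Dd_h[OF \<theta>(3) k] \<theta>(4) by (auto simp: \<kappa>_def)
  \<comment> \<open>So far only coordinate vectors were tested; both sides are linear in the test
    vector, and every tangent vector comes from its coordinates \<open>\<kappa>\<close>.\<close>
  have lin: "linear (\<lambda>v. \<Sum>e\<in>E. f e * lb e v)" for f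
    by (intro linear_compose_sum ballI linear_compose_scale_right[where 'b=real, simplified] llb)
  have "(\<Sum>e\<in>E. la e tot * lb e \<kappa>) = (\<Sum>e\<in>E. d e * lb e \<kappa>)"
    using linear_eq_on[OF lin lin \<kappa>(1) key] .
  then show "(\<Sum>e\<in>E. Dd (a e) p Z * Dd (b e) p k) = (\<Sum>e\<in>E. Dd (\<lambda>q. Dd (a e) q (Yt q)) p (X p) * Dd (b e) p k)"
    by (simp add: la_def lb_def Z \<kappa>(2) d_def)
qed

text \<open>In every chart the value satisfies the same equations as \<open>z\<close>. Their
  difference is tangent, so testing on the difference itself and applying \<open>pd\<close> shows
  that it vanishes.\<close>

lemma nabla_eqI:
  assumes V: "V \<subseteq> W" "p \<in> V"
    and X: "X p \<in> tangent_space V p"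
    and Y: "Cinf N' Yt" "p \<in> N'" "\<And>q. q \<in> N' \<inter> V \<Longrightarrow> Yt q \<in> tangent_space W q"
      "\<And>q. q \<in> N' \<inter> V \<Longrightarrow> Y q = Yt q"
    and z: "z \<in> tangent_space W p" "\<And>k. k \<in> tangent_space W p \<Longrightarrow>
      (\<Sum>e\<in>E. Dd (a e) p z * Dd (b e) p k) = (\<Sum>e\<in>E. Dd (\<lambda>q. Dd (a e) q (Yt q)) p (X p) * Dd (b e) p k)"
  shows "nabla E G V X Y p = z"
  unfolding nabla_def
proof (rule the_equality)
  have pW: "p \<in> W" and pH: "p \<in> H" using V H(1) by auto
  have val: "dir_deriv (nabla_coords E G I U \<psi> V X Y \<theta>) \<psi> \<theta> = z"
    if c: "chart I U \<psi> (markov_kernels E)" "\<theta> \<in> U" "\<psi> \<theta> = p" for I U \<psi> \<theta>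
  proof -
    obtain \<Omega> \<Psi> N h where lc: "local_chart I U \<psi> W \<Omega> \<Psi> N h" "\<psi> \<theta> \<in> N"
      using chart_local_chart[OF c(1)[folded W(1)] c(2)] by metis
    define Z where "Z = dir_deriv (nabla_coords E G I U \<psi> V X Y \<theta>) \<psi> \<theta>"
    have pN: "p \<in> N" using lc(2) c(3) by simp
    have Z: "Z \<in> tangent_space W p"
      unfolding Z_def by (rule nabla_chart_value(1)[where X=X and Y=Y and Yt=Yt and N'=N', OF lc(1) V(1) c(2,3) pN V(2) X Y])
    have d: "Z - z \<in> tangent_space W p"
      by (rule local_chart.tangent_space_diff[OF lc(1)]) (use pN pW Z z(1) in auto)
    have eq: "(\<Sum>e\<in>E. Dd (a e) p Z * Dd (b e) p k) = (\<Sum>e\<in>E. Dd (a e) p z * Dd (b e) p k)"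
      if k: "k \<in> tangent_space W p" for k
      unfolding z(2)[OF k] Z_def
      by (rule nabla_chart_value(2)[where X=X and Y=Y and Yt=Yt and N'=N', OF lc(1) V(1) c(2,3) pN V(2) X Y k])
    have "(\<Sum>e\<in>E. Dd (a e) p (Z - z) * Dd (b e) p (Z - z)) =
      (\<Sum>e\<in>E. Dd (a e) p Z * Dd (b e) p (Z - z)) - (\<Sum>e\<in>E. Dd (a e) p z * Dd (b e) p (Z - z))"
      unfolding sum_subtractf[symmetric]
      by (rule sum.cong) (auto simp: linear_diff[OF Cinf_linear_Dd[OF a(1) pH]] left_diff_distrib)
    also have "\<dots> = 0" using eq[OF d] by simp
    finally have "Z - z = 0" by (rule pd[OF pW d])
    then show ?thesis by (simp add: Z_def)
  qed
  then show "\<forall>I U \<psi> \<theta>. chart I U \<psi> (markov_kernels E) \<and> \<theta> \<in> U \<and> \<psi> \<theta> = p \<longrightarrow>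
      dir_deriv (nabla_coords E G I U \<psi> V X Y \<theta>) \<psi> \<theta> = z"
    by blast
  fix z' assume z': "\<forall>I U \<psi> \<theta>. chart I U \<psi> (markov_kernels E) \<and> \<theta> \<in> U \<and> \<psi> \<theta> = p \<longrightarrow>
      dir_deriv (nabla_coords E G I U \<psi> V X Y \<theta>) \<psi> \<theta> = z'"
  \<comment> \<open>Without a chart around \<open>p\<close> every vector would meet the description;
    the manifold property of \<open>W\<close> supplies one.\<close>
  obtain I U \<psi> where "chart I U \<psi> (markov_kernels E)" "p \<in> \<psi> ` U"
    using W V unfolding smooth_manifold_def by blast
  then show "z' = z" using val z' by (metis imageE)
qed

end

section \<open>Stationary distributions and edge measures\<close>

text \<open>A quotient of polynomials in the entries, so smooth dependence on \<open>A\<close> and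
  \<open>b\<close> is visible. It solves the system only where \<open>det A\<close> is nonzero;
  elsewhere division by 0 gives 0.\<close>

definition cramer_solution :: "real^'n^'n \<Rightarrow> real^'n \<Rightarrow> real^'n" where
  "cramer_solution A b = (\<chi> k. det (\<chi> i j. if j = k then b $ i else A $ i $ j) / det A)"

lemma cramer_solution_iff: "det A \<noteq> 0 \<Longrightarrow> A *v x = b \<longleftrightarrow> x = cramer_solution A b"
  unfolding cramer_solution_def by (rule cramer)

lemma Cinf_cramer_solution:
  assumes "open S" "\<And>i j. Cinf S (\<lambda>p. A p $ i $ j)" "\<And>i. Cinf S (\<lambda>p. b p $ i)" "\<And>p. p \<in> S \<Longrightarrow> det (A p) \<noteq> 0"
  shows "Cinf S (\<lambda>p. cramer_solution (A p) (b p) $ k)"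
  unfolding cramer_solution_def vec_lambda_beta
proof (intro Cinf_divide Cinf_det assms)
  fix i j show "Cinf S (\<lambda>p. (\<chi> i j. if j = k then b p $ i else A p $ i $ j) $ i $ j)"
    by (cases "j = k") (simp_all add: assms)
qed

text \<open>The matrix \<open>I - P + J\<close>, with \<open>J\<close> the all-ones matrix, is invertible for irreducible \<open>P\<close>. It
  serves twice: \<open>\<pi> (I - P + J) = (1, \<dots>, 1)\<close> characterises the stationary distribution, and
  \<open>(I - P + J) f = b\<close> is the Poisson equation with the normalisation built in.\<close>

definition fundamental :: "'x::finite kernel \<Rightarrow> 'x kernel" where
  "fundamental P = (\<chi> x y. (if x = y then 1 else 0) - P $ x $ y + 1)"

lemma sum_delta_mult:
  fixes f :: "'x::finite \<Rightarrow> real"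
  shows "(\<Sum>y\<in>UNIV. (if x = y then 1 else 0) * f y) = f x" "(\<Sum>y\<in>UNIV. (if y = x then 1 else 0) * f y) = f x"
  by (simp_all add: mult_delta_left)

lemma fundamental_mult: "(fundamental P *v f) $ x = f $ x - (\<Sum>y\<in>UNIV. P $ x $ y * f $ y) + (\<Sum>y\<in>UNIV. f $ y)"
  by (simp add: fundamental_def matrix_vector_mult_def distrib_right left_diff_distrib sum.distrib sum_subtractf sum_delta_mult)

lemma transpose_fundamental_mult:
  "(transpose (fundamental P) *v f) $ y = f $ y - (\<Sum>x\<in>UNIV. P $ x $ y * f $ x) + (\<Sum>x\<in>UNIV. f $ x)"
  by (simp add: fundamental_def transpose_def matrix_vector_mult_def distrib_right left_diff_distrib sum.distrib sum_subtractf sum_delta_mult)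

text \<open>\<open>stationary\<close> is a description that carries no information away from
  kernels. This formula agrees with it on kernels and is smooth on an open set around them, so it
  has ambient derivatives. The transpose puts the row-vector equation into column form.\<close>

definition stat_ext :: "'x::finite kernel \<Rightarrow> real ^ 'x" where
  "stat_ext P = cramer_solution (transpose (fundamental P)) (\<chi> i. 1)"

lemma bounded_linear_entry: "bounded_linear (\<lambda>P::'x::finite kernel. P $ x $ y)"
  by (rule bounded_linear_compose[OF bounded_linear_vec_nth bounded_linear_vec_nth])

lemma has_derivative_entry [derivative_intros]:
  "((\<lambda>P::'x::finite kernel. P $ x $ y) has_derivative (\<lambda>v. v $ x $ y)) F"
  using bounded_linear_entry by (rule bounded_linear_imp_has_derivative)

section \<open>Maximum principle and stationary distribution of an irreducible kernel\<close>

locale connected_graph =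
  fixes E :: "('x::finite \<times> 'x) set"
  assumes conn: "(x, y) \<in> E\<^sup>*" and card2: "CARD('x) \<ge> 2"
begin

abbreviation "W \<equiv> markov_kernels E"

lemma W_nonneg: "P \<in> W \<Longrightarrow> 0 \<le> P $ x $ y"
  and W_pos: "P \<in> W \<Longrightarrow> (x, y) \<in> E \<Longrightarrow> 0 < P $ x $ y"
  and W_row: "P \<in> W \<Longrightarrow> (\<Sum>y\<in>UNIV. P $ x $ y) = 1"
  by (auto simp: markov_kernels_def)

lemma W_zero:
  assumes "P \<in> W" "(x, y) \<notin> E" shows "P $ x $ y = 0"
proof -
  have "\<not> 0 < P $ x $ y" using assms by (simp add: markov_kernels_def)
  then show ?thesis using W_nonneg[OF assms(1), of x y] by simp
qed

text \<open>At a maximum of \<open>f\<close>, the average of \<open>f\<close> under the row is at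
  most the value.\<close>

lemma sub_poisson:
  assumes P: "P \<in> W" and f: "\<And>x. f x - (\<Sum>y\<in>UNIV. P $ x $ y * f y) + c = (0::real)"
  shows "c \<le> 0"
proof -
  obtain x where x: "f y \<le> f x" for y
    using Max_in[of "range f"] Max_ge[of "range f"] by (metis UNIV_not_empty finite_imageI finite image_is_empty imageE rangeI)
  have "(\<Sum>y\<in>UNIV. P $ x $ y * f y) \<le> (\<Sum>y\<in>UNIV. P $ x $ y * f x)"
    by (intro sum_mono mult_left_mono x W_nonneg[OF P])
  also have "\<dots> = f x" using W_row[OF P, of x] by (simp flip: sum_distrib_right)
  finally show ?thesis using f[of x] by linarith
qed

text \<open>The bound for \<open>f\<close> and for its negative gives \<open>c = 0\<close>. A
  harmonic function with its maximum at a state has it at all successors, and strong connectivity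
  carries this to every state.\<close>

lemma poisson_const:
  assumes P: "P \<in> W" and f: "\<And>x. f x - (\<Sum>y\<in>UNIV. P $ x $ y * f y) + c = (0::real)"
  shows "c = 0" "f x = f y"
proof -
  have "- f x - (\<Sum>y\<in>UNIV. P $ x $ y * - f y) + - c = 0" for x
    using f[of x] by (simp add: sum_negf)
  from sub_poisson[OF P this] sub_poisson[OF P f] show c: "c = 0" by linarith
  obtain m where m: "f y \<le> f m" for y
    using Max_in[of "range f"] Max_ge[of "range f"] by (metis UNIV_not_empty finite_imageI finite image_is_empty imageE rangeI)
  have step: "f y = f m" if "f x = f m" "(x, y) \<in> E" for x y
  proof -
    have "(\<Sum>y\<in>UNIV. P $ x $ y * (f m - f y)) = f m - (\<Sum>y\<in>UNIV. P $ x $ y * f y)"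
      using W_row[OF P, of x] by (simp add: right_diff_distrib sum_subtractf flip: sum_distrib_right)
    also have "\<dots> = 0" using f[of x] c that by simp
    finally have "\<forall>y\<in>UNIV. P $ x $ y * (f m - f y) = 0"
      by (subst (asm) sum_nonneg_eq_0_iff) (auto simp: m W_nonneg[OF P])
    then show ?thesis using W_pos[OF P that(2)]
      by (metis UNIV_I less_irrefl mult_eq_0_iff right_minus_eq)
  qed
  have "f y = f m" for y
    using conn[of m y] by (induction rule: rtrancl_induct) (rule refl, rule step)
  then show "f x = f y" by metis
qed

text \<open>A null vector satisfies \<open>poisson_const\<close> with \<open>c\<close> its own
  total: the total is 0 and the vector is constant.\<close>

lemma det_fundamental:
  assumes P: "P \<in> W"
  shows "det (fundamental P) \<noteq> 0"
proof -
  have "f = 0" if f: "fundamental P *v f = 0" for f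
  proof -
    have eq: "f $ x - (\<Sum>y\<in>UNIV. P $ x $ y * f $ y) + (\<Sum>y\<in>UNIV. f $ y) = 0" for x
      using f fundamental_mult[of P f x] by simp
    have s: "(\<Sum>y\<in>UNIV. f $ y) = 0" by (rule poisson_const(1)[OF P, of "\<lambda>x. f $ x"]) (rule eq)
    have c: "f $ y = f $ x" for x y by (rule poisson_const(2)[OF P, of "\<lambda>x. f $ x"]) (rule eq)
    have "f $ x = 0" for x
    proof -
      have "(\<Sum>y\<in>UNIV. f $ y) = (\<Sum>y\<in>(UNIV::'x set). f $ x)" by (rule sum.cong) (auto intro: c)
      then show ?thesis using s by simp
    qed
    then show "f = 0" by (simp add: vec_eq_iff)
  qed
  then have "\<exists>B. B ** fundamental P = mat 1" by (simp add: matrix_left_invertible_ker)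
  then have "invertible (fundamental P)" unfolding invertible_left_inverse .
  then show ?thesis unfolding invertible_det_nz .
qed

lemma stat_eqI:
  assumes "P \<in> W" "(\<Sum>x\<in>UNIV. \<pi> $ x) = 1" "\<And>y. (\<Sum>x\<in>UNIV. P $ x $ y * \<pi> $ x) = \<pi> $ y"
  shows "\<pi> = stat_ext P"
proof -
  have "transpose (fundamental P) *v \<pi> = (\<chi> i. 1)"
    unfolding vec_eq_iff transpose_fundamental_mult using assms(2,3) by simp
  moreover have "det (transpose (fundamental P)) \<noteq> 0"
    using det_fundamental[OF assms(1)] by simp
  ultimately show ?thesis unfolding stat_ext_def by (rule cramer_solution_iff[THEN iffD1, rotated])
qed

text \<open>Summed over \<open>y\<close>, the first two terms of the equations cancel because rows
  of \<open>P\<close> sum to 1. This leaves the normalisation, which reduces each equation to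
  invariance.\<close>

lemma stat_ext:
  assumes P: "P \<in> W"
  shows stat_sum: "(\<Sum>x\<in>UNIV. stat_ext P $ x) = 1"
    and stat_inv: "(\<Sum>x\<in>UNIV. P $ x $ y * stat_ext P $ x) = stat_ext P $ y"
proof -
  let ?\<pi> = "stat_ext P"
  have "transpose (fundamental P) *v ?\<pi> = (\<chi> i. 1)"
    using det_fundamental[OF P] by (intro cramer_solution_iff[THEN iffD2]) (simp_all add: stat_ext_def)
  then have eq: "?\<pi> $ y - (\<Sum>x\<in>UNIV. P $ x $ y * ?\<pi> $ x) + (\<Sum>x\<in>UNIV. ?\<pi> $ x) = 1" for y
    unfolding vec_eq_iff transpose_fundamental_mult vec_lambda_beta by (rule spec)
  have "(\<Sum>y\<in>UNIV. \<Sum>x\<in>UNIV. P $ x $ y * ?\<pi> $ x) = (\<Sum>x\<in>UNIV. ?\<pi> $ x)"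
    by (subst sum.swap) (simp add: W_row[OF P] flip: sum_distrib_right)
  then have "(\<Sum>y\<in>UNIV. ?\<pi> $ y - (\<Sum>x\<in>UNIV. P $ x $ y * ?\<pi> $ x) + (\<Sum>x\<in>UNIV. ?\<pi> $ x)) = real CARD('x) * (\<Sum>x\<in>UNIV. ?\<pi> $ x)"
    by (simp add: sum.distrib sum_subtractf)
  then show s: "(\<Sum>x\<in>UNIV. ?\<pi> $ x) = 1" unfolding eq by simp
  show "(\<Sum>x\<in>UNIV. P $ x $ y * ?\<pi> $ x) = ?\<pi> $ y" using eq[of y] s by simp
qed

text \<open>By the triangle inequality the absolute values of \<pi> are dominated by their image
  under \<open>P\<close>, and equal totals force equality. Divided by \<open>s\<close> they meet the
  conditions of \<open>stat_eqI\<close>, hence equal \<pi>.\<close>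

lemma stat_nonneg:
  assumes P: "P \<in> W"
  shows "0 \<le> stat_ext P $ x"
proof -
  let ?\<pi> = "stat_ext P"
  define s where "s = (\<Sum>x\<in>UNIV. \<bar>?\<pi> $ x\<bar>)"
  have "1 \<le> s" unfolding s_def using sum_mono[of UNIV "\<lambda>x. ?\<pi> $ x" "\<lambda>x. \<bar>?\<pi> $ x\<bar>"] stat_sum[OF P] by simp
  have le: "\<bar>?\<pi> $ y\<bar> \<le> (\<Sum>x\<in>UNIV. P $ x $ y * \<bar>?\<pi> $ x\<bar>)" for y
  proof -
    have "\<bar>?\<pi> $ y\<bar> = \<bar>\<Sum>x\<in>UNIV. P $ x $ y * ?\<pi> $ x\<bar>" by (simp add: stat_inv[OF P])
    also have "\<dots> \<le> (\<Sum>x\<in>UNIV. \<bar>P $ x $ y * ?\<pi> $ x\<bar>)" by (rule sum_abs)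
    also have "\<dots> = (\<Sum>x\<in>UNIV. P $ x $ y * \<bar>?\<pi> $ x\<bar>)"
      by (simp add: abs_mult W_nonneg[OF P])
    finally show ?thesis .
  qed
  have tot: "(\<Sum>y\<in>UNIV. (\<Sum>x\<in>UNIV. P $ x $ y * \<bar>?\<pi> $ x\<bar>) - \<bar>?\<pi> $ y\<bar>) = 0"
  proof -
    have "(\<Sum>y\<in>UNIV. \<Sum>x\<in>UNIV. P $ x $ y * \<bar>?\<pi> $ x\<bar>) = s"
      by (subst sum.swap) (simp add: s_def W_row[OF P] flip: sum_distrib_right)
    then show ?thesis by (simp add: sum_subtractf s_def)
  qed
  have "\<forall>y\<in>UNIV. (\<Sum>x\<in>UNIV. P $ x $ y * \<bar>?\<pi> $ x\<bar>) - \<bar>?\<pi> $ y\<bar> = 0"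
    using tot by (subst (asm) sum_nonneg_eq_0_iff) (auto simp: le)
  then have inv: "(\<Sum>x\<in>UNIV. P $ x $ y * \<bar>?\<pi> $ x\<bar>) = \<bar>?\<pi> $ y\<bar>" for y by simp
  have "(\<chi> x. \<bar>?\<pi> $ x\<bar> / s) = ?\<pi>"
    by (rule stat_eqI[OF P]) (use \<open>1 \<le> s\<close> inv in \<open>simp_all add: s_def flip: sum_divide_distrib\<close>)
  then have "?\<pi> $ x = \<bar>?\<pi> $ x\<bar> / s" by (metis vec_lambda_beta)
  then show ?thesis using \<open>1 \<le> s\<close> by (metis abs_ge_zero divide_nonneg_nonneg order_trans zero_le_one)
qed

text \<open>A zero of \<pi> propagates against the edges and so would reach every state,
  contradicting total mass 1.\<close>

lemma stat_pos:
  assumes P: "P \<in> W"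
  shows "0 < stat_ext P $ x"
proof (rule ccontr)
  let ?\<pi> = "stat_ext P"
  assume "\<not> 0 < ?\<pi> $ x"
  then have x: "?\<pi> $ x = 0" using stat_nonneg[OF P, of x] by simp
  have step: "?\<pi> $ z = 0" if "?\<pi> $ y = 0" "(z, y) \<in> E" for y z
  proof -
    have "(\<Sum>x\<in>UNIV. P $ x $ y * ?\<pi> $ x) = 0" using that stat_inv[OF P] by simp
    then have "\<forall>x\<in>UNIV. P $ x $ y * ?\<pi> $ x = 0"
      by (subst (asm) sum_nonneg_eq_0_iff) (auto simp: W_nonneg[OF P] stat_nonneg[OF P])
    then show ?thesis using W_pos[OF P that(2)] by force
  qed
  have "?\<pi> $ z = 0" for z
    using conn[of z x] by (induction rule: converse_rtrancl_induct) (use x step in auto)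
  then show False using stat_sum[OF P] by simp
qed

lemma stationary_eq:
  assumes P: "P \<in> W"
  shows "stationary P = stat_ext P"
  unfolding stationary_def
proof (rule the_equality)
  show "(\<forall>x. 0 \<le> stat_ext P $ x) \<and> (\<Sum>x\<in>UNIV. stat_ext P $ x) = 1 \<and> stat_ext P v* P = stat_ext P"
    using stat_nonneg[OF P] stat_sum[OF P] stat_inv[OF P]
    by (auto simp: vector_matrix_mult_def vec_eq_iff mult.commute)
  fix \<pi> assume "(\<forall>x. 0 \<le> \<pi> $ x) \<and> (\<Sum>x\<in>UNIV. \<pi> $ x) = 1 \<and> \<pi> v* P = \<pi>"
  then show "\<pi> = stat_ext P"
    by (intro stat_eqI[OF P]) (auto simp: vector_matrix_mult_def vec_eq_iff mult.commute)
qed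

text \<open>An ambient neighbourhood of the kernels on which \<pi>, logarithms and quotients are
  smooth. No row-sum condition is imposed, as it would not be open.\<close>

definition stat_domain :: "'x kernel set" where
  "stat_domain = {P. det (fundamental P) \<noteq> 0 \<and> (\<forall>e\<in>E. 0 < P $ fst e $ snd e) \<and> (\<forall>x. 0 < stat_ext P $ x)}"

lemma W_subset_stat_domain: "W \<subseteq> stat_domain"
  using det_fundamental stat_pos W_pos by (auto simp: stat_domain_def)

lemma Cinf_fundamental: "Cinf UNIV (\<lambda>P::'x kernel. fundamental P $ i $ j)"
  unfolding fundamental_def vec_lambda_beta
  by (intro Cinf_add Cinf_diff Cinf_const Cinf_nth Cinf_ident open_UNIV)

lemma Cinf_stat_ext_det: "Cinf {P::'x kernel. det (fundamental P) \<noteq> 0} (\<lambda>P. stat_ext P $ x)"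
proof -
  have "Cinf UNIV (\<lambda>P::'x kernel. det (fundamental P))"
    by (intro Cinf_det Cinf_fundamental open_UNIV)
  from open_Cinf_preimage[OF this, of "- {0}"] have o: "open {P::'x kernel. det (fundamental P) \<noteq> 0}"
    by (simp add: vimage_def Compl_eq open_Collect_neq)
  have "Cinf {P::'x kernel. det (fundamental P) \<noteq> 0} (\<lambda>P. transpose (fundamental P) $ i $ j)" for i j
    using Cinf_subset[OF Cinf_fundamental o] by (simp add: transpose_def)
  then show ?thesis
    unfolding stat_ext_def
    by (rule Cinf_cramer_solution[OF o]) (simp_all add: Cinf_const o)
qed

lemma open_stat_domain: "open stat_domain"
proof -
  let ?D = "{P::'x kernel. det (fundamental P) \<noteq> 0}"
  have oD: "open ?D" using Cinf_open[OF Cinf_stat_ext_det] .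
  \<comment> \<open>\<open>stat_ext\<close> is known to be smooth only on \<open>?D\<close>, so each
    condition is paired with \<open>?D\<close>; the intersection ranges over a nonempty type and
    therefore keeps it.\<close>
  have "stat_domain = (\<Inter>e\<in>E. {P. 0 < P $ fst e $ snd e}) \<inter> (\<Inter>x. ?D \<inter> (\<lambda>P. stat_ext P $ x) -` {0<..})"
    by (auto simp: stat_domain_def)
  moreover have "open (\<Inter>e\<in>E. {P::'x kernel. 0 < P $ fst e $ snd e})"
    by (intro open_INT finite ballI open_Collect_less continuous_intros)
  moreover have "open (\<Inter>x. ?D \<inter> (\<lambda>P. stat_ext P $ x) -` {0<..})"
    by (intro open_INT finite ballI open_Cinf_preimage[OF Cinf_stat_ext_det]) auto
  ultimately show ?thesis by (simp only: open_Int)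
qed

lemma Cinf_stat_ext: "Cinf stat_domain (\<lambda>P. stat_ext P $ x)"
  by (rule Cinf_subset[OF Cinf_stat_ext_det open_stat_domain]) (auto simp: stat_domain_def)

lemma Cinf_entry: "Cinf stat_domain (\<lambda>P. P $ x $ y)"
  by (intro Cinf_nth Cinf_ident open_stat_domain)

definition edge_weight :: "'x \<times> 'x \<Rightarrow> 'x kernel \<Rightarrow> real" where
  "edge_weight e P = stat_ext P $ fst e * P $ fst e $ snd e"

definition log_entry :: "'x \<times> 'x \<Rightarrow> 'x kernel \<Rightarrow> real" where
  "log_entry e P = ln (P $ fst e $ snd e)"

lemma Cinf_edge_weight: "Cinf stat_domain (edge_weight e)"
  unfolding edge_weight_def[abs_def] by (intro Cinf_mult Cinf_stat_ext Cinf_entry)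

lemma Cinf_log_entry: "e \<in> E \<Longrightarrow> Cinf stat_domain (log_entry e)"
  unfolding log_entry_def[abs_def] by (intro Cinf_ln Cinf_entry) (auto simp: stat_domain_def)

lemma edge_measure_eq: "P \<in> W \<Longrightarrow> edge_measure P $ x $ y = edge_weight (x, y) P"
  by (simp add: edge_measure_def stationary_eq edge_weight_def)

lemma Dd_entry: "Dd (\<lambda>P. P $ x $ y) p v = v $ x $ y" for p v :: "'x kernel"
proof -
  show ?thesis by (simp add: Dd_eqI[OF has_derivative_entry])
qed

lemma Dd_edge_weight: "p \<in> stat_domain \<Longrightarrow> Dd (edge_weight e) p v = Dd (\<lambda>P. stat_ext P $ fst e) p v * p $ fst e $ snd e + stat_ext p $ fst e * v $ fst e $ snd e"
proof -
  assume p: "p \<in> stat_domain"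
  have "(edge_weight e has_derivative (\<lambda>v. stat_ext p $ fst e * v $ fst e $ snd e +
    Dd (\<lambda>P. stat_ext P $ fst e) p v * p $ fst e $ snd e)) (at p)"
    unfolding edge_weight_def[abs_def]
    by (intro has_derivative_mult Cinf_has_derivative[OF Cinf_stat_ext p]) (auto intro!: derivative_eq_intros)
  then show ?thesis by (simp add: Dd_eqI)
qed

lemma Dd_log_entry:
  assumes "p \<in> stat_domain" "e \<in> E" shows "Dd (log_entry e) p v = v $ fst e $ snd e / p $ fst e $ snd e"
proof -
  have "0 < p $ fst e $ snd e" using assms by (auto simp: stat_domain_def)
  then have "(log_entry e has_derivative (\<lambda>v. v $ fst e $ snd e / p $ fst e $ snd e)) (at p)"
    unfolding log_entry_def[abs_def]
    by (auto intro!: derivative_eq_intros simp: divide_inverse)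
  then show ?thesis by (simp add: Dd_eqI)
qed

lemma sum_E: "(\<Sum>e\<in>E. F e) = (\<Sum>x\<in>UNIV. \<Sum>y\<in>UNIV. F (x, y))"
  if "\<And>x y. (x, y) \<notin> E \<Longrightarrow> F (x, y) = (0::real)"
proof -
  have "(\<Sum>x\<in>UNIV. \<Sum>y\<in>UNIV. F (x, y)) = (\<Sum>e\<in>UNIV. F e)"
    by (simp add: sum.cartesian_product flip: UNIV_Times_UNIV)
  also have "\<dots> = (\<Sum>e\<in>E. F e)"
    by (rule sum.mono_neutral_right) (use that in auto)
  finally show ?thesis by simp
qed

section \<open>Linear constraints on tangent vectors of the kernel manifold\<close>

context
  fixes p v assumes p: "p \<in> W" and v: "v \<in> tangent_space W p"
begin

lemma tangent_W_zero:
  assumes "(x, y) \<notin> E" shows "v $ x $ y = 0"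
proof -
  have "(\<lambda>P::'x kernel. P $ x $ y) differentiable (at p)"
    by (rule differentiableI[OF has_derivative_entry])
  then have "Dd (\<lambda>P. P $ x $ y) p v = 0"
    by (rule Dd_tangent_const[OF v open_UNIV UNIV_I, of _ 0, rotated]) (simp add: W_zero assms)
  then show ?thesis by (simp add: Dd_entry)
qed

lemma tangent_W_row: "(\<Sum>y\<in>UNIV. v $ x $ y) = 0"
proof -
  have hd: "((\<lambda>P. \<Sum>y\<in>UNIV. P $ x $ y) has_derivative (\<lambda>v. \<Sum>y\<in>UNIV. v $ x $ y)) (at p)"
    by (intro has_derivative_sum has_derivative_entry)
  have "Dd (\<lambda>P. \<Sum>y\<in>UNIV. P $ x $ y) p v = 0"
    by (rule Dd_tangent_const[OF v open_UNIV UNIV_I, of _ 1]) (simp add: W_row, rule differentiableI[OF hd])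
  then show ?thesis by (simp add: Dd_eqI[OF hd])
qed

lemma pH: "p \<in> stat_domain" using p W_subset_stat_domain by auto

lemma tangent_W_stat_sum: "(\<Sum>x\<in>UNIV. Dd (\<lambda>P. stat_ext P $ x) p v) = 0"
proof -
  have hd: "((\<lambda>P. \<Sum>x\<in>UNIV. stat_ext P $ x) has_derivative (\<lambda>v. \<Sum>x\<in>UNIV. Dd (\<lambda>P. stat_ext P $ x) p v)) (at p)"
    by (intro has_derivative_sum Cinf_has_derivative[OF Cinf_stat_ext pH])
  have "Dd (\<lambda>P. \<Sum>x\<in>UNIV. stat_ext P $ x) p v = 0"
    by (rule Dd_tangent_const[OF v open_UNIV UNIV_I, of _ 1]) (simp add: stat_sum, rule differentiableI[OF hd])
  then show ?thesis by (simp add: Dd_eqI[OF hd])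
qed

lemma tangent_W_Q_zero:
  assumes "(x, y) \<notin> E" shows "Dd (edge_weight (x, y)) p v = 0"
proof -
  have "Dd (edge_weight (x, y)) p v = Dd (\<lambda>P. stat_ext P $ x) p v * p $ x $ y + stat_ext p $ x * v $ x $ y"
    using Dd_edge_weight[OF pH, of "(x, y)" v] by (simp only: fst_conv snd_conv)
  then show ?thesis by (simp only: tangent_W_zero[OF assms] W_zero[OF p assms] mult_zero_right add_0)
qed

lemma tangent_W_Q_row: "(\<Sum>y\<in>UNIV. Dd (edge_weight (x, y)) p v) = Dd (\<lambda>P. stat_ext P $ x) p v"
proof -
  have "Dd (edge_weight (x, y)) p v = Dd (\<lambda>P. stat_ext P $ x) p v * p $ x $ y + stat_ext p $ x * v $ x $ y" for y
    using Dd_edge_weight[OF pH, of "(x, y)" v] by (simp only: fst_conv snd_conv)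
  then have "(\<Sum>y\<in>UNIV. Dd (edge_weight (x, y)) p v) =
    Dd (\<lambda>P. stat_ext P $ x) p v * (\<Sum>y\<in>UNIV. p $ x $ y) + stat_ext p $ x * (\<Sum>y\<in>UNIV. v $ x $ y)"
    by (simp only: sum.distrib sum_distrib_left)
  then show ?thesis by (simp only: tangent_W_row W_row[OF p] mult_zero_right mult_1_right add_0_right)
qed

text \<open>Derivative of the stationarity equation. With \<open>tangent_W_Q_row\<close> it says
  that both marginals of dQ(v) coincide, which is why coboundaries f(y) - f(x) pair to 0 with
  it.\<close>

lemma tangent_W_Q_col: "(\<Sum>x\<in>UNIV. Dd (edge_weight (x, y)) p v) = Dd (\<lambda>P. stat_ext P $ y) p v"
proof -
  have hd: "((\<lambda>P. \<Sum>x\<in>UNIV. edge_weight (x, y) P) has_derivative (\<lambda>v. \<Sum>x\<in>UNIV. Dd (edge_weight (x, y)) p v)) (at p)"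
    by (intro has_derivative_sum Cinf_has_derivative[OF Cinf_edge_weight pH])
  have "Dd (\<lambda>P. \<Sum>x\<in>UNIV. edge_weight (x, y) P) p v = Dd (\<lambda>P. stat_ext P $ y) p v"
    by (rule Dd_tangent_eq[OF v open_UNIV UNIV_I _ differentiableI[OF hd] Cinf_differentiable[OF Cinf_stat_ext pH]])
      (simp add: edge_weight_def stat_inv mult.commute[of "stat_ext _ $ _"])
  then show ?thesis by (simp add: Dd_eqI[OF hd])
qed

text \<open>From Q = \<pi> P follows dQ(v) = d\<pi>(v) P + Q dlog P(v). Multiplied by dlog P(u), the
  first summand becomes d\<pi>(v)(x) u(x, y), and it sums to 0 because the rows of \<open>u\<close>
  do.\<close>

lemma tangent_W_metric_log_entry_edge_weight:
  assumes u: "\<And>x y. (x, y) \<notin> E \<Longrightarrow> u $ x $ y = 0" "\<And>x. (\<Sum>y\<in>UNIV. u $ x $ y) = 0"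
  shows "(\<Sum>e\<in>E. Dd (log_entry e) p u * Dd (edge_weight e) p v) = (\<Sum>e\<in>E. edge_weight e p * (Dd (log_entry e) p u * Dd (log_entry e) p v))"
proof -
  have "(\<Sum>e\<in>E. Dd (log_entry e) p u * Dd (edge_weight e) p v) =
    (\<Sum>e\<in>E. Dd (\<lambda>P. stat_ext P $ fst e) p v * u $ fst e $ snd e) + (\<Sum>e\<in>E. edge_weight e p * (Dd (log_entry e) p u * Dd (log_entry e) p v))"
    unfolding sum.distrib[symmetric]
  proof (rule sum.cong[OF refl])
    fix e assume e: "e \<in> E"
    then have "0 < p $ fst e $ snd e" using pH by (auto simp: stat_domain_def)
    then show "Dd (log_entry e) p u * Dd (edge_weight e) p v = Dd (\<lambda>P. stat_ext P $ fst e) p v * u $ fst e $ snd e + edge_weight e p * (Dd (log_entry e) p u * Dd (log_entry e) p v)"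
      unfolding Dd_edge_weight[OF pH] Dd_log_entry[OF pH e] edge_weight_def by (simp add: field_simps)
  qed
  also have "(\<Sum>e\<in>E. Dd (\<lambda>P. stat_ext P $ fst e) p v * u $ fst e $ snd e) = 0"
    by (subst sum_E) (simp_all add: u(1) sum_distrib_left[symmetric] u(2))
  finally show ?thesis by simp
qed

lemma tangent_W_metric_pos:
  assumes "(\<Sum>e\<in>E. edge_weight e p * (Dd (log_entry e) p v * Dd (log_entry e) p v)) = 0"
  shows "v = 0"
proof -
  have pos: "0 < edge_weight e p" "0 < p $ fst e $ snd e" if "e \<in> E" for e
    using that pH unfolding stat_domain_def edge_weight_def by auto
  have "0 \<le> edge_weight e p * (Dd (log_entry e) p v * Dd (log_entry e) p v)" if "e \<in> E" for e
    using pos(1)[OF that] by (intro mult_nonneg_nonneg zero_le_square less_imp_le)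
  then have "\<forall>e\<in>E. edge_weight e p * (Dd (log_entry e) p v * Dd (log_entry e) p v) = 0"
    using assms by (subst (asm) sum_nonneg_eq_0_iff) simp_all
  then have "v $ fst e $ snd e = 0" if "e \<in> E" for e
    using that pos[OF that] by (auto simp: Dd_log_entry[OF pH])
  then have "v $ x $ y = 0" for x y
    using tangent_W_zero[of x y] by (metis fst_conv snd_conv)
  then show ?thesis by (simp add: vec_eq_iff)
qed

end

end

section \<open>Reversible kernels\<close>

text \<open>Relative to a base kernel \<open>P0\<close>, zero entries and row sums are linear
  conditions and positivity on \<open>E\<close> is open, so a single chart suffices.\<close>

lemma (in connected_graph) smooth_manifold_W: "\<exists>n. smooth_manifold n W"
proof (cases "W = {}")
  case True
  then show ?thesis by (auto simp: smooth_manifold_def)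
next
  case False
  then obtain P0 where P0: "P0 \<in> W" by auto
  define L where "L = {v::'x kernel. (\<forall>x y. (x, y) \<notin> E \<longrightarrow> v $ x $ y = 0) \<and> (\<forall>x. (\<Sum>y\<in>UNIV. v $ x $ y) = 0)}"
  have L: "subspace L"
    by (auto simp: L_def subspace_def sum.distrib simp flip: scaleR_sum_right sum_distrib_left)
  define G where "G = (\<Inter>e\<in>E. {\<theta>. 0 < P0 $ fst e $ snd e + \<theta> $ fst e $ snd e})"
  have G: "open G"
    unfolding G_def by (intro open_INT finite ballI open_Collect_less continuous_intros)
  have WLG: "P0 + \<theta> \<in> W \<longleftrightarrow> \<theta> \<in> L \<inter> G" for \<theta>
  proof
    assume a: "P0 + \<theta> \<in> W"
    have "\<theta> $ x $ y = 0" if "(x, y) \<notin> E" for x y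
      using W_zero[OF a that] W_zero[OF P0 that] by simp
    moreover have "(\<Sum>y\<in>UNIV. \<theta> $ x $ y) = 0" for x
      using W_row[OF a, of x] W_row[OF P0, of x] by (simp add: sum.distrib)
    moreover have "0 < P0 $ x $ y + \<theta> $ x $ y" if "(x, y) \<in> E" for x y
      using W_pos[OF a that] by simp
    ultimately show "\<theta> \<in> L \<inter> G" by (auto simp: L_def G_def)
  next
    assume a: "\<theta> \<in> L \<inter> G"
    have z: "(P0 + \<theta>) $ x $ y = 0" if "(x, y) \<notin> E" for x y
      using a W_zero[OF P0 that] that by (auto simp: L_def)
    have pos: "0 < (P0 + \<theta>) $ x $ y" if "(x, y) \<in> E" for x y
      using a that by (force simp: G_def)
    have row: "(\<Sum>y\<in>UNIV. (P0 + \<theta>) $ x $ y) = 1" for x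
      using a W_row[OF P0, of x] by (simp add: L_def sum.distrib)
    show "P0 + \<theta> \<in> W"
      unfolding markov_kernels_def
    proof (intro CollectI conjI allI)
      fix x y
      show "(\<Sum>y\<in>UNIV. (P0 + \<theta>) $ x $ y) = 1" by (rule row)
      show "0 < (P0 + \<theta>) $ x $ y \<longleftrightarrow> (x, y) \<in> E" using z pos by (metis less_irrefl)
      show "0 \<le> (P0 + \<theta>) $ x $ y" using z pos by (metis less_imp_le order_refl)
    qed
  qed
  have "smooth_manifold (dim L) W"
  proof (rule smooth_manifold_affine[OF L G, of "\<lambda>\<theta>. P0 + \<theta>" W "\<lambda>q. q - P0"])
    show "Cinf G (\<lambda>\<theta>. P0 + \<theta>)" by (intro Cinf_add Cinf_const Cinf_ident G)
    show "Cinf UNIV (\<lambda>q. q - P0)" by (intro Cinf_diff Cinf_const Cinf_ident open_UNIV)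
    show "\<And>q. q \<in> W \<Longrightarrow> q - P0 \<in> L \<inter> G" using WLG[of "q - P0" for q] by simp
  qed (use WLG in simp_all)
  then show ?thesis by blast
qed

section \<open>Reversible kernels as normalised symmetric measures\<close>

definition row_sum :: "'x::finite kernel \<Rightarrow> 'x \<Rightarrow> real" where
  "row_sum Q x = (\<Sum>y\<in>UNIV. Q $ x $ y)"

definition normalize_rows :: "'x::finite kernel \<Rightarrow> 'x kernel" where
  "normalize_rows Q = (\<chi> x y. Q $ x $ y / row_sum Q x)"

lemma row_sum_linear: "row_sum (Q + t *\<^sub>R K) x = row_sum Q x + t * row_sum K x"
  by (simp add: row_sum_def sum.distrib sum_distrib_left)

lemma Cinf_row_sum: "open S \<Longrightarrow> Cinf S (\<lambda>Q. row_sum Q x)"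
  unfolding row_sum_def by (intro Cinf_sum Cinf_nth Cinf_ident)

lemma has_derivative_row_sum: "((\<lambda>Q. row_sum Q x) has_derivative (\<lambda>v. row_sum v x)) F"
  unfolding row_sum_def by (intro has_derivative_sum has_derivative_entry)

locale symmetric_graph = connected_graph E for E :: "('x::finite \<times> 'x) set" +
  assumes symE: "(x, y) \<in> E \<Longrightarrow> (y, x) \<in> E"
begin

abbreviation "V \<equiv> reversible_kernels E"

definition edge_matrix :: "'x kernel \<Rightarrow> 'x kernel" where
  "edge_matrix P = (\<chi> x y. edge_weight (x, y) P)"

lemma edge_matrix_nth: "edge_matrix P $ x $ y = stat_ext P $ x * P $ x $ y"
  by (simp add: edge_matrix_def edge_weight_def)

lemma V_iff: "P \<in> V \<longleftrightarrow> P \<in> W \<and> (\<forall>x y. edge_matrix P $ x $ y = edge_matrix P $ y $ x)"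
  unfolding reversible_kernels_def edge_matrix_nth by (auto simp: stationary_eq)

lemma V_subset_W: "V \<subseteq> W" using V_iff by blast

definition sym_measures :: "'x kernel set" where
  "sym_measures = {Q. (\<forall>x y. Q $ x $ y = Q $ y $ x) \<and> (\<forall>x y. (x, y) \<notin> E \<longrightarrow> Q $ x $ y = 0) \<and>
     (\<forall>e\<in>E. 0 < Q $ fst e $ snd e) \<and> (\<Sum>x\<in>UNIV. row_sum Q x) = 1}"

text \<open>A path to a second state has a first edge. This is where \<open>card2\<close> enters: a
  single state without a loop is connected by reflexivity alone.\<close>

lemma out_edge: "\<exists>y. (x, y) \<in> E"
proof -
  obtain z where "z \<noteq> x"
  proof -
    have "UNIV \<noteq> {x}" using card2 by (metis One_nat_def card.empty card.insert empty_iff finite.emptyI numeral_le_one_iff semiring_norm(69))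
    then show ?thesis using that by blast
  qed
  then show ?thesis using conn[of x z] by (metis converse_rtranclE)
qed

lemma sym_measures_row_pos:
  assumes "Q \<in> sym_measures" shows "0 < row_sum Q x"
proof -
  have nn: "0 \<le> Q $ x $ y" for y
    using assms by (cases "(x, y) \<in> E") (force simp: sym_measures_def)+
  obtain y where "(x, y) \<in> E" using out_edge by blast
  then have "0 < Q $ x $ y" using assms by (force simp: sym_measures_def)
  also have "Q $ x $ y \<le> row_sum Q x"
    unfolding row_sum_def by (rule member_le_sum) (use nn in auto)
  finally show ?thesis .
qed

text \<open>Symmetry gives \<open>Q\<close> equal row and column sums, so the row sums are
  stationary for the normalised kernel, and reweighting by them returns \<open>Q\<close>.\<close>

lemma normalize_rows_sym_measures:
  assumes Q: "Q \<in> sym_measures"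
  shows "normalize_rows Q \<in> V" "edge_matrix (normalize_rows Q) = Q"
proof -
  have pos: "0 < Q $ x $ y" if "(x, y) \<in> E" for x y using Q that by (force simp: sym_measures_def)
  have zero: "Q $ x $ y = 0" if "(x, y) \<notin> E" for x y using Q that by (auto simp: sym_measures_def)
  have sy: "Q $ x $ y = Q $ y $ x" for x y using Q by (simp add: sym_measures_def)
  note rp = sym_measures_row_pos[OF Q]
  have e: "normalize_rows Q $ x $ y * row_sum Q x = Q $ x $ y" for x y
    using rp[of x] by (simp add: normalize_rows_def)
  have W: "normalize_rows Q \<in> W"
    unfolding markov_kernels_def
  proof (intro CollectI conjI allI)
    fix x y
    show "(\<Sum>y\<in>UNIV. normalize_rows Q $ x $ y) = 1"
      using rp[of x] by (simp add: normalize_rows_def row_sum_def flip: sum_divide_distrib)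
    show "0 < normalize_rows Q $ x $ y \<longleftrightarrow> (x, y) \<in> E"
      using rp[of x] pos[of x y] zero[of x y] by (cases "(x, y) \<in> E") (auto simp: normalize_rows_def)
    show "0 \<le> normalize_rows Q $ x $ y"
      using rp[of x] pos[of x y] zero[of x y] by (cases "(x, y) \<in> E") (auto simp: normalize_rows_def)
  qed
  have "(\<chi> x. row_sum Q x) = stat_ext (normalize_rows Q)"
  proof (rule stat_eqI[OF W])
    show "(\<Sum>x\<in>UNIV. (\<chi> x. row_sum Q x) $ x) = 1" using Q by (simp add: sym_measures_def)
    show "(\<Sum>x\<in>UNIV. normalize_rows Q $ x $ y * (\<chi> x. row_sum Q x) $ x) = (\<chi> x. row_sum Q x) $ y" for y
      unfolding vec_lambda_beta e unfolding row_sum_def by (rule sum.cong[OF refl sy])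
  qed
  then have "stat_ext (normalize_rows Q) $ x = row_sum Q x" for x by (metis vec_lambda_beta)
  then show edge_matrix: "edge_matrix (normalize_rows Q) = Q"
    using e by (simp add: vec_eq_iff edge_matrix_nth mult.commute)
  show "normalize_rows Q \<in> V"
    unfolding V_iff edge_matrix using W sy by blast
qed

lemma row_sum_edge_matrix: "P \<in> W \<Longrightarrow> row_sum (edge_matrix P) x = stat_ext P $ x"
  by (simp add: row_sum_def edge_matrix_nth W_row flip: sum_distrib_left)

lemma edge_matrix_V:
  assumes P: "P \<in> V"
  shows "edge_matrix P \<in> sym_measures" "normalize_rows (edge_matrix P) = P"
proof -
  have W: "P \<in> W" using P V_subset_W by auto
  show "normalize_rows (edge_matrix P) = P"
    using stat_pos[OF W] by (simp add: normalize_rows_def vec_eq_iff row_sum_edge_matrix[OF W] less_imp_neq[symmetric] edge_matrix_nth)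
  show "edge_matrix P \<in> sym_measures"
    unfolding sym_measures_def
  proof (intro CollectI conjI allI ballI impI)
    fix x y show "edge_matrix P $ x $ y = edge_matrix P $ y $ x" using P by (simp add: V_iff)
    show "edge_matrix P $ x $ y = 0" if "(x, y) \<notin> E" using W_zero[OF W that] by (simp add: edge_matrix_nth)
  next
    fix e assume "e \<in> E"
    then show "0 < edge_matrix P $ fst e $ snd e"
      using W_pos[OF W, of "fst e" "snd e"] stat_pos[OF W] by (simp add: edge_matrix_nth)
  next
    show "(\<Sum>x\<in>UNIV. row_sum (edge_matrix P) x) = 1" by (simp add: row_sum_edge_matrix[OF W] stat_sum[OF W])
  qed
qed

text \<open>In an open set the entries off \<open>E\<close> have no fixed sign, so positivity of the
  row sums, needed for smooth normalisation, is a separate condition.\<close>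

definition pos_matrices :: "'x kernel set" where
  "pos_matrices = {Q. (\<forall>e\<in>E. 0 < Q $ fst e $ snd e) \<and> (\<forall>x. 0 < row_sum Q x)}"

lemma open_pos_matrices: "open pos_matrices"
proof -
  have "pos_matrices = (\<Inter>e\<in>E. {Q. 0 < Q $ fst e $ snd e}) \<inter> (\<Inter>x. {Q. 0 < row_sum Q x})"
    by (auto simp: pos_matrices_def)
  moreover have "open (\<Inter>e\<in>E. {Q::'x kernel. 0 < Q $ fst e $ snd e})"
    by (intro open_INT finite ballI open_Collect_less continuous_intros)
  moreover have "open (\<Inter>x. {Q::'x kernel. 0 < row_sum Q x})"
    unfolding row_sum_def by (intro open_INT finite ballI open_Collect_less continuous_intros)
  ultimately show ?thesis by (simp only: open_Int)
qed

lemma sym_measures_subset_pos_matrices: "sym_measures \<subseteq> pos_matrices"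
  using sym_measures_row_pos by (auto simp: pos_matrices_def sym_measures_def)

lemma Cinf_normalize_rows: "Cinf pos_matrices normalize_rows"
proof (rule Cinf_matrix[OF open_pos_matrices])
  fix x y
  have "Cinf pos_matrices (\<lambda>Q. Q $ x $ y / row_sum Q x)"
  proof (intro Cinf_divide Cinf_row_sum Cinf_nth Cinf_ident open_pos_matrices)
    fix Q assume "Q \<in> pos_matrices"
    then have "0 < row_sum Q x" by (simp add: pos_matrices_def)
    then show "row_sum Q x \<noteq> 0" by simp
  qed
  then show "Cinf pos_matrices (\<lambda>Q. normalize_rows Q $ x $ y)" by (simp add: normalize_rows_def)
qed

lemma Cinf_edge_matrix: "Cinf stat_domain edge_matrix"
proof (rule Cinf_matrix[OF open_stat_domain])
  show "Cinf stat_domain (\<lambda>P. edge_matrix P $ x $ y)" for x y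
    using Cinf_edge_weight[of "(x, y)"] by (simp add: edge_matrix_def)
qed

definition sym_matrices :: "'x kernel set" where
  "sym_matrices = {v. (\<forall>x y. v $ x $ y = v $ y $ x) \<and> (\<forall>x y. (x, y) \<notin> E \<longrightarrow> v $ x $ y = 0)}"

definition sym_matrices0 :: "'x kernel set" where
  "sym_matrices0 = {v \<in> sym_matrices. (\<Sum>x\<in>UNIV. row_sum v x) = 0}"

lemma subspace_sym_matrices: "subspace sym_matrices"
  by (auto simp: sym_matrices_def subspace_def)

lemma subspace_sym_matrices0: "subspace sym_matrices0"
  using subspace_sym_matrices row_sum_linear[of 0]  row_sum_linear[of _ 1]
  by (auto simp: sym_matrices0_def subspace_def sum.distrib row_sum_def simp flip: sum_distrib_left)

lemma sym_measures_affine: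
  assumes Q: "Q0 \<in> sym_measures"
  shows "Q0 + \<theta> \<in> sym_measures \<longleftrightarrow> \<theta> \<in> sym_matrices0 \<and> Q0 + \<theta> \<in> pos_matrices"
proof -
  have r: "row_sum (Q0 + \<theta>) x = row_sum Q0 x + row_sum \<theta> x" for x
    using row_sum_linear[of Q0 1 \<theta>] by simp
  have s: "(\<Sum>x\<in>UNIV. row_sum (Q0 + \<theta>) x) = 1 \<longleftrightarrow> (\<Sum>x\<in>UNIV. row_sum \<theta> x) = 0"
    using Q by (simp add: r sum.distrib sym_measures_def)
  have y: "(Q0 + \<theta>) $ x $ y = (Q0 + \<theta>) $ y $ x \<longleftrightarrow> \<theta> $ x $ y = \<theta> $ y $ x" for x y
    using Q by (simp add: sym_measures_def)
  have z: "(Q0 + \<theta>) $ x $ y = 0 \<longleftrightarrow> \<theta> $ x $ y = 0" if "(x, y) \<notin> E" for x y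
    using Q that by (simp add: sym_measures_def)
  show ?thesis
    using s y z sym_measures_subset_pos_matrices unfolding sym_measures_def sym_matrices0_def sym_matrices_def pos_matrices_def by blast
qed

lemma smooth_manifold_V: "smooth_manifold (dim sym_matrices0) V"
proof (cases "V = {}")
  case True
  then show ?thesis by (simp add: smooth_manifold_def)
next
  case False
  then obtain P0 where "P0 \<in> V" by auto
  define Q0 where "Q0 = edge_matrix P0"
  have Q0: "Q0 \<in> sym_measures" unfolding Q0_def by (rule edge_matrix_V) fact
  let ?G = "(\<lambda>\<theta>. Q0 + \<theta>) -` pos_matrices"
  have tr: "Cinf UNIV (\<lambda>\<theta>. Q0 + \<theta>)" by (intro Cinf_add Cinf_const Cinf_ident open_UNIV)
  have G: "open ?G" using open_Cinf_preimage[OF tr open_pos_matrices] by simp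
  show ?thesis
  proof (rule smooth_manifold_affine[OF subspace_sym_matrices0 G])
    show "normalize_rows (Q0 + \<theta>) \<in> V" if "\<theta> \<in> sym_matrices0 \<inter> ?G" for \<theta>
      using normalize_rows_sym_measures(1) sym_measures_affine[OF Q0] that by simp
    show "edge_matrix q - Q0 \<in> sym_matrices0 \<inter> ?G" if "q \<in> V" for q
      using sym_measures_affine[OF Q0, of "edge_matrix q - Q0"] edge_matrix_V(1)[OF that] by simp
    show "edge_matrix (normalize_rows (Q0 + \<theta>)) - Q0 = \<theta>" if "\<theta> \<in> sym_matrices0 \<inter> ?G" for \<theta>
      using normalize_rows_sym_measures(2) sym_measures_affine[OF Q0] that by simp
    show "normalize_rows (Q0 + (edge_matrix q - Q0)) = q" if "q \<in> V" for q
      using edge_matrix_V(2)[OF that] by simp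
    show "Cinf ?G (\<lambda>\<theta>. normalize_rows (Q0 + \<theta>))"
      by (rule Cinf_compose[OF Cinf_subset[OF tr G] Cinf_normalize_rows]) auto
    show "Cinf stat_domain (\<lambda>q. edge_matrix q - Q0)" by (intro Cinf_diff Cinf_edge_matrix Cinf_const open_stat_domain)
    show "V \<subseteq> stat_domain" using V_subset_W W_subset_stat_domain by blast
  qed
qed

lemma tangent_V_Q_sym:
  assumes p: "p \<in> V" and v: "v \<in> tangent_space V p"
  shows "Dd (edge_weight (x, y)) p v = Dd (edge_weight (y, x)) p v"
proof (rule Dd_tangent_eq[OF v open_UNIV UNIV_I])
  have pH: "p \<in> stat_domain" using p V_subset_W W_subset_stat_domain by blast
  show "edge_weight (x, y) differentiable (at p)" "edge_weight (y, x) differentiable (at p)"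
    using Cinf_differentiable[OF Cinf_edge_weight pH] by blast+
  fix q assume "q \<in> UNIV \<inter> V"
  then have "edge_matrix q $ x $ y = edge_matrix q $ y $ x" by (simp add: V_iff)
  then show "edge_weight (x, y) q = edge_weight (y, x) q" by (simp add: edge_matrix_def)
qed

lemma Dd_normalize_rows:
  assumes Q: "Q \<in> pos_matrices"
  shows "Dd normalize_rows Q K $ x $ y = (K $ x $ y - normalize_rows Q $ x $ y * row_sum K x) / row_sum Q x"
proof -
  have r: "row_sum Q x \<noteq> 0" using Q by (metis (mono_tags, lifting) pos_matrices_def less_irrefl mem_Collect_eq)
  have "((\<lambda>Q. normalize_rows Q $ x $ y) has_derivative (\<lambda>v. Dd normalize_rows Q v $ x $ y)) (at Q)"
    using bounded_linear.has_derivative[OF bounded_linear_entry Cinf_has_derivative[OF Cinf_normalize_rows Q]] .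
  moreover have "((\<lambda>Q. normalize_rows Q $ x $ y) has_derivative (\<lambda>v. (v $ x $ y * row_sum Q x - Q $ x $ y * row_sum v x) / (row_sum Q x * row_sum Q x))) (at Q)"
    unfolding normalize_rows_def vec_lambda_beta
    by (rule has_derivative_divide'[OF has_derivative_entry has_derivative_row_sum r])
  ultimately have "(\<lambda>v. Dd normalize_rows Q v $ x $ y) = (\<lambda>v. (v $ x $ y * row_sum Q x - Q $ x $ y * row_sum v x) / (row_sum Q x * row_sum Q x))"
    by (rule has_derivative_unique)
  then have "Dd normalize_rows Q K $ x $ y = (K $ x $ y * row_sum Q x - Q $ x $ y * row_sum K x) / (row_sum Q x * row_sum Q x)"
    by (rule fun_cong)
  then show ?thesis using r by (simp add: normalize_rows_def field_simps)
qed

text \<open>The line from Q in direction \<open>K\<close> stays among symmetric measures for small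
  t, so normalising its rows gives a curve in \<open>V\<close>. The formula is its velocity, the
  derivative of Q / \<open>row_sum\<close> Q.\<close>

lemma tangent_V_I:
  assumes p: "p \<in> V" and K: "K \<in> sym_matrices0"
  shows "(\<chi> x y. (K $ x $ y - p $ x $ y * row_sum K x) / stat_ext p $ x) \<in> tangent_space V p"
proof -
  have pW: "p \<in> W" using p V_subset_W by blast
  let ?Q = "edge_matrix p"
  have Q: "?Q \<in> sym_measures" "normalize_rows ?Q = p" using edge_matrix_V[OF p] by auto
  have QP: "?Q \<in> pos_matrices" using Q sym_measures_subset_pos_matrices by blast
  have line: "Cinf UNIV (\<lambda>t::real. ?Q + t *\<^sub>R K)"
    by (intro Cinf_add Cinf_const Cinf_scaleR Cinf_ident open_UNIV)
  let ?S = "(\<lambda>t::real. ?Q + t *\<^sub>R K) -` pos_matrices"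
  have oS: "open ?S" using open_Cinf_preimage[OF line open_pos_matrices] by simp
  have D: "Dd normalize_rows ?Q K = (\<chi> x y. (K $ x $ y - p $ x $ y * row_sum K x) / stat_ext p $ x)"
    by (simp add: vec_eq_iff Dd_normalize_rows[OF QP] Q row_sum_edge_matrix[OF pW])
  show ?thesis
    unfolding D[symmetric]
  proof (rule tangent_spaceI)
    show "Cinf ?S (\<lambda>t. normalize_rows (?Q + t *\<^sub>R K))"
      by (rule Cinf_compose[OF Cinf_subset[OF line oS] Cinf_normalize_rows]) auto
    show "0 \<in> ?S" using QP by simp
    show "(\<lambda>t. normalize_rows (?Q + t *\<^sub>R K)) ` ?S \<subseteq> V"
    proof (rule image_subsetI)
      fix t assume "t \<in> ?S"
      moreover have "t *\<^sub>R K \<in> sym_matrices0" using K subspace_sym_matrices0 by (rule subspace_scale[rotated])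
      ultimately have "?Q + t *\<^sub>R K \<in> sym_measures" using sym_measures_affine[OF Q(1)] by simp
      then show "normalize_rows (?Q + t *\<^sub>R K) \<in> V" by (rule normalize_rows_sym_measures)
    qed
    show "normalize_rows (?Q + 0 *\<^sub>R K) = p" using Q by simp
    show "((\<lambda>t. normalize_rows (?Q + t *\<^sub>R K)) has_vector_derivative Dd normalize_rows ?Q K) (at 0)"
      using has_vector_derivative_Dd_curve[OF line_has_vector_derivative[of ?Q K], of normalize_rows]
        Cinf_differentiable[OF Cinf_normalize_rows QP] by simp
  qed
qed

end

section \<open>Dimension of the space of symmetric matrices\<close>

lemma span_axes_eq:
  fixes R :: "('x::finite \<times> 'x) set"
  shows "span ((\<lambda>(x, y). axis x (axis y 1)) ` R) = {v :: 'x kernel. \<forall>x y. (x, y) \<notin> R \<longrightarrow> v $ x $ y = 0}"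
    (is "span ?B = ?L")
proof (rule antisym)
  have "subspace ?L" by (auto simp: subspace_def)
  moreover have "?B \<subseteq> ?L" by (auto simp: axis_def)
  ultimately show "span ?B \<subseteq> ?L" by (rule span_minimal[rotated])
  show "?L \<subseteq> span ?B"
  proof
    fix v assume v: "v \<in> ?L"
    have "(v $ x $ y) *\<^sub>R axis x (axis y 1) \<in> span ?B" for x y
    proof (cases "(x, y) \<in> R")
      case True
      then have "axis x (axis y 1) \<in> ?B" by force
      then show ?thesis by (intro span_scale span_base)
    next
      case False
      then have "v $ x $ y = 0" using v by simp
      then show ?thesis by (simp add: span_zero)
    qed
    then have "(\<Sum>x\<in>UNIV. \<Sum>y\<in>UNIV. (v $ x $ y) *\<^sub>R axis x (axis y 1)) \<in> span ?B"
      by (intro span_sum)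
    then show "v \<in> span ?B" by (simp flip: matrix_eq_sum_axis)
  qed
qed

lemma dim_matrices_supported:
  fixes R :: "('x::finite \<times> 'x) set"
  shows "dim {v :: 'x kernel. \<forall>x y. (x, y) \<notin> R \<longrightarrow> v $ x $ y = 0} = card R"
proof -
  let ?f = "\<lambda>(x, y). axis x (axis y 1) :: 'x kernel"
  have inj: "inj_on ?f R" by (auto simp: inj_on_def axis_eq_axis)
  have "?f ` R \<subseteq> Basis" by (auto simp: Basis_vec_def)
  then have "independent (?f ` R)" using independent_Basis independent_mono by blast
  then have "dim (span (?f ` R)) = card R" by (simp add: dim_eq_card_independent card_image[OF inj])
  then show ?thesis by (simp add: span_axes_eq)
qed

context symmetric_graph
begin

text \<open>An injective numbering orders the states; \<open>R\<close> keeps one orientation of each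
  edge and all loops, so \<open>R\<close> and its converse cover \<open>E\<close> and meet in the
  loops. \<open>T\<close> reflects a matrix supported on \<open>R\<close> into a symmetric
  one.\<close>

lemma dim_sym_matrices: "2 * dim sym_matrices = card E + card {(x, x') \<in> E. x = x'}"
proof -
  obtain r :: "'x \<Rightarrow> nat" where r: "inj r"
    using finite_imp_inj_to_nat_seg[OF finite[of "UNIV :: 'x set"]] by blast
  define R where "R = {(x, y) \<in> E. r x \<le> r y}"
  have "card (R\<inverse>) = card R" by simp
  moreover have "E = R \<union> R\<inverse>" using symE by (auto simp: R_def)
  moreover have "R \<inter> R\<inverse> = {(x, x') \<in> E. x = x'}" using r by (auto simp: R_def inj_eq)
  ultimately have c: "card E + card {(x, x') \<in> E. x = x'} = 2 * card R"
    using card_Un_Int[of R "R\<inverse>"] by simp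
  define L where "L = {v :: 'x kernel. \<forall>x y. (x, y) \<notin> R \<longrightarrow> v $ x $ y = 0}"
  have subL: "subspace L" by (auto simp: L_def subspace_def)
  define T :: "'x kernel \<Rightarrow> 'x kernel" where "T = (\<lambda>v. \<chi> x y. if r x \<le> r y then v $ x $ y else v $ y $ x)"
  have lT: "linear T" by (rule linearI) (auto simp: T_def vec_eq_iff)
  have inj: "inj_on T L"
  proof (rule inj_onI)
    fix u v assume uv: "u \<in> L" "v \<in> L" "T u = T v"
    have "u $ x $ y = v $ x $ y" for x y
    proof (cases "(x, y) \<in> R")
      case True
      have "T u $ x $ y = T v $ x $ y" using uv by simp
      then show ?thesis using True by (simp add: T_def R_def)
    qed (use uv in \<open>simp add: L_def\<close>)
    then show "u = v" by (simp add: vec_eq_iff)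
  qed
  have onto: "T ` L = sym_matrices"
  proof (rule antisym)
    show "T ` L \<subseteq> sym_matrices"
    proof (rule image_subsetI)
      fix v assume v: "v \<in> L"
      have "T v $ x $ y = T v $ y $ x" for x y
      proof (cases "r x = r y")
        case True then show ?thesis using r by (simp add: inj_eq)
      next
        case False then show ?thesis by (auto simp: T_def)
      qed
      moreover have "T v $ x $ y = 0" if "(x, y) \<notin> E" for x y
        using v that symE[of y x] by (auto simp: T_def L_def R_def)
      ultimately show "T v \<in> sym_matrices" by (simp add: sym_matrices_def)
    qed
    show "sym_matrices \<subseteq> T ` L"
    proof
      fix w assume w: "w \<in> sym_matrices"
      define v where "v = (\<chi> x y. if r x \<le> r y then w $ x $ y else 0)"
      have "v \<in> L" using w by (auto simp: v_def L_def R_def sym_matrices_def)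
      moreover have "T v = w"
        using w by (auto simp: T_def v_def vec_eq_iff sym_matrices_def)
      ultimately show "w \<in> T ` L" by blast
    qed
  qed
  have "dim (T ` L) = dim L"
    by (rule dim_image_eq[OF lT]) (simp add: inj span_eq_iff[THEN iffD2, OF subL])
  then have "dim sym_matrices = card R" unfolding onto by (simp only: L_def dim_matrices_supported)
  then show ?thesis using c by simp
qed

lemma sym_measures_nonempty: "sym_measures \<noteq> {}"
proof -
  obtain e where e: "e \<in> E" using out_edge by blast
  have cE: "0 < card E" using e by (auto simp: card_gt_0_iff)
  define Q :: "'x kernel" where "Q = (\<chi> x y. if (x, y) \<in> E then 1 / card E else 0)"
  have "(\<Sum>e\<in>E. Q $ fst e $ snd e) = (\<Sum>x\<in>UNIV. row_sum Q x)"
    by (subst sum_E) (simp_all add: Q_def row_sum_def)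
  moreover have "(\<Sum>e\<in>E. Q $ fst e $ snd e) = (\<Sum>e\<in>E. 1 / card E)"
    by (rule sum.cong) (simp_all add: Q_def)
  moreover have "(\<Sum>e\<in>E. 1 / real (card E)) = 1" using e by auto
  ultimately have "(\<Sum>x\<in>UNIV. row_sum Q x) = 1" by (simp only:)
  then have "Q \<in> sym_measures" using symE cE by (auto simp: sym_measures_def Q_def)
  then show ?thesis by blast
qed

text \<open>Total mass is a linear functional on \<open>sym_matrices\<close> with kernel
  \<open>sym_matrices0\<close>, nonzero because a symmetric measure \<open>Q\<close> has mass 1;
  subtracting a multiple of \<open>Q\<close> lands in the kernel. This is the -1 in the
  dimension.\<close>

lemma dim_sym_matrices0: "dim sym_matrices = dim sym_matrices0 + 1"
proof -
  obtain Q where Q: "Q \<in> sym_measures" using sym_measures_nonempty by blast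
  have QSL: "Q \<in> sym_matrices" using Q by (simp add: sym_measures_def sym_matrices_def)
  have "span sym_matrices0 = sym_matrices0" using subspace_sym_matrices0 by (rule span_eq_iff[THEN iffD2])
  moreover have "Q \<notin> sym_matrices0" using Q by (simp add: sym_matrices0_def sym_measures_def)
  ultimately have Qn: "Q \<notin> span sym_matrices0" by (simp only: not_False_eq_True)
  have "sym_matrices = span (insert Q sym_matrices0)"
  proof (rule antisym)
    show "span (insert Q sym_matrices0) \<subseteq> sym_matrices"
      by (rule span_minimal[OF _ subspace_sym_matrices]) (use QSL in \<open>auto simp: sym_matrices0_def\<close>)
    show "sym_matrices \<subseteq> span (insert Q sym_matrices0)"
    proof
      fix v assume v: "v \<in> sym_matrices"
      define s where "s = (\<Sum>x\<in>UNIV. row_sum v x)"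
      have "v + (- s) *\<^sub>R Q \<in> sym_matrices"
        by (intro subspace_add[OF subspace_sym_matrices] subspace_scale[OF subspace_sym_matrices] v QSL)
      moreover have "(\<Sum>x\<in>UNIV. row_sum (v + (- s) *\<^sub>R Q) x) = 0"
        using Q unfolding row_sum_linear sum.distrib sum_distrib_left[symmetric] by (simp add: sym_measures_def s_def)
      ultimately have "v + (- s) *\<^sub>R Q \<in> sym_matrices0" by (simp only: sym_matrices0_def mem_Collect_eq)
      then have "(v + (- s) *\<^sub>R Q) + s *\<^sub>R Q \<in> span (insert Q sym_matrices0)"
        by (intro span_add span_scale span_base) auto
      then show "v \<in> span (insert Q sym_matrices0)" by simp
    qed
  qed
  then show ?thesis using Qn by (simp add: dim_insert)
qed

end

section \<open>Covariant derivatives of fields of reversible kernels\<close>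

definition iter_deriv :: "('a::real_normed_vector \<Rightarrow> 'a) \<Rightarrow> ('a \<Rightarrow> 'a) \<Rightarrow> ('a \<Rightarrow> 'b::real_normed_vector) \<Rightarrow> 'a \<Rightarrow> 'b" where
  "iter_deriv X Y f p = Dd (\<lambda>q. Dd f q (Y q)) p (X p)"

lemma Cinf_iter_deriv:
  fixes f :: "'a::euclidean_space \<Rightarrow> 'b::real_normed_vector"
  shows "Cinf S X \<Longrightarrow> Cinf S Y \<Longrightarrow> Cinf S f \<Longrightarrow> Cinf S (iter_deriv X Y f)"
  unfolding iter_deriv_def[abs_def] by (intro Cinf_Dd)

section \<open>The two connections as instances of the dual scheme\<close>

context connected_graph
begin

lemma edge_measure_edge_weight: "p \<in> W \<Longrightarrow> edge_measure p $ fst e $ snd e = edge_weight e p"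
  by (simp add: edge_measure_eq)

lemma log_entry_fun: "(\<lambda>P. ln (P $ fst e $ snd e)) = log_entry e"
  by (simp add: log_entry_def[abs_def])

lemma metric_log_entry_edge_weight:
  assumes p: "p \<in> W" and u: "u \<in> tangent_space W p" and v: "v \<in> tangent_space W p"
  shows "(\<Sum>e\<in>E. edge_weight e p * (Dd (log_entry e) p u * Dd (log_entry e) p v)) = (\<Sum>e\<in>E. Dd (log_entry e) p u * Dd (edge_weight e) p v)"
  by (rule tangent_W_metric_log_entry_edge_weight[OF p v, symmetric]) (use tangent_W_zero[OF p u] tangent_W_row[OF p u] in auto)

lemma dual_connection_e:
  "dual_connection E W stat_domain log_entry edge_weight log_entry (\<lambda>e P. edge_measure P $ fst e $ snd e) (christoffel_e E)"
proof
  show "\<exists>n. smooth_manifold n W" by (rule smooth_manifold_W)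
  show "christoffel_e E = (\<lambda>\<psi> i j k \<theta>. \<Sum>e\<in>E. dir_deriv i (dir_deriv j (\<lambda>\<theta>. log_entry e (\<psi> \<theta>))) \<theta> *
      dir_deriv k (\<lambda>\<theta>. edge_measure (\<psi> \<theta>) $ fst e $ snd e) \<theta>)"
    by (intro ext) (simp add: christoffel_e_def split_beta log_entry_def)
  show "(\<Sum>e\<in>E. edge_measure p $ fst e $ snd e * (Dd (\<lambda>P. ln (P $ fst e $ snd e)) p u * Dd (\<lambda>P. ln (P $ fst e $ snd e)) p v)) =
      (\<Sum>e\<in>E. Dd (log_entry e) p u * Dd (edge_weight e) p v)"
    if "p \<in> W" "u \<in> tangent_space W p" "v \<in> tangent_space W p" for p u v
    unfolding log_entry_fun edge_measure_edge_weight[OF that(1)] by (rule metric_log_entry_edge_weight[OF that])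
  show "v = 0" if "p \<in> W" "v \<in> tangent_space W p" "(\<Sum>e\<in>E. Dd (log_entry e) p v * Dd (edge_weight e) p v) = 0" for p v
    using that(3) unfolding metric_log_entry_edge_weight[OF that(1,2,2), symmetric] by (rule tangent_W_metric_pos[OF that(1,2)])
qed (use W_subset_stat_domain Cinf_edge_weight Cinf_log_entry edge_measure_edge_weight in \<open>auto simp: stat_domain_def\<close>)

lemma dual_connection_m:
  "dual_connection E W stat_domain edge_weight log_entry (\<lambda>e P. edge_measure P $ fst e $ snd e) log_entry (christoffel_m E)"
proof
  show "\<exists>n. smooth_manifold n W" by (rule smooth_manifold_W)
  show "christoffel_m E = (\<lambda>\<psi> i j k \<theta>. \<Sum>e\<in>E. dir_deriv i (dir_deriv j (\<lambda>\<theta>. edge_measure (\<psi> \<theta>) $ fst e $ snd e)) \<theta> *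
      dir_deriv k (\<lambda>\<theta>. log_entry e (\<psi> \<theta>)) \<theta>)"
    by (intro ext) (simp add: christoffel_m_def split_beta log_entry_def)
  show "(\<Sum>e\<in>E. edge_measure p $ fst e $ snd e * (Dd (\<lambda>P. ln (P $ fst e $ snd e)) p u * Dd (\<lambda>P. ln (P $ fst e $ snd e)) p v)) =
      (\<Sum>e\<in>E. Dd (edge_weight e) p u * Dd (log_entry e) p v)"
    if "p \<in> W" "u \<in> tangent_space W p" "v \<in> tangent_space W p" for p u v
    unfolding log_entry_fun edge_measure_edge_weight[OF that(1)]
    using metric_log_entry_edge_weight[OF that(1,3,2)] by (simp only: mult.commute)
  show "v = 0" if "p \<in> W" "v \<in> tangent_space W p" "(\<Sum>e\<in>E. Dd (edge_weight e) p v * Dd (log_entry e) p v) = 0" for p v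
  proof -
    have "(\<Sum>e\<in>E. Dd (log_entry e) p v * Dd (edge_weight e) p v) = 0" using that(3) by (simp only: mult.commute)
    then show ?thesis
      unfolding metric_log_entry_edge_weight[OF that(1,2,2), symmetric] by (rule tangent_W_metric_pos[OF that(1,2)])
  qed
qed (use W_subset_stat_domain Cinf_edge_weight Cinf_log_entry edge_measure_edge_weight in \<open>auto simp: stat_domain_def\<close>)

end

text \<open>Ambient extensions, on one open set, of two vector fields on \<open>V\<close>. Tangency
  is required at points of \<open>V\<close> only, so tangency and duality below refer to
  \<open>N \<inter> V\<close>, while smoothness is asserted on \<open>N\<close>.\<close>

locale local_fields = symmetric_graph E for E :: "('x::finite \<times> 'x) set" +
  fixes N :: "'x kernel set" and X Y :: "'x kernel \<Rightarrow> 'x kernel"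
  assumes X: "Cinf N X" "\<And>q. q \<in> N \<inter> V \<Longrightarrow> X q \<in> tangent_space V q"
    and Y: "Cinf N Y" "\<And>q. q \<in> N \<inter> V \<Longrightarrow> Y q \<in> tangent_space V q"
    and N: "N \<subseteq> stat_domain"
begin

lemma open_N: "open N" using X(1) by (rule Cinf_open)

lemma N_V: "q \<in> N \<inter> V \<Longrightarrow> q \<in> W" "q \<in> N \<inter> V \<Longrightarrow> Y q \<in> tangent_space W q"
  using V_subset_W Y(2) tangent_space_mono[OF V_subset_W] by blast+

lemma CQ: "Cinf N (edge_weight e)" and CL: "e \<in> E \<Longrightarrow> Cinf N (log_entry e)" and Cst: "Cinf N (\<lambda>P. stat_ext P $ x)"
  and Cen: "Cinf N (\<lambda>P. P $ x $ y)"
  using Cinf_subset[OF Cinf_edge_weight open_N N] Cinf_subset[OF Cinf_log_entry open_N N]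
    Cinf_subset[OF Cinf_stat_ext open_N N] Cinf_subset[OF Cinf_entry open_N N] by blast+

lemma N_stat: "q \<in> N \<Longrightarrow> stat_ext q $ x \<noteq> 0"
  using N unfolding stat_domain_def by (metis (mono_tags, lifting) less_irrefl mem_Collect_eq subsetD)

section \<open>The m-connection on reversible kernels\<close>

definition weight_deriv2 :: "'x kernel \<Rightarrow> 'x kernel" where
  "weight_deriv2 q = (\<chi> x y. iter_deriv X Y (edge_weight (x, y)) q)"

text \<open>On \<open>V\<close>, the image of \<open>weight_deriv2\<close> under the derivative of
  row normalisation: the direction in which Q moves with velocity X(Y Q).\<close>

definition nabla_m :: "'x kernel \<Rightarrow> 'x kernel" where
  "nabla_m q = (\<chi> x y. (weight_deriv2 q $ x $ y - q $ x $ y * row_sum (weight_deriv2 q) x) / stat_ext q $ x)"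

lemma Cinf_nabla_m: "Cinf N nabla_m"
proof (rule Cinf_matrix[OF open_N])
  have K: "Cinf N (\<lambda>q. weight_deriv2 q $ x $ y)" for x y
    using Cinf_iter_deriv[OF X(1) Y(1) CQ[of "(x, y)"]] by (simp add: weight_deriv2_def)
  have "Cinf N (\<lambda>q. (weight_deriv2 q $ x $ y - q $ x $ y * row_sum (weight_deriv2 q) x) / stat_ext q $ x)" for x y
    unfolding row_sum_def
    by (intro Cinf_divide Cinf_diff Cinf_mult Cinf_sum K Cst Cen open_N)
      (rule N_stat)
  then show "Cinf N (\<lambda>q. nabla_m q $ x $ y)" for x y by (simp add: nabla_m_def)
qed

text \<open>Symmetry, support and total mass are linear conditions on Q. They pass to dQ(Y), with
  total 0, throughout \<open>N \<inter> V\<close>, and so survive a second differentiation along X,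
  which is tangent to \<open>V\<close>.\<close>

lemma weight_deriv2_sym_matrices0:
  assumes q: "q \<in> N \<inter> V"
  shows "weight_deriv2 q \<in> sym_matrices0"
proof -
  have qN: "q \<in> N" and Xq: "X q \<in> tangent_space V q" using q X(2) by auto
  have d: "(\<lambda>q. Dd (edge_weight e) q (Y q)) differentiable (at q)" for e
    by (rule Cinf_differentiable[OF Cinf_Dd[OF CQ Y(1)] qN])
  have "weight_deriv2 q $ x $ y = weight_deriv2 q $ y $ x" for x y
    unfolding weight_deriv2_def iter_deriv_def vec_lambda_beta
    by (rule Dd_tangent_eq[OF Xq open_N qN _ d d]) (rule tangent_V_Q_sym; use Y in auto)
  moreover have "weight_deriv2 q $ x $ y = 0" if "(x, y) \<notin> E" for x y
    unfolding weight_deriv2_def iter_deriv_def vec_lambda_beta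
    by (rule Dd_tangent_const[OF Xq open_N qN _ d]) (rule tangent_W_Q_zero[OF _ _ that]; use N_V in auto)
  moreover have "(\<Sum>x\<in>UNIV. row_sum (weight_deriv2 q) x) = 0"
  proof -
    have hd: "((\<lambda>q. \<Sum>x\<in>UNIV. \<Sum>y\<in>UNIV. Dd (edge_weight (x, y)) q (Y q)) has_derivative
      (\<lambda>v. \<Sum>x\<in>UNIV. \<Sum>y\<in>UNIV. Dd (\<lambda>q. Dd (edge_weight (x, y)) q (Y q)) q v)) (at q)"
      by (intro has_derivative_sum Dd_works d)
    have "Dd (\<lambda>q. \<Sum>x\<in>UNIV. \<Sum>y\<in>UNIV. Dd (edge_weight (x, y)) q (Y q)) q (X q) = 0"
    proof (rule Dd_tangent_const[OF Xq open_N qN _ differentiableI[OF hd]])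
      fix q' assume "q' \<in> N \<inter> V"
      note q' = N_V[OF this]
      show "(\<Sum>x\<in>UNIV. \<Sum>y\<in>UNIV. Dd (edge_weight (x, y)) q' (Y q')) = 0"
        unfolding tangent_W_Q_row[OF q'] by (rule tangent_W_stat_sum[OF q'])
    qed
    then show ?thesis by (simp add: Dd_eqI[OF hd] row_sum_def weight_deriv2_def iter_deriv_def)
  qed
  ultimately show ?thesis by (simp add: sym_matrices0_def sym_matrices_def)
qed

lemma nabla_m_tangent: "q \<in> N \<inter> V \<Longrightarrow> nabla_m q \<in> tangent_space V q"
  unfolding nabla_m_def by (rule tangent_V_I) (use weight_deriv2_sym_matrices0 in auto)

text \<open>The metric identity replaces dQ of \<open>nabla_m\<close> by its logarithmic derivative,
  which is explicit: multiplied by Q it is K - P \<open>row_sum\<close> K with K =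
  \<open>weight_deriv2\<close>. The second part, paired with k / P, produces row sums of
  \<open>k\<close>, which vanish.\<close>

lemma nabla_m_dual:
  assumes q: "q \<in> N \<inter> V" and k: "k \<in> tangent_space W q"
  shows "(\<Sum>e\<in>E. Dd (edge_weight e) q (nabla_m q) * Dd (log_entry e) q k) = (\<Sum>e\<in>E. iter_deriv X Y (edge_weight e) q * Dd (log_entry e) q k)"
proof -
  have qW: "q \<in> W" using N_V q by blast
  have qH: "q \<in> stat_domain" using q N by blast
  have zW: "nabla_m q \<in> tangent_space W q"
    using nabla_m_tangent[OF q] tangent_space_mono[OF V_subset_W] by blast
  have "(\<Sum>e\<in>E. Dd (edge_weight e) q (nabla_m q) * Dd (log_entry e) q k) = (\<Sum>e\<in>E. Dd (log_entry e) q k * Dd (edge_weight e) q (nabla_m q))"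
    by (simp only: mult.commute)
  also have "\<dots> = (\<Sum>e\<in>E. edge_weight e q * (Dd (log_entry e) q k * Dd (log_entry e) q (nabla_m q)))"
    by (rule metric_log_entry_edge_weight[OF qW k zW, symmetric])
  also have "\<dots> = (\<Sum>e\<in>E. iter_deriv X Y (edge_weight e) q * Dd (log_entry e) q k - k $ fst e $ snd e * row_sum (weight_deriv2 q) (fst e))"
  proof (rule sum.cong[OF refl])
    fix e assume e: "e \<in> E"
    have pos: "q $ fst e $ snd e \<noteq> 0" "stat_ext q $ fst e \<noteq> 0"
      using W_pos[OF qW, of "fst e" "snd e"] stat_pos[OF qW, of "fst e"] e by auto
    have it: "iter_deriv X Y (edge_weight e) q = weight_deriv2 q $ fst e $ snd e" by (simp add: weight_deriv2_def)
    show "edge_weight e q * (Dd (log_entry e) q k * Dd (log_entry e) q (nabla_m q)) =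
      iter_deriv X Y (edge_weight e) q * Dd (log_entry e) q k - k $ fst e $ snd e * row_sum (weight_deriv2 q) (fst e)"
      unfolding it Dd_log_entry[OF qH e] edge_weight_def nabla_m_def vec_lambda_beta using pos by (simp add: field_simps)
  qed
  also have "\<dots> = (\<Sum>e\<in>E. iter_deriv X Y (edge_weight e) q * Dd (log_entry e) q k) - (\<Sum>e\<in>E. k $ fst e $ snd e * row_sum (weight_deriv2 q) (fst e))"
    by (rule sum_subtractf)
  also have "(\<Sum>e\<in>E. k $ fst e $ snd e * row_sum (weight_deriv2 q) (fst e)) = 0"
  proof -
    have "(\<Sum>e\<in>E. k $ fst e $ snd e * row_sum (weight_deriv2 q) (fst e)) = (\<Sum>x\<in>UNIV. (\<Sum>y\<in>UNIV. k $ x $ y) * row_sum (weight_deriv2 q) x)"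
      by (subst sum_E) (simp_all add: tangent_W_zero[OF qW k] sum_distrib_right)
    then show ?thesis by (simp add: tangent_W_row[OF qW k])
  qed
  finally show ?thesis by simp
qed

section \<open>The e-connection on reversible kernels\<close>

definition log_deriv2 :: "'x kernel \<Rightarrow> 'x kernel" where
  "log_deriv2 q = (\<chi> x y. if (x, y) \<in> E then iter_deriv X Y (log_entry (x, y)) q else 0)"

text \<open>The right-hand side collects the row sums of P X(Y log P), so on kernels the solution
  makes the rows of \<open>nabla_e\<close> sum to 0. The default 0 of \<open>log_deriv2\<close> off
  \<open>E\<close> is harmless, as kernels vanish there.\<close>

definition poisson_sol :: "'x kernel \<Rightarrow> real ^ 'x" where
  "poisson_sol q = cramer_solution (fundamental q) (\<chi> x. \<Sum>y\<in>UNIV. q $ x $ y * log_deriv2 q $ x $ y)"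

text \<open>The constant c is minus the total of \<open>poisson_sol\<close>, the term contributed by
  the all-ones matrix in \<open>fundamental\<close>.\<close>

definition nabla_e :: "'x kernel \<Rightarrow> 'x kernel" where
  "nabla_e q = (\<chi> x y. q $ x $ y * (log_deriv2 q $ x $ y + poisson_sol q $ y - poisson_sol q $ x - (\<Sum>z\<in>UNIV. poisson_sol q $ z)))"

lemma Cinf_nabla_e: "Cinf N nabla_e"
proof (rule Cinf_matrix[OF open_N])
  have F: "Cinf N (\<lambda>q. log_deriv2 q $ x $ y)" for x y
    using Cinf_iter_deriv[OF X(1) Y(1) CL[of "(x, y)"]] Cinf_const[OF open_N] by (cases "(x, y) \<in> E") (simp_all add: log_deriv2_def)
  have f: "Cinf N (\<lambda>q. poisson_sol q $ x)" for x
    unfolding poisson_sol_def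
  proof (rule Cinf_cramer_solution[OF open_N])
    show "Cinf N (\<lambda>q. fundamental q $ i $ j)" for i j
      by (rule Cinf_subset[OF Cinf_fundamental open_N]) simp
    show "Cinf N (\<lambda>q. (\<chi> x. \<Sum>y\<in>UNIV. q $ x $ y * log_deriv2 q $ x $ y) $ i)" for i
      unfolding vec_lambda_beta by (intro Cinf_sum Cinf_mult F Cen open_N)
    show "det (fundamental q) \<noteq> 0" if "q \<in> N" for q
      using that N by (auto simp: stat_domain_def)
  qed
  have "Cinf N (\<lambda>q. q $ x $ y * (log_deriv2 q $ x $ y + poisson_sol q $ y - poisson_sol q $ x - (\<Sum>z\<in>UNIV. poisson_sol q $ z)))" for x y
    by (intro Cinf_mult Cinf_diff Cinf_add Cinf_sum F f Cen open_N)
  then show "Cinf N (\<lambda>q. nabla_e q $ x $ y)" for x y by (simp add: nabla_e_def)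
qed

lemma poisson_sol_poisson:
  assumes q: "q \<in> N \<inter> V"
  shows "poisson_sol q $ x - (\<Sum>y\<in>UNIV. q $ x $ y * poisson_sol q $ y) + (\<Sum>z\<in>UNIV. poisson_sol q $ z) = (\<Sum>y\<in>UNIV. q $ x $ y * log_deriv2 q $ x $ y)"
proof -
  have "det (fundamental q) \<noteq> 0" by (rule det_fundamental) (use N_V q in blast)
  then have "fundamental q *v poisson_sol q = (\<chi> x. \<Sum>y\<in>UNIV. q $ x $ y * log_deriv2 q $ x $ y)"
    by (rule cramer_solution_iff[THEN iffD2]) (rule poisson_sol_def)
  then have "(fundamental q *v poisson_sol q) $ x = (\<Sum>y\<in>UNIV. q $ x $ y * log_deriv2 q $ x $ y)"
    by (simp only: vec_lambda_beta)
  then show ?thesis by (simp only: fundamental_mult)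
qed

text \<open>Along reversible kernels the antisymmetric part of a tangent vector, in logarithmic
  coordinates, is a coboundary; differentiating once more shows the same for \<open>log_deriv2\<close>.\<close>

definition stat_log_deriv2 :: "'x kernel \<Rightarrow> 'x \<Rightarrow> real" where
  "stat_log_deriv2 q x = Dd (\<lambda>q. Dd (\<lambda>P. stat_ext P $ x) q (Y q) / stat_ext q $ x) q (X q)"

lemma log_deriv2_antisym:
  assumes q: "q \<in> N \<inter> V" and e: "(x, y) \<in> E"
  shows "log_deriv2 q $ x $ y - log_deriv2 q $ y $ x = stat_log_deriv2 q y - stat_log_deriv2 q x"
proof -
  have e': "(y, x) \<in> E" using e by (rule symE)
  have qN: "q \<in> N" and Xq: "X q \<in> tangent_space V q" using q X(2) by auto
  let ?u = "\<lambda>x q. Dd (\<lambda>P. stat_ext P $ x) q (Y q) / stat_ext q $ x"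
  let ?L = "\<lambda>e q. Dd (log_entry e) q (Y q)"
  have dL: "?L e differentiable (at q)" if "e \<in> E" for e
    by (rule Cinf_differentiable[OF Cinf_Dd[OF CL[OF that] Y(1)] qN])
  have "Cinf N (?u x)" for x
    by (intro Cinf_divide Cinf_Dd Cst Y(1)) (rule N_stat)
  then have du: "?u x differentiable (at q)" for x
    using qN by (rule Cinf_differentiable)
  have hL: "((\<lambda>q. ?L (x, y) q - ?L (y, x) q) has_derivative (\<lambda>v. Dd (?L (x, y)) q v - Dd (?L (y, x)) q v)) (at q)"
    by (intro has_derivative_diff Dd_works dL e e')
  have hu: "((\<lambda>q. ?u y q - ?u x q) has_derivative (\<lambda>v. Dd (?u y) q v - Dd (?u x) q v)) (at q)"
    by (intro has_derivative_diff Dd_works du)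
  have "Dd (\<lambda>q. ?L (x, y) q - ?L (y, x) q) q (X q) = Dd (\<lambda>q. ?u y q - ?u x q) q (X q)"
  proof (rule Dd_tangent_eq[OF Xq open_N qN _ differentiableI[OF hL] differentiableI[OF hu]])
    fix r assume r: "r \<in> N \<inter> V"
    have rW: "r \<in> W" and rH: "r \<in> stat_domain" and rV: "r \<in> V" using N_V r N by blast+
    have pos: "0 < r $ x $ y" "0 < r $ y $ x" "0 < stat_ext r $ x" "0 < stat_ext r $ y"
      using W_pos[OF rW e] W_pos[OF rW e'] stat_pos[OF rW] by auto
    define a b where "a = Dd (\<lambda>P. stat_ext P $ x) r (Y r)" and "b = Dd (\<lambda>P. stat_ext P $ y) r (Y r)"
    have db: "stat_ext r $ x * r $ x $ y = stat_ext r $ y * r $ y $ x"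
      using rV unfolding V_iff edge_matrix_nth by blast
    have ab: "a * r $ x $ y + stat_ext r $ x * Y r $ x $ y = b * r $ y $ x + stat_ext r $ y * Y r $ y $ x"
      using tangent_V_Q_sym[OF rV Y(2)[OF r], of x y] unfolding Dd_edge_weight[OF rH] a_def b_def by simp
    \<comment> \<open>Dividing the derivative of detailed balance by detailed balance itself equates
      the logarithmic derivatives of its two sides.\<close>
    have "(a * r $ x $ y + stat_ext r $ x * Y r $ x $ y) / (stat_ext r $ x * r $ x $ y) = a / stat_ext r $ x + Y r $ x $ y / r $ x $ y"
      using pos by (simp add: field_simps)
    moreover have "(b * r $ y $ x + stat_ext r $ y * Y r $ y $ x) / (stat_ext r $ y * r $ y $ x) = b / stat_ext r $ y + Y r $ y $ x / r $ y $ x"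
      using pos by (simp add: field_simps)
    ultimately have "a / stat_ext r $ x + Y r $ x $ y / r $ x $ y = b / stat_ext r $ y + Y r $ y $ x / r $ y $ x"
      using ab db by simp
    then show "?L (x, y) r - ?L (y, x) r = ?u y r - ?u x r"
      unfolding Dd_log_entry[OF rH e] Dd_log_entry[OF rH e'] a_def b_def by simp
  qed
  then show ?thesis
    using e e' by (simp add: Dd_eqI[OF hL] Dd_eqI[OF hu] log_deriv2_def stat_log_deriv2_def iter_deriv_def)
qed

text \<open>By \<open>tangent_V_I\<close> it suffices to find \<open>K\<close> in
  \<open>sym_matrices0\<close> that yields \<open>nabla_e\<close>. Here K / Q may differ from z / P
  by any function of x, since subtracting P times the row sum removes it; this freedom is spent on
  symmetry.\<close>

lemma nabla_e_tangent:
  assumes q: "q \<in> N \<inter> V"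
  shows "nabla_e q \<in> tangent_space V q"
proof -
  have qV: "q \<in> V" and qW: "q \<in> W" using q N_V by blast+
  define s where "s = (\<Sum>z\<in>UNIV. poisson_sol q $ z)"
  \<comment> \<open>Compared with z / P, the term - f(x) is replaced by f(x) + u(x), with u =
    \<open>stat_log_deriv2 q\<close>: f(x) + f(y) is symmetric, and so is \<open>log_deriv2\<close>
    + u(x) by \<open>log_deriv2_antisym\<close>.\<close>
  define K' where "K' = (\<chi> x y. edge_matrix q $ x $ y * (log_deriv2 q $ x $ y + poisson_sol q $ y + poisson_sol q $ x + stat_log_deriv2 q x))"
  \<comment> \<open>\<open>edge_matrix q\<close> is symmetric of mass 1, so subtracting
    \<open>c\<close> times it brings the total to 0 and keeps symmetry.\<close>
  define c where "c = (\<Sum>x\<in>UNIV. row_sum K' x)"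
  define K where "K = K' + (- c) *\<^sub>R edge_matrix q"
  have Q: "edge_matrix q \<in> sym_measures" by (rule edge_matrix_V[OF qV])
  have rQ: "row_sum (edge_matrix q) x = stat_ext q $ x" for x by (rule row_sum_edge_matrix[OF qW])
  have K'sym_matrices: "K' \<in> sym_matrices"
    unfolding sym_matrices_def
  proof (intro CollectI conjI allI impI)
    fix x y
    have z: "edge_matrix q $ x $ y = 0" if "(x, y) \<notin> E" for x y using Q that by (simp add: sym_measures_def)
    show "K' $ x $ y = 0" if "(x, y) \<notin> E" using z[OF that] by (simp add: K'_def)
    show "K' $ x $ y = K' $ y $ x"
    proof (cases "(x, y) \<in> E")
      case True
      have "edge_matrix q $ x $ y = edge_matrix q $ y $ x" using Q by (simp add: sym_measures_def)
      moreover have "log_deriv2 q $ x $ y + poisson_sol q $ y + poisson_sol q $ x + stat_log_deriv2 q x = log_deriv2 q $ y $ x + poisson_sol q $ x + poisson_sol q $ y + stat_log_deriv2 q y"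
        using log_deriv2_antisym[OF q True] by simp
      ultimately show ?thesis unfolding K'_def vec_lambda_beta by (simp only:)
    next
      case False
      then have "(y, x) \<notin> E" using symE by blast
      then show ?thesis using z[OF False] z[of y x] by (simp add: K'_def)
    qed
  qed
  have QSL: "edge_matrix q \<in> sym_matrices" using Q by (simp add: sym_measures_def sym_matrices_def)
  have "K \<in> sym_matrices" unfolding K_def
    by (intro subspace_add[OF subspace_sym_matrices] subspace_scale[OF subspace_sym_matrices] K'sym_matrices QSL)
  moreover have "(\<Sum>x\<in>UNIV. row_sum K x) = 0"
    using stat_sum[OF qW] unfolding K_def row_sum_linear sum.distrib sum_distrib_left[symmetric] rQ c_def by simp
  ultimately have K0: "K \<in> sym_matrices0" by (simp add: sym_matrices0_def)
  \<comment> \<open>The Poisson equation turns the averages of \<open>log_deriv2\<close> and of f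
    into f(x) + s, whence the factor 2.\<close>
  have rK: "row_sum K x = stat_ext q $ x * (2 * poisson_sol q $ x + s + stat_log_deriv2 q x - c)" for x
  proof -
    have "row_sum K' x = stat_ext q $ x * (\<Sum>y\<in>UNIV. q $ x $ y * (log_deriv2 q $ x $ y + poisson_sol q $ y + poisson_sol q $ x + stat_log_deriv2 q x))"
      unfolding row_sum_def K'_def vec_lambda_beta edge_matrix_nth sum_distrib_left by (simp add: mult.assoc)
    also have "(\<Sum>y\<in>UNIV. q $ x $ y * (log_deriv2 q $ x $ y + poisson_sol q $ y + poisson_sol q $ x + stat_log_deriv2 q x)) =
      (\<Sum>y\<in>UNIV. q $ x $ y * log_deriv2 q $ x $ y) + (\<Sum>y\<in>UNIV. q $ x $ y * poisson_sol q $ y) + (\<Sum>y\<in>UNIV. q $ x $ y) * (poisson_sol q $ x + stat_log_deriv2 q x)"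
      unfolding sum_distrib_right sum.distrib[symmetric] by (simp add: algebra_simps)
    also have "\<dots> = 2 * poisson_sol q $ x + s + stat_log_deriv2 q x"
      using poisson_sol_poisson[OF q, of x] by (simp add: W_row[OF qW] s_def)
    finally show ?thesis unfolding K_def row_sum_linear rQ by (simp add: algebra_simps)
  qed
  have "nabla_e q = (\<chi> x y. (K $ x $ y - q $ x $ y * row_sum K x) / stat_ext q $ x)"
  proof -
    have "(K $ x $ y - q $ x $ y * row_sum K x) / stat_ext q $ x = nabla_e q $ x $ y" for x y
    proof -
      have pos: "stat_ext q $ x \<noteq> 0" using stat_pos[OF qW, of x] by simp
      have "K $ x $ y = stat_ext q $ x * (q $ x $ y * (log_deriv2 q $ x $ y + poisson_sol q $ y + poisson_sol q $ x + stat_log_deriv2 q x - c))"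
        by (simp add: K_def K'_def edge_matrix_nth algebra_simps)
      then have "K $ x $ y - q $ x $ y * row_sum K x = stat_ext q $ x * nabla_e q $ x $ y"
        unfolding rK nabla_e_def vec_lambda_beta s_def[symmetric] by (simp add: algebra_simps)
      then show ?thesis using pos by simp
    qed
    then show ?thesis by (simp add: vec_eq_iff)
  qed
  then show ?thesis using tangent_V_I[OF qV K0] by simp
qed

text \<open>z / P differs from X(Y log P) by f(y) - f(x) - s. Paired with dQ(k), the difference of f
  vanishes because the marginals coincide, and s because the total mass is 0.\<close>

lemma nabla_e_dual:
  assumes q: "q \<in> N \<inter> V" and k: "k \<in> tangent_space W q"
  shows "(\<Sum>e\<in>E. Dd (log_entry e) q (nabla_e q) * Dd (edge_weight e) q k) = (\<Sum>e\<in>E. iter_deriv X Y (log_entry e) q * Dd (edge_weight e) q k)"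
proof -
  have qW: "q \<in> W" and qH: "q \<in> stat_domain" using q N_V N by blast+
  define s where "s = (\<Sum>z\<in>UNIV. poisson_sol q $ z)"
  define D where "D = (\<lambda>x y. Dd (edge_weight (x, y)) q k)"
  define S where "S = (\<lambda>x. Dd (\<lambda>P. stat_ext P $ x) q k)"
  have row: "(\<Sum>y\<in>UNIV. D x y) = S x" for x unfolding D_def S_def by (rule tangent_W_Q_row[OF qW k])
  have col: "(\<Sum>x\<in>UNIV. D x y) = S y" for y unfolding D_def S_def by (rule tangent_W_Q_col[OF qW k])
  have tot: "(\<Sum>x\<in>UNIV. S x) = 0" unfolding S_def by (rule tangent_W_stat_sum[OF qW k])
  have "(\<Sum>e\<in>E. Dd (log_entry e) q (nabla_e q) * Dd (edge_weight e) q k) =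
    (\<Sum>e\<in>E. iter_deriv X Y (log_entry e) q * Dd (edge_weight e) q k + (poisson_sol q $ snd e - poisson_sol q $ fst e - s) * D (fst e) (snd e))"
  proof (rule sum.cong[OF refl])
    fix e assume e: "e \<in> E"
    have "0 < q $ fst e $ snd e" using W_pos[OF qW, of "fst e" "snd e"] e by simp
    then have "Dd (log_entry e) q (nabla_e q) = log_deriv2 q $ fst e $ snd e + (poisson_sol q $ snd e - poisson_sol q $ fst e - s)"
      unfolding Dd_log_entry[OF qH e] nabla_e_def vec_lambda_beta s_def by simp
    moreover have "log_deriv2 q $ fst e $ snd e = iter_deriv X Y (log_entry e) q" using e by (simp add: log_deriv2_def)
    ultimately show "Dd (log_entry e) q (nabla_e q) * Dd (edge_weight e) q k =
      iter_deriv X Y (log_entry e) q * Dd (edge_weight e) q k + (poisson_sol q $ snd e - poisson_sol q $ fst e - s) * D (fst e) (snd e)"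
      by (simp add: D_def distrib_right)
  qed
  also have "\<dots> = (\<Sum>e\<in>E. iter_deriv X Y (log_entry e) q * Dd (edge_weight e) q k) + (\<Sum>e\<in>E. (poisson_sol q $ snd e - poisson_sol q $ fst e - s) * D (fst e) (snd e))"
    by (rule sum.distrib)
  also have "(\<Sum>e\<in>E. (poisson_sol q $ snd e - poisson_sol q $ fst e - s) * D (fst e) (snd e)) = 0"
  proof -
    have "(\<Sum>e\<in>E. (poisson_sol q $ snd e - poisson_sol q $ fst e - s) * D (fst e) (snd e)) =
      (\<Sum>x\<in>UNIV. \<Sum>y\<in>UNIV. (poisson_sol q $ y - poisson_sol q $ x - s) * D x y)"
      by (subst sum_E) (simp_all add: D_def tangent_W_Q_zero[OF qW k])
    also have "\<dots> = (\<Sum>x\<in>UNIV. \<Sum>y\<in>UNIV. poisson_sol q $ y * D x y) - (\<Sum>x\<in>UNIV. (poisson_sol q $ x + s) * (\<Sum>y\<in>UNIV. D x y))"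
      unfolding sum_distrib_left sum_subtractf[symmetric] by (simp add: algebra_simps)
    also have "(\<Sum>x\<in>UNIV. \<Sum>y\<in>UNIV. poisson_sol q $ y * D x y) = (\<Sum>y\<in>UNIV. poisson_sol q $ y * (\<Sum>x\<in>UNIV. D x y))"
      unfolding sum_distrib_left by (rule sum.swap)
    also have "\<dots> - (\<Sum>x\<in>UNIV. (poisson_sol q $ x + s) * (\<Sum>y\<in>UNIV. D x y)) = - s * (\<Sum>x\<in>UNIV. S x)"
      unfolding row col sum_distrib_left sum_subtractf[symmetric] by (simp add: algebra_simps)
    finally show ?thesis by (simp add: tot)
  qed
  finally show ?thesis by simp
qed

end

section \<open>From local formulas to vector fields on the submanifold\<close>

context symmetric_graph
begin

lemma vector_fields_local:
  assumes "X \<in> vector_fields V" "Y \<in> vector_fields V" "p \<in> V"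
  obtains N Xt Yt where "local_fields E N Xt Yt" "p \<in> N" "\<forall>q \<in> N \<inter> V. X q = Xt q \<and> Y q = Yt q"
proof -
  obtain N1 Xt where 1: "Cinf N1 Xt" "p \<in> N1" "\<forall>q\<in>N1 \<inter> V. X q = Xt q"
    using assms unfolding vector_fields_def smooth_on_Cinf by blast
  obtain N2 Yt where 2: "Cinf N2 Yt" "p \<in> N2" "\<forall>q\<in>N2 \<inter> V. Y q = Yt q"
    using assms unfolding vector_fields_def smooth_on_Cinf by blast
  have XY: "X q \<in> tangent_space V q" "Y q \<in> tangent_space V q" if "q \<in> V" for q
    using assms that by (auto simp: vector_fields_def)
  define N where "N = N1 \<inter> N2 \<inter> stat_domain"
  have o: "open N" unfolding N_def using Cinf_open[OF 1(1)] Cinf_open[OF 2(1)] open_stat_domain by (intro open_Int)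
  have eq: "\<forall>q \<in> N \<inter> V. X q = Xt q \<and> Y q = Yt q" using 1(3) 2(3) by (auto simp: N_def)
  have "local_fields E N Xt Yt"
  proof unfold_locales
    show "Cinf N Xt" by (rule Cinf_subset[OF 1(1) o]) (auto simp: N_def)
    show "Cinf N Yt" by (rule Cinf_subset[OF 2(1) o]) (auto simp: N_def)
    show "N \<subseteq> stat_domain" by (auto simp: N_def)
    fix q assume "q \<in> N \<inter> V"
    then show "Xt q \<in> tangent_space V q" "Yt q \<in> tangent_space V q"
      using XY[of q] eq by auto
  qed
  moreover have "p \<in> N" using 1(2) 2(2) assms(3) V_subset_W W_subset_stat_domain by (auto simp: N_def)
  ultimately show ?thesis using eq that by blast
qed

text \<open>\<open>z\<close> takes the extended fields as arguments because its formula
  differentiates in the ambient space. By \<open>nabla_eqI\<close> its values on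
  \<open>N \<inter> V\<close> are those of \<open>nabla\<close>, so it is a local smooth extension
  of \<open>nabla\<close>.\<close>

lemma autoparallelI:
  assumes dc: "dual_connection E W stat_domain a b A B G"
    and z: "\<And>N X Y q. local_fields E N X Y \<Longrightarrow> Cinf N (z X Y)"
      "\<And>N X Y q. local_fields E N X Y \<Longrightarrow> q \<in> N \<inter> V \<Longrightarrow> z X Y q \<in> tangent_space V q"
      "\<And>N X Y q k. local_fields E N X Y \<Longrightarrow> q \<in> N \<inter> V \<Longrightarrow> k \<in> tangent_space W q \<Longrightarrow>
        (\<Sum>e\<in>E. Dd (a e) q (z X Y q) * Dd (b e) q k) = (\<Sum>e\<in>E. iter_deriv X Y (a e) q * Dd (b e) q k)"
  shows "autoparallel E G V"
  unfolding autoparallel_def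
proof (intro ballI)
  fix X Y assume XY: "X \<in> vector_fields V" "Y \<in> vector_fields V"
  have "\<exists>N g. Cinf N g \<and> p \<in> N \<and> (\<forall>q\<in>N \<inter> V. nabla E G V X Y q = g q \<and> g q \<in> tangent_space V q)"
    if p: "p \<in> V" for p
  proof -
    obtain N Xt Yt where lf: "local_fields E N Xt Yt" and pN: "p \<in> N"
      and eq: "\<forall>q \<in> N \<inter> V. X q = Xt q \<and> Y q = Yt q"
      by (rule vector_fields_local[OF XY p])
    interpret local_fields E N Xt Yt by (fact lf)
    have "nabla E G V X Y q = z Xt Yt q" if q: "q \<in> N \<inter> V" for q
    proof (rule dual_connection.nabla_eqI[OF dc V_subset_W, where N' = N and Yt = Yt])
      show "q \<in> V" "q \<in> N" using q by auto
      show "X q \<in> tangent_space V q" using X(2)[OF q] eq q by simp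
      show "Cinf N Yt" by (rule local.Y(1))
      show "Yt r \<in> tangent_space W r" if "r \<in> N \<inter> V" for r by (rule N_V[OF that])
      show "Y r = Yt r" if "r \<in> N \<inter> V" for r using eq that by simp
      show "z Xt Yt q \<in> tangent_space W q"
        using z(2)[OF lf q] tangent_space_mono[OF V_subset_W] by blast
      fix k assume "k \<in> tangent_space W q"
      from z(3)[OF lf q this]
      show "(\<Sum>e\<in>E. Dd (a e) q (z Xt Yt q) * Dd (b e) q k) = (\<Sum>e\<in>E. Dd (\<lambda>q. Dd (a e) q (Yt q)) q (X q) * Dd (b e) q k)"
        using eq q by (simp add: iter_deriv_def)
    qed
    then show ?thesis using z(1,2)[OF lf] pN by blast
  qed
  then have *: "\<forall>p\<in>V. \<exists>N g. Cinf N g \<and> p \<in> N \<and> (\<forall>q\<in>N \<inter> V. nabla E G V X Y q = g q \<and> g q \<in> tangent_space V q)"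
    by blast
  have "smooth_on V (nabla E G V X Y)"
    unfolding smooth_on_Cinf using * by meson
  moreover have "nabla E G V X Y p \<in> tangent_space V p" if "p \<in> V" for p
    using * that by (metis IntI)
  ultimately show "nabla E G V X Y \<in> vector_fields V" by (simp add: vector_fields_def)
qed

lemma autoparallel_e: "autoparallel E (christoffel_e E) V"
  by (rule autoparallelI[OF dual_connection_e, of "local_fields.nabla_e E"])
    (rule local_fields.Cinf_nabla_e local_fields.nabla_e_tangent local_fields.nabla_e_dual; assumption)+

lemma autoparallel_m: "autoparallel E (christoffel_m E) V"
  by (rule autoparallelI[OF dual_connection_m, of local_fields.nabla_m])
    (rule local_fields.Cinf_nabla_m local_fields.nabla_m_tangent local_fields.nabla_m_dual; assumption)+

end

theorem theorem5p4:
  fixes E :: "('x::finite \<times> 'x) set"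
  assumes "CARD('x) \<ge> 2"
    and "\<forall>x y. (x, y) \<in> E\<^sup>*"
    and "sym E"
  shows "doubly_autoparallel_submanifold E (reversible_kernels E) \<and>
    (\<exists>m. smooth_manifold m (reversible_kernels E) \<and>
         real m = (real (card E) + real (card {(x, x') \<in> E. x = x'})) / 2 - 1)"
proof -
  interpret symmetric_graph E
    by unfold_locales (use assms in \<open>auto dest: symD\<close>)
  \<comment> \<open>Kept as a doubled equation in the naturals; halving and subtracting 1 happen
    only in the reals.\<close>
  have "2 * (dim sym_matrices0 + 1) = card E + card {(x, x') \<in> E. x = x'}"
    using dim_sym_matrices dim_sym_matrices0 by simp
  then have "2 * (real (dim sym_matrices0) + 1) = real (card E) + real (card {(x, x') \<in> E. x = x'})"
    by (metis (mono_tags, lifting) of_nat_1 of_nat_add of_nat_mult of_nat_numeral)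
  then have "real (dim sym_matrices0) = (real (card E) + real (card {(x, x') \<in> E. x = x'})) / 2 - 1"
    by (simp add: field_simps)
  moreover have "smooth_submanifold V W"
    unfolding smooth_submanifold_def using V_subset_W smooth_manifold_W smooth_manifold_V by blast
  ultimately show ?thesis
    unfolding doubly_autoparallel_submanifold_def
    using autoparallel_e autoparallel_m smooth_manifold_V by blast
qed

end
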